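(* Let $S=(W,\mathcal W,m,\mathbb D,\Gamma)$ be an error structure admitting a D-gradient $D:\mathbb D\to L^2(m,H)$ with $H$ a separable Hilbert space, and let $\nu$ be an $H$-valued white noise measure on $(W,\mathcal W)$ with associated positive measure $m$. Let $X\in\mathbb D^d$, let $S_X=(\mathbb R^d,\mathcal B(\mathbb R^d),X_*m,\mathbb D_X,\Gamma_X)$ be the image of $S$ by $X$, for $F\in\mathbb D_X$ let $d_GF=X_*(d_G(F\circ X))$, and let $I$ be the identity map of $\mathbb R^d$. Then for every $F\in\mathbb D_X$ there exists an element of $L^2(\mathbb R^d,\underline{\underline{\Gamma}}_X[I]\cdot X_*m)$, denoted $\nabla_XF$, such that $$d_GF=(\nabla_XF)^t\,d_GI.$$ Moreover $$\Gamma_X[F]=(\nabla_XF)^t\,\underline{\underline{\Gamma}}_X[I]\,\nabla_XF,$$ and on the initial structure $$d_G(F\circ X)=(\nabla_XF)^t\circ X\; d_GX.$$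
   Context: **Error structure.** $(W,\mathcal W,m,\mathbb D,\Gamma)$ is an error structure if $(W,\mathcal W,m)$ is a probability space and: (1) $\mathbb D$ is a dense vector subspace of $L^2(W,\mathcal W,m)$; (2) $\Gamma$ is a symmetric positive bilinear operator from $\mathbb D\times\mathbb D$ into $L^1(m)$ such that for $u\in\mathbb D^k$, $v\in\mathbb D^n$ and $F:\mathbb R^k\to\mathbb R$, $G:\mathbb R^n\to\mathbb R$ Lipschitz and $C^1$, one has $F(u)\in\mathbb D$, $G(v)\in\mathbb D$ and $\Gamma[F(u),G(v)]=\sum_{i,j}F_i'(u)G_j'(v)\Gamma[u_i,v_j]$ $m$-a.e.; (3) the form $\mathcal E[u,v]=\frac12\int\Gamma[u,v]\,dm$ is closed, i.e. $\mathbb D$ is complete for the norm $\|u\|_{\mathbb D}=(\|u\|_{L^2(m)}^2+\mathcal E[u,u])^{1/2}$. One writes $\Gamma[u]=\Gamma[u,u]$. **Image structure.** For $X\in\mathbb D^d$, $S_X=(\mathbb R^d,\mathcal B(\mathbb R^d),X_*m,\mathbb D_X,\Gamma_X)$, where $X_*m$ is the image measure of $m$ by $X$, $\mathbb D_X$ is the closure (in $L^2(X_*m)$-classes) of the space of $C^1$ Lipschitz functions $u:\mathbb R^d\to\mathbb R$ for the norm $\|u\|_{\mathbb D_X}=\|u\circ X\|_{\mathbb D}$, and $\Gamma_X[u](x)=\mathbb E[\Gamma[u\circ X]\mid X=x]$ (conditional expectation under $m$; $\Gamma_X[u,v]$ by polarization). $S_X$ is again an error structure (known), and $F\in\mathbb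 D_X$ implies $F\circ X\in\mathbb D$. The identity map $I=(I_1,\dots,I_d)$ of $\mathbb R^d$ belongs to $(\mathbb D_X)^d$. **D-gradient.** A D-gradient for the error structure, with auxiliary separable Hilbert space $H$, is a linear map $D:\mathbb D\to L^2(m,H)$ with $\|D[U]\|_H^2=\Gamma[U]$ $m$-a.e. for all $U\in\mathbb D$. **Scalar white noise measures.** Let $\mu$ be a bounded positive measure on a measurable space $(E,\mathcal F)$. A (Gaussian) white noise measure on $(E,\mathcal F)$ defined on a probability space $(\Omega,\mathcal A,\mathbb P)$ with associated positive measure $\mu$ is a map $\lambda:\mathcal F\to L^2(\Omega,\mathcal A,\mathbb P)$ such that $\lambda(A)$ is a centered Gaussian variable with variance $\mu(A)$ for all $A\in\mathcal F$; $A\mapsto\lambda(A)$ is $\sigma$-additive in $L^2(\Omega,\mathcal A,\mathbb P)$; and $\lambda(A_1),\dots,\lambda(A_k)$ are independent whenever $A_1,\dots,A_k\in\mathcal F$ are pairwise disjoint. It extends uniquely to a linear isometry $f\mapsto\lambda(f)=\int f\,d\lambda$ from $L^2(E,\mathcal F,\mu)$ into $L^2(\Omega,\mathcal A,\mathbb P)$. Equalities between white noise measures mean equality in $L^2(\Omega,\mathcal A,\mathbb P)$ of the values on every measurable set. **$H$-valued white noise and measure-valued gradient.** An $H$-valued white noise measure $\nu$ on $(W,\mathcal W)$ with associated positive measure $m$ is the formal series $\nu=\sum_n\nu_n\chi_n$, where $(\chi_n)$ is a complete orthonormal system of $H$ and $(\nu_n)$ are independent scalar white noise measures on $(W,\mathcal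 W)$, defined on a common probability space $(\Omega,\mathcal A,\mathbb P)$, each with associated positive measure $m$. For $\psi\in L^2(m,H)$, $(\psi,\nu)$ is the scalar white noise measure on $(W,\mathcal W)$ defined by $(\psi,\nu)(A)=\sum_n\nu_n(1_A\langle\psi,\chi_n\rangle_H)$, $A\in\mathcal W$ (series converging in $L^2(\Omega,\mathcal A,\mathbb P)$); its associated positive measure is $\|\psi\|_H^2\cdot m$. For $Y\in\mathbb D$, the measure-valued gradient of $Y$ is $d_GY=(DY,\nu)$; for $Y\in\mathbb D^d$, $d_GY$ is the column vector $(d_GY_1,\dots,d_GY_d)^t$, an $\mathbb R^d$-valued white noise measure. **Images.** For a white noise measure $\lambda$ on $(W,\mathcal W)$, $X_*\lambda$ is defined by $(X_*\lambda)(A)=\lambda(X^{-1}(A))$, $A\in\mathcal B(\mathbb R^d)$ (componentwise for vector-valued $\lambda$). For $F\in\mathbb D_X$, $d_GF=X_*(d_G(F\circ X))$; for $\Phi=(\Phi_1,\dots,\Phi_k)\in(\mathbb D_X)^k$, $d_G\Phi$ is the column vector $(d_G\Phi_i)$. In particular $d_GI=X_*d_GX$. **Weighted $L^2$ spaces and products.** $\underline{\underline{\Gamma}}_X[I]$ is the matrix $(\Gamma_X[I_i,I_j])_{ij}$ and $\underline{\underline{\Gamma}}[X]$ the matrix $(\Gamma[X_i,X_j])_{ij}$. $L^2(\mathbb R^d,\underline{\underline{\Gamma}}_X[I]\cdot X_*m)$ is the space of $d$-tuples $v=(v_1,\dots,v_d)$ (column vectors) of measurable functions on $\mathbb R^d$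 with $\|v\|^2=\int v^t\underline{\underline{\Gamma}}_X[I]v\,dX_*m<\infty$, where $v,v'$ are identified if $\|v-v'\|=0$; $L^2(W,\underline{\underline{\Gamma}}[X]\cdot m)$ is defined in the same way on $(W,\mathcal W,m)$. For bounded measurable $\varphi:\mathbb R^d\to\mathbb R^d$, $\varphi^t\,d_GI$ is the map $A\mapsto\sum_i\int1_A\varphi_i\,d(d_GI_i)$; since $\mathbb E_{\mathbb P}[(\varphi^t d_GI)(A)^2]=\int_A\varphi^t\underline{\underline{\Gamma}}_X[I]\varphi\,dX_*m$, this extends by continuity to $\varphi\in L^2(\mathbb R^d,\underline{\underline{\Gamma}}_X[I]\cdot X_*m)$. Likewise $\varphi^t\,d_GX$ is defined for $\varphi\in L^2(W,\underline{\underline{\Gamma}}[X]\cdot m)$; note that $v\circ X$ belongs to this space when $v\in L^2(\mathbb R^d,\underline{\underline{\Gamma}}_X[I]\cdot X_*m)$. *)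

theory Defs
  imports "HOL-Probability.Probability"
begin

section \<open>Square integrable functions\<close>

text \<open>
  Elements of \<open>L\<^sup>2\<close> are handled through measurable representatives: sets of functions
  are closed under almost everywhere equality, and identities between classes are
  stated almost everywhere.
\<close>

definition L2 :: "'a measure \<Rightarrow> ('a \<Rightarrow> 'b::{second_countable_topology,real_normed_vector}) set" where
  "L2 M = {f \<in> borel_measurable M. integrable M (\<lambda>x. (norm (f x))\<^sup>2)}"

definition L2_norm :: "'a measure \<Rightarrow> ('a \<Rightarrow> 'b::{second_countable_topology,real_normed_vector}) \<Rightarrow> real" where
  "L2_norm M f = sqrt (\<integral>x. (norm (f x))\<^sup>2 \<partial>M)"

definition L2_tendsto :: "'a measure \<Rightarrow> (nat \<Rightarrow> 'a \<Rightarrow> real) \<Rightarrow> ('a \<Rightarrow> real) \<Rightarrow> bool" where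
  "L2_tendsto M f g \<longleftrightarrow> (\<lambda>n. L2_norm M (\<lambda>x. f n x - g x)) \<longlonglongrightarrow> 0"

definition L2_lim :: "'a measure \<Rightarrow> (nat \<Rightarrow> 'a \<Rightarrow> real) \<Rightarrow> 'a \<Rightarrow> real" where
  "L2_lim M f = (SOME g. g \<in> L2 M \<and> L2_tendsto M f g)"


section \<open>Error structures\<close>

text \<open>
  The functional calculus of an error structure ranges over all numbers of variables, so
  a function on \<open>\<real>\<^sup>k\<close> is rendered as a function \<open>F\<close> of a sequence. The Lipschitz bound
  only involves the first \<open>k\<close> coordinates, hence \<open>F\<close> depends on these only, and so do its
  partial derivatives \<open>F' i\<close>; for such functions, continuity in the product topology of
  \<open>nat \<Rightarrow> real\<close> is continuity on \<open>\<real>\<^sup>k\<close>.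
\<close>

definition C1_lipschitz_coords ::
    "nat \<Rightarrow> ((nat \<Rightarrow> real) \<Rightarrow> real) \<Rightarrow> (nat \<Rightarrow> (nat \<Rightarrow> real) \<Rightarrow> real) \<Rightarrow> bool" where
  "C1_lipschitz_coords k F F' \<longleftrightarrow>
     (\<exists>L. \<forall>x y. \<bar>F x - F y\<bar> \<le> L * L2_set (\<lambda>i. x i - y i) {..<k}) \<and>
     (\<forall>i<k. (\<forall>x. ((\<lambda>t. F (x(i := t))) has_real_derivative F' i x) (at (x i))) \<and>
            continuous_on UNIV (F' i))"

definition energy :: "'w measure \<Rightarrow> (('w \<Rightarrow> real) \<Rightarrow> ('w \<Rightarrow> real) \<Rightarrow> 'w \<Rightarrow> real)
    \<Rightarrow> ('w \<Rightarrow> real) \<Rightarrow> ('w \<Rightarrow> real) \<Rightarrow> real" where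
  "energy m \<Gamma> u v = (1/2) * (\<integral>w. \<Gamma> u v w \<partial>m)"

definition dom_norm :: "'w measure \<Rightarrow> (('w \<Rightarrow> real) \<Rightarrow> ('w \<Rightarrow> real) \<Rightarrow> 'w \<Rightarrow> real)
    \<Rightarrow> ('w \<Rightarrow> real) \<Rightarrow> real" where
  "dom_norm m \<Gamma> u = sqrt ((L2_norm m u)\<^sup>2 + energy m \<Gamma> u u)"

locale error_structure = prob_space m
  for m :: "'w measure" and \<D> :: "('w \<Rightarrow> real) set"
    and \<Gamma> :: "('w \<Rightarrow> real) \<Rightarrow> ('w \<Rightarrow> real) \<Rightarrow> 'w \<Rightarrow> real" +
  assumes dom_L2: "\<D> \<subseteq> L2 m"
    and dom_AE_cong: "\<lbrakk>u \<in> \<D>; v \<in> borel_measurable m; AE w in m. u w = v w\<rbrakk> \<Longrightarrow> v \<in> \<D>"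
    and dom_zero: "(\<lambda>w. 0) \<in> \<D>"
    and dom_add: "\<lbrakk>u \<in> \<D>; v \<in> \<D>\<rbrakk> \<Longrightarrow> (\<lambda>w. u w + v w) \<in> \<D>"
    and dom_scale: "u \<in> \<D> \<Longrightarrow> (\<lambda>w. c * u w) \<in> \<D>"
    and dom_dense: "\<lbrakk>f \<in> L2 m; 0 < e\<rbrakk> \<Longrightarrow> \<exists>u\<in>\<D>. L2_norm m (\<lambda>w. f w - u w) < e"
    and Gamma_L1: "\<lbrakk>u \<in> \<D>; v \<in> \<D>\<rbrakk> \<Longrightarrow> integrable m (\<Gamma> u v)"
    and Gamma_AE_cong: "\<lbrakk>u \<in> \<D>; u' \<in> \<D>; v \<in> \<D>; AE w in m. u w = u' w\<rbrakk>
          \<Longrightarrow> AE w in m. \<Gamma> u v w = \<Gamma> u' v w"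
    and Gamma_sym: "\<lbrakk>u \<in> \<D>; v \<in> \<D>\<rbrakk> \<Longrightarrow> AE w in m. \<Gamma> u v w = \<Gamma> v u w"
    and Gamma_add: "\<lbrakk>u \<in> \<D>; u' \<in> \<D>; v \<in> \<D>\<rbrakk>
          \<Longrightarrow> AE w in m. \<Gamma> (\<lambda>z. u z + u' z) v w = \<Gamma> u v w + \<Gamma> u' v w"
    and Gamma_scale: "\<lbrakk>u \<in> \<D>; v \<in> \<D>\<rbrakk> \<Longrightarrow> AE w in m. \<Gamma> (\<lambda>z. c * u z) v w = c * \<Gamma> u v w"
    and Gamma_pos: "u \<in> \<D> \<Longrightarrow> AE w in m. 0 \<le> \<Gamma> u u w"
    and dom_comp: "\<lbrakk>C1_lipschitz_coords k F F'; \<forall>i<k. U i \<in> \<D>\<rbrakk>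
          \<Longrightarrow> (\<lambda>w. F (\<lambda>i. U i w)) \<in> \<D>"
    and Gamma_comp: "\<lbrakk>C1_lipschitz_coords k F F'; \<forall>i<k. U i \<in> \<D>;
           C1_lipschitz_coords n G G'; \<forall>j<n. V j \<in> \<D>\<rbrakk>
          \<Longrightarrow> AE w in m. \<Gamma> (\<lambda>z. F (\<lambda>i. U i z)) (\<lambda>z. G (\<lambda>j. V j z)) w =
               (\<Sum>i<k. \<Sum>j<n. F' i (\<lambda>l. U l w) * G' j (\<lambda>l. V l w) * \<Gamma> (U i) (V j) w)"
    and closed_form: "\<lbrakk>\<forall>n. s n \<in> \<D>;
           \<forall>e>0. \<exists>n0. \<forall>p\<ge>n0. \<forall>q\<ge>n0. dom_norm m \<Gamma> (\<lambda>w. s p w - s q w) < e\<rbrakk>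
          \<Longrightarrow> \<exists>u\<in>\<D>. (\<lambda>n. dom_norm m \<Gamma> (\<lambda>w. s n w - u w)) \<longlonglongrightarrow> 0"


section \<open>The image structure\<close>

definition C1_lipschitz :: "(real ^ 'd \<Rightarrow> real) \<Rightarrow> bool" where
  "C1_lipschitz u \<longleftrightarrow> (\<exists>L. L-lipschitz_on UNIV u) \<and>
     (\<exists>g. (\<forall>x. GDERIV u x :> g x) \<and> continuous_on UNIV g)"

abbreviation image_measure :: "'w measure \<Rightarrow> ('w \<Rightarrow> real ^ 'd) \<Rightarrow> (real ^ 'd) measure" where
  "image_measure m X \<equiv> distr m borel X"

definition image_dom :: "'w measure \<Rightarrow> ('w \<Rightarrow> real) set
    \<Rightarrow> (('w \<Rightarrow> real) \<Rightarrow> ('w \<Rightarrow> real) \<Rightarrow> 'w \<Rightarrow> real) \<Rightarrow> ('w \<Rightarrow> real ^ 'd) \<Rightarrow> (real ^ 'd \<Rightarrow> real) set" where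
  "image_dom m \<D> \<Gamma> X = {F \<in> L2 (image_measure m X). F \<circ> X \<in> \<D> \<and>
     (\<forall>e>0. \<exists>u. C1_lipschitz u \<and> dom_norm m \<Gamma> ((\<lambda>x. F x - u x) \<circ> X) < e)}"

text \<open>A version of \<open>x \<mapsto> E[f | X = x]\<close>: a Borel function that yields \<open>E[f | \<sigma>(X)]\<close>
  when composed with \<open>X\<close>.\<close>

definition cond_exp_at :: "'w measure \<Rightarrow> ('w \<Rightarrow> real ^ 'd) \<Rightarrow> ('w \<Rightarrow> real) \<Rightarrow> real ^ 'd \<Rightarrow> real" where
  "cond_exp_at m X f = (SOME g. g \<in> borel_measurable borel \<and>
     (AE w in m. g (X w) = real_cond_exp m (vimage_algebra (space m) X borel) f w))"

definition image_Gamma1 :: "'w measure \<Rightarrow> (('w \<Rightarrow> real) \<Rightarrow> ('w \<Rightarrow> real) \<Rightarrow> 'w \<Rightarrow> real)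
    \<Rightarrow> ('w \<Rightarrow> real ^ 'd) \<Rightarrow> (real ^ 'd \<Rightarrow> real) \<Rightarrow> real ^ 'd \<Rightarrow> real" where
  "image_Gamma1 m \<Gamma> X u = cond_exp_at m X (\<Gamma> (u \<circ> X) (u \<circ> X))"

definition image_Gamma :: "'w measure \<Rightarrow> (('w \<Rightarrow> real) \<Rightarrow> ('w \<Rightarrow> real) \<Rightarrow> 'w \<Rightarrow> real)
    \<Rightarrow> ('w \<Rightarrow> real ^ 'd) \<Rightarrow> (real ^ 'd \<Rightarrow> real) \<Rightarrow> (real ^ 'd \<Rightarrow> real) \<Rightarrow> real ^ 'd \<Rightarrow> real" where
  "image_Gamma m \<Gamma> X u v x =
     (image_Gamma1 m \<Gamma> X (\<lambda>y. u y + v y) x - image_Gamma1 m \<Gamma> X (\<lambda>y. u y - v y) x) / 4"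

definition Gamma_matrix :: "(('w \<Rightarrow> real) \<Rightarrow> ('w \<Rightarrow> real) \<Rightarrow> 'w \<Rightarrow> real)
    \<Rightarrow> ('w \<Rightarrow> real ^ 'd) \<Rightarrow> 'w \<Rightarrow> real ^ 'd ^ 'd" where
  "Gamma_matrix \<Gamma> X w = (\<chi> i j. \<Gamma> (\<lambda>z. X z $ i) (\<lambda>z. X z $ j) w)"

definition image_Gamma_matrix :: "'w measure \<Rightarrow> (('w \<Rightarrow> real) \<Rightarrow> ('w \<Rightarrow> real) \<Rightarrow> 'w \<Rightarrow> real)
    \<Rightarrow> ('w \<Rightarrow> real ^ 'd) \<Rightarrow> real ^ 'd \<Rightarrow> real ^ 'd ^ 'd" where
  "image_Gamma_matrix m \<Gamma> X = Gamma_matrix (image_Gamma m \<Gamma> X) (\<lambda>x. x)"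


section \<open>Gradients\<close>

definition D_gradient :: "'w measure \<Rightarrow> ('w \<Rightarrow> real) set
    \<Rightarrow> (('w \<Rightarrow> real) \<Rightarrow> ('w \<Rightarrow> real) \<Rightarrow> 'w \<Rightarrow> real)
    \<Rightarrow> (('w \<Rightarrow> real) \<Rightarrow> 'w \<Rightarrow> 'h::{real_inner,banach,second_countable_topology}) \<Rightarrow> bool" where
  "D_gradient m \<D> \<Gamma> D \<longleftrightarrow>
     (\<forall>u\<in>\<D>. D u \<in> L2 m) \<and>
     (\<forall>u\<in>\<D>. \<forall>v\<in>\<D>. (AE w in m. u w = v w) \<longrightarrow> (AE w in m. D u w = D v w)) \<and>
     (\<forall>u\<in>\<D>. \<forall>v\<in>\<D>. AE w in m. D (\<lambda>z. u z + v z) w = D u w + D v w) \<and>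
     (\<forall>u\<in>\<D>. \<forall>c. AE w in m. D (\<lambda>z. c * u z) w = c *\<^sub>R D u w) \<and>
     (\<forall>u\<in>\<D>. AE w in m. (norm (D u w))\<^sup>2 = \<Gamma> u u w)"


section \<open>White noise measures\<close>

definition centered_gaussian :: "real \<Rightarrow> real measure" where
  "centered_gaussian v =
     (if v = 0 then return borel 0 else density lborel (\<lambda>x. ennreal (normal_density 0 (sqrt v) x)))"

definition white_noise :: "'o measure \<Rightarrow> 'e measure \<Rightarrow> ('e set \<Rightarrow> 'o \<Rightarrow> real) \<Rightarrow> bool" where
  "white_noise P \<mu> lam \<longleftrightarrow> prob_space P \<and> finite_measure \<mu> \<and>
     (\<forall>A\<in>sets \<mu>. lam A \<in> L2 P \<and> distr P borel (lam A) = centered_gaussian (measure \<mu> A)) \<and>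
     (\<forall>A. range A \<subseteq> sets \<mu> \<and> disjoint_family A \<longrightarrow>
        L2_tendsto P (\<lambda>n \<omega>. \<Sum>i<n. lam (A i) \<omega>) (lam (\<Union>i. A i))) \<and>
     (\<forall>k::nat. \<forall>A. A ` {..<k} \<subseteq> sets \<mu> \<and> disjoint_family_on A {..<k} \<longrightarrow>
        prob_space.indep_vars P (\<lambda>_. borel) (\<lambda>i. lam (A i)) {..<k})"

definition wn_eq :: "'o measure \<Rightarrow> 'e measure \<Rightarrow> ('e set \<Rightarrow> 'o \<Rightarrow> real) \<Rightarrow> ('e set \<Rightarrow> 'o \<Rightarrow> real) \<Rightarrow> bool" where
  "wn_eq P M lam lam' \<longleftrightarrow> (\<forall>A\<in>sets M. AE \<omega> in P. lam A \<omega> = lam' A \<omega>)"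

definition isometric_extension :: "'o measure \<Rightarrow> 'e measure \<Rightarrow> ('e set \<Rightarrow> 'o \<Rightarrow> real)
    \<Rightarrow> (('e \<Rightarrow> real) \<Rightarrow> 'o \<Rightarrow> real) \<Rightarrow> bool" where
  "isometric_extension P \<mu> lam J \<longleftrightarrow>
     (\<forall>f\<in>L2 \<mu>. J f \<in> L2 P \<and> L2_norm P (J f) = L2_norm \<mu> f) \<and>
     (\<forall>f\<in>L2 \<mu>. \<forall>g\<in>L2 \<mu>. \<forall>a b. AE \<omega> in P. J (\<lambda>x. a * f x + b * g x) \<omega> = a * J f \<omega> + b * J g \<omega>) \<and>
     (\<forall>A\<in>sets \<mu>. AE \<omega> in P. J (indicator A) \<omega> = lam A \<omega>)"

text \<open>When \<open>lam\<close> is a white noise measure with associated measure \<open>\<mu>\<close>, the extension exists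
  and is unique up to almost sure equality of its values.\<close>

definition wn_integral :: "'o measure \<Rightarrow> 'e measure \<Rightarrow> ('e set \<Rightarrow> 'o \<Rightarrow> real)
    \<Rightarrow> ('e \<Rightarrow> real) \<Rightarrow> 'o \<Rightarrow> real" where
  "wn_integral P \<mu> lam = (SOME J. isometric_extension P \<mu> lam J)"

text \<open>
  A complete orthonormal system is indexed by a set \<open>N\<close> of naturals, so that \<open>H\<close> may have
  finite or infinite dimension. Independence of the scalar noises \<open>\<nu> n\<close> is independence
  of the processes \<open>A \<mapsto> \<nu> n A\<close>.
\<close>

definition complete_orthonormal :: "nat set \<Rightarrow> (nat \<Rightarrow> 'h::real_inner) \<Rightarrow> bool" where
  "complete_orthonormal N e \<longleftrightarrow>
     (\<forall>i\<in>N. \<forall>j\<in>N. e i \<bullet> e j = (if i = j then 1 else 0)) \<and> closure (span (e ` N)) = UNIV"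

definition H_white_noise :: "'o measure \<Rightarrow> 'w measure \<Rightarrow> nat set \<Rightarrow> (nat \<Rightarrow> 'h::real_inner)
    \<Rightarrow> (nat \<Rightarrow> 'w set \<Rightarrow> 'o \<Rightarrow> real) \<Rightarrow> bool" where
  "H_white_noise P m N e \<nu> \<longleftrightarrow> prob_space P \<and> complete_orthonormal N e \<and>
     (\<forall>n\<in>N. white_noise P m (\<nu> n)) \<and>
     prob_space.indep_vars P (\<lambda>_. PiM (sets m) (\<lambda>_. borel))
       (\<lambda>n \<omega>. restrict (\<lambda>A. \<nu> n A \<omega>) (sets m)) N"

definition H_pairing :: "'o measure \<Rightarrow> 'w measure \<Rightarrow> nat set \<Rightarrow> (nat \<Rightarrow> 'h::real_inner)
    \<Rightarrow> (nat \<Rightarrow> 'w set \<Rightarrow> 'o \<Rightarrow> real) \<Rightarrow> ('w \<Rightarrow> 'h) \<Rightarrow> 'w set \<Rightarrow> 'o \<Rightarrow> real" where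
  "H_pairing P m N e \<nu> \<psi> A =
     L2_lim P (\<lambda>k \<omega>. \<Sum>n\<in>N \<inter> {..<k}.
       wn_integral P m (\<nu> n) (\<lambda>w. indicator A w * (\<psi> w \<bullet> e n)) \<omega>)"

definition wn_image :: "'w measure \<Rightarrow> ('w \<Rightarrow> real ^ 'd) \<Rightarrow> ('w set \<Rightarrow> 'o \<Rightarrow> real)
    \<Rightarrow> (real ^ 'd) set \<Rightarrow> 'o \<Rightarrow> real" where
  "wn_image m X lam A = lam (X -` A \<inter> space m)"

definition dG :: "'o measure \<Rightarrow> 'w measure \<Rightarrow> nat set \<Rightarrow> (nat \<Rightarrow> 'h::real_inner)
    \<Rightarrow> (nat \<Rightarrow> 'w set \<Rightarrow> 'o \<Rightarrow> real) \<Rightarrow> (('w \<Rightarrow> real) \<Rightarrow> 'w \<Rightarrow> 'h)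
    \<Rightarrow> ('w \<Rightarrow> real) \<Rightarrow> 'w set \<Rightarrow> 'o \<Rightarrow> real" where
  "dG P m N e \<nu> D Y = H_pairing P m N e \<nu> (D Y)"

definition image_dG :: "'o measure \<Rightarrow> 'w measure \<Rightarrow> nat set \<Rightarrow> (nat \<Rightarrow> 'h::real_inner)
    \<Rightarrow> (nat \<Rightarrow> 'w set \<Rightarrow> 'o \<Rightarrow> real) \<Rightarrow> (('w \<Rightarrow> real) \<Rightarrow> 'w \<Rightarrow> 'h)
    \<Rightarrow> ('w \<Rightarrow> real ^ 'd) \<Rightarrow> (real ^ 'd \<Rightarrow> real) \<Rightarrow> (real ^ 'd) set \<Rightarrow> 'o \<Rightarrow> real" where
  "image_dG P m N e \<nu> D X F = wn_image m X (dG P m N e \<nu> D (F \<circ> X))"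


section \<open>Weighted spaces and products with vector valued white noises\<close>

definition weighted_L2 :: "'x measure \<Rightarrow> ('x \<Rightarrow> real ^ 'd ^ 'd) \<Rightarrow> ('x \<Rightarrow> real ^ 'd) set" where
  "weighted_L2 M G = {v \<in> borel_measurable M. integrable M (\<lambda>x. v x \<bullet> (G x *v v x))}"

definition weighted_norm :: "'x measure \<Rightarrow> ('x \<Rightarrow> real ^ 'd ^ 'd) \<Rightarrow> ('x \<Rightarrow> real ^ 'd) \<Rightarrow> real" where
  "weighted_norm M G v = sqrt (\<integral>x. v x \<bullet> (G x *v v x) \<partial>M)"

text \<open>
  In the next two definitions \<open>\<Lambda>\<close> is a vector valued white noise with covariance \<open>G \<cdot> M\<close>,
  so that the positive measure associated with its component \<open>i\<close> is \<open>G\<^sub>i\<^sub>i \<cdot> M\<close>. The first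
  one is the product with a bounded function, the second one its extension by continuity.
\<close>

definition wn_dot_bounded :: "'o measure \<Rightarrow> 'x measure \<Rightarrow> ('x \<Rightarrow> real ^ 'd ^ 'd)
    \<Rightarrow> ('d \<Rightarrow> 'x set \<Rightarrow> 'o \<Rightarrow> real) \<Rightarrow> ('x \<Rightarrow> real ^ 'd) \<Rightarrow> 'x set \<Rightarrow> 'o \<Rightarrow> real" where
  "wn_dot_bounded P M G \<Lambda> \<phi> A \<omega> =
     (\<Sum>i\<in>UNIV. wn_integral P (density M (\<lambda>x. ennreal (G x $ i $ i))) (\<Lambda> i)
        (\<lambda>x. indicator A x * \<phi> x $ i) \<omega>)"

definition wn_dot :: "'o measure \<Rightarrow> 'x measure \<Rightarrow> ('x \<Rightarrow> real ^ 'd ^ 'd)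
    \<Rightarrow> ('d \<Rightarrow> 'x set \<Rightarrow> 'o \<Rightarrow> real) \<Rightarrow> ('x \<Rightarrow> real ^ 'd) \<Rightarrow> 'x set \<Rightarrow> 'o \<Rightarrow> real" where
  "wn_dot P M G \<Lambda> \<phi> A =
     (SOME Y. Y \<in> L2 P \<and>
        (\<exists>\<phi>'. (\<forall>n::nat. \<phi>' n \<in> borel_measurable M \<and> bounded (\<phi>' n ` space M)) \<and>
              (\<lambda>n. weighted_norm M G (\<lambda>x. \<phi>' n x - \<phi> x)) \<longlonglongrightarrow> 0 \<and>
              L2_tendsto P (\<lambda>n. wn_dot_bounded P M G \<Lambda> (\<phi>' n) A) Y))"

end

theory Submission
  imports Defs
begin

text \<open>
  The theorem is about noises, but its content is about vector fields. For \<open>\<psi> \<in> L\<^sup>2(m, H)\<close> let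
  \<open>T \<psi> = \<Sum>\<^sub>n \<integral> \<langle>\<psi>, e\<^sub>n\<rangle> d\<nu>\<^sub>n\<close>. Orthogonality of the independent noises \<open>\<nu>\<^sub>n\<close> and Parseval's identity make
  \<open>T\<close> a linear isometry into \<open>L\<^sup>2(P)\<close> (\<open>H_integral_isometry\<close>), and \<open>d\<^sub>GY(A) = T(1\<^sub>A D[Y])\<close>. A product
  \<open>v\<^sup>t d\<^sub>GX\<close> or \<open>v\<^sup>t d\<^sub>GI\<close> is then the image under \<open>T\<close> of the field \<open>\<Sum>\<^sub>i v\<^sub>i D[X\<^sub>i]\<close>, composed with \<open>X\<close> in
  the second case: the integrals against the components are identified by uniqueness of isometric
  extensions, and the extension from bounded to unbounded \<open>v\<close> by continuity of \<open>T\<close>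
  (\<open>wn_dot_eq\<close>, proved once for a projection \<open>\<pi>\<close> that is either \<open>X\<close> or the identity).

  Both identities between noises thus follow from one identity between fields,
  \<open>D[F(X)] = \<Sum>\<^sub>i v\<^sub>i(X) D[X\<^sub>i]\<close>. For a Lipschitz \<open>C\<^sup>1\<close> function \<open>F = u\<close> it holds with \<open>v = \<nabla>u\<close> by the
  functional calculus (\<open>gradient_chain_rule\<close>). For a limit \<open>F\<close> of such functions the gradients need
  not converge, because the matrix \<open>\<Gamma>\<^sub>X[I]\<close> may be degenerate. Instead \<open>v(x)\<close> is chosen as a
  minimizer of
    \<open>q x a = \<Gamma>\<^sub>X[F](x) - 2 \<Sum>\<^sub>i a\<^sub>i E[\<langle>D[F(X)], D[X\<^sub>i]\<rangle> | X = x] + a\<^sup>t \<Gamma>\<^sub>X[I](x) a\<close>,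
  the conditional mean square of \<open>D[F(X)] - \<Sum>\<^sub>i a\<^sub>i D[X\<^sub>i]\<close>. Being bounded below, this quadratic
  polynomial has a critical point, and gradient descent finds one that depends measurably on \<open>x\<close>
  (\<open>bounded_below_quadratic\<close>, \<open>solve_measurable\<close>). The gradients of approximating smooth functions
  are competitors whose residual tends to \<open>0\<close> in mean, so the minimum is \<open>0\<close> almost everywhere
  (\<open>image_gradient_exists\<close>). This gives the representation of \<open>D[F(X)]\<close>, and at a critical point
  with \<open>q x (v x) = 0\<close> one has \<open>\<Gamma>\<^sub>X[F] = v\<^sup>t \<Gamma>\<^sub>X[I] v\<close>.
\<close>


section \<open>The Hilbert space structure of square integrable functions\<close>

text \<open>
  Nonnegativity on all of \<open>\<real>\<close> forces the sign of the leading coefficient too. A vanishing leading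
  coefficient forces the linear one to vanish, which is how degenerate forms are handled below.
\<close>

lemma quadratic_nonneg_discriminant:
  fixes a b c :: real
  assumes nonneg: "\<And>t. 0 \<le> a * t\<^sup>2 + 2 * b * t + c"
  shows "0 \<le> a" and "b\<^sup>2 \<le> a * c"
proof -
  have c: "0 \<le> c" using nonneg[of 0] by simp
  show a: "0 \<le> a"
  proof (rule ccontr)
    assume "\<not> 0 \<le> a"
    hence a: "a < 0" by simp
    define t where "t = sqrt ((c + 1) / (- a))"
    have t2: "t\<^sup>2 = (c + 1) / (- a)" using a c by (simp add: t_def divide_nonneg_neg)
    have at: "a * t\<^sup>2 = - (c + 1)" using a by (simp add: t2 field_simps)
    show False using nonneg[of t] nonneg[of "- t"] at by simp
  qed
  show "b\<^sup>2 \<le> a * c"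
  proof (cases "a = 0")
    case True
    have "b = 0"
    proof (rule ccontr)
      assume "b \<noteq> 0"
      thus False using nonneg[of "- (c + 1) / (2 * b)"] True by simp
    qed
    thus ?thesis using True by simp
  next
    case False
    hence a: "0 < a" using a by simp
    have "0 \<le> a * (- b / a)\<^sup>2 + 2 * b * (- b / a) + c" by (rule nonneg)
    also have "\<dots> = c - b\<^sup>2 / a" using a by (simp add: power2_eq_square field_simps)
    finally show ?thesis using a by (simp add: field_simps)
  qed
qed

lemma L2I:
  "f \<in> borel_measurable M \<Longrightarrow> integrable M (\<lambda>x. (norm (f x))\<^sup>2) \<Longrightarrow> f \<in> L2 M"
  by (simp add: L2_def)

lemma L2_measurable [measurable_dest]: "f \<in> L2 M \<Longrightarrow> f \<in> borel_measurable M"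
  by (simp add: L2_def)

lemma L2_integrable: "f \<in> L2 M \<Longrightarrow> integrable M (\<lambda>x. (norm (f x))\<^sup>2)"
  by (simp add: L2_def)

lemma L2_zero [simp]: "(\<lambda>x. 0) \<in> L2 M"
  by (simp add: L2_def)

lemma L2_cong_AE:
  assumes "f \<in> L2 M" "g \<in> borel_measurable M" "AE x in M. f x = g x"
  shows "g \<in> L2 M"
proof (rule L2I)
  note [measurable] = assms(2) L2_measurable[OF assms(1)]
  have "integrable M (\<lambda>x. (norm (f x))\<^sup>2) \<longleftrightarrow> integrable M (\<lambda>x. (norm (g x))\<^sup>2)"
    using assms(3) by (intro integrable_cong_AE) auto
  thus "integrable M (\<lambda>x. (norm (g x))\<^sup>2)" using L2_integrable[OF assms(1)] by simp
qed (fact assms)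

lemma L2_bound:
  assumes "f \<in> L2 M" "g \<in> borel_measurable M" "AE x in M. norm (g x) \<le> C * norm (f x)"
  shows "g \<in> L2 M"
proof (rule L2I)
  note [measurable] = assms(2) L2_measurable[OF assms(1)]
  have "AE x in M. norm ((norm (g x))\<^sup>2) \<le> norm (C\<^sup>2 * (norm (f x))\<^sup>2)"
    using assms(3)
  proof eventually_elim
    case (elim x)
    have "(norm (g x))\<^sup>2 \<le> (C * norm (f x))\<^sup>2" by (intro power_mono elim) simp
    thus ?case by (simp add: power_mult_distrib)
  qed
  thus "integrable M (\<lambda>x. (norm (g x))\<^sup>2)"
    by (intro Bochner_Integration.integrable_bound
          [OF integrable_mult_right[OF L2_integrable[OF assms(1)], of "C\<^sup>2"]]) auto
qed (fact assms)

lemma L2_scaleR: "f \<in> L2 M \<Longrightarrow> (\<lambda>x. c *\<^sub>R f x) \<in> L2 M"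
  by (rule L2_bound[where f = f and C = "\<bar>c\<bar>"]) (auto dest: L2_measurable)

lemma norm_add_squared_le:
  fixes a b :: "'a::real_normed_vector"
  shows "(norm (a + b))\<^sup>2 \<le> 2 * (norm a)\<^sup>2 + 2 * (norm b)\<^sup>2"
proof -
  have "(norm (a + b))\<^sup>2 \<le> (norm a + norm b)\<^sup>2"
    by (intro power_mono norm_triangle_ineq) simp
  also have "\<dots> \<le> 2 * (norm a)\<^sup>2 + 2 * (norm b)\<^sup>2"
    using zero_le_power2[of "norm a - norm b"] by (simp add: power2_eq_square algebra_simps)
  finally show ?thesis .
qed

lemma L2_add:
  assumes "f \<in> L2 M" "g \<in> L2 M"
  shows "(\<lambda>x. f x + g x) \<in> L2 M"
proof (rule L2I)
  note [measurable] = L2_measurable[OF assms(1)] L2_measurable[OF assms(2)]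
  show "(\<lambda>x. f x + g x) \<in> borel_measurable M" by measurable
  have "integrable M (\<lambda>x. 2 * (norm (f x))\<^sup>2 + 2 * (norm (g x))\<^sup>2)"
    using assms[THEN L2_integrable] by simp
  thus "integrable M (\<lambda>x. (norm (f x + g x))\<^sup>2)"
    by (rule Bochner_Integration.integrable_bound) (auto simp: norm_add_squared_le)
qed

lemma L2_diff: "f \<in> L2 M \<Longrightarrow> g \<in> L2 M \<Longrightarrow> (\<lambda>x. f x - g x) \<in> L2 M"
  using L2_add[of f M "\<lambda>x. (-1) *\<^sub>R g x"] L2_scaleR[of g M "-1"] by simp

lemma L2_sum: "(\<And>i. i \<in> I \<Longrightarrow> f i \<in> L2 M) \<Longrightarrow> (\<lambda>x. \<Sum>i\<in>I. f i x) \<in> L2 M"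
  by (induction I rule: infinite_finite_induct) (auto intro: L2_add)

lemma L2_mult: "f \<in> L2 M \<Longrightarrow> (\<lambda>x. c * f x) \<in> L2 M" for c :: real
  using L2_scaleR[of f M c] by simp

lemma L2_indicator_scaleR:
  assumes "f \<in> L2 M" "A \<in> sets M" shows "(\<lambda>x. indicator A x *\<^sub>R f x) \<in> L2 M"
proof (rule L2_bound[where C = 1])
  show "(\<lambda>x. indicator A x *\<^sub>R f x) \<in> borel_measurable M"
    using assms L2_measurable[OF assms(1)] by measurable
qed (use assms in \<open>auto split: split_indicator\<close>)

lemma L2_inner_const: "f \<in> L2 M \<Longrightarrow> (\<lambda>x. f x \<bullet> c) \<in> L2 M"
  for f :: "'a \<Rightarrow> 'b::{second_countable_topology,real_inner}"
  by (rule L2_bound[where f = f and C = "norm c"])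
     (auto dest: L2_measurable intro!: AE_I2 order_trans[OF Cauchy_Schwarz_ineq2] simp: mult.commute)

lemma integrable_inner_L2:
  fixes f g :: "'a \<Rightarrow> 'b::{second_countable_topology,real_inner}"
  assumes "f \<in> L2 M" "g \<in> L2 M"
  shows "integrable M (\<lambda>x. f x \<bullet> g x)"
proof -
  note [measurable] = L2_measurable[OF assms(1)] L2_measurable[OF assms(2)]
  have le: "norm (f x \<bullet> g x) \<le> norm ((norm (f x))\<^sup>2 + (norm (g x))\<^sup>2)" for x
    using Cauchy_Schwarz_ineq2[of "f x" "g x"] zero_le_power2[of "norm (f x) - norm (g x)"]
      zero_le_power2[of "norm (f x)"] zero_le_power2[of "norm (g x)"]
    unfolding power2_diff real_norm_def by linarith
  have "integrable M (\<lambda>x. (norm (f x))\<^sup>2 + (norm (g x))\<^sup>2)"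
    using assms[THEN L2_integrable] by (rule Bochner_Integration.integrable_add)
  thus ?thesis
    by (rule Bochner_Integration.integrable_bound) (measurable, rule AE_I2, rule le)
qed

lemma integrable_mult_L2:
  fixes f g :: "'a \<Rightarrow> real"
  shows "f \<in> L2 M \<Longrightarrow> g \<in> L2 M \<Longrightarrow> integrable M (\<lambda>x. f x * g x)"
  using integrable_inner_L2[of f M g] by simp

lemma bounded_times_integrable:
  fixes f :: "'y \<Rightarrow> real"
  assumes "\<phi> \<in> borel_measurable N" "\<And>x. x \<in> space N \<Longrightarrow> \<bar>\<phi> x\<bar> \<le> C" "integrable N f"
  shows "integrable N (\<lambda>x. \<phi> x * f x)"
proof (rule Bochner_Integration.integrable_bound)
  show "integrable N (\<lambda>x. C * f x)" using assms(3) by simp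
  show "AE x in N. norm (\<phi> x * f x) \<le> norm (C * f x)"
  proof (rule AE_I2)
    fix x assume x: "x \<in> space N"
    have "\<bar>\<phi> x\<bar> \<le> \<bar>C\<bar>" using assms(2)[OF x] by simp
    thus "norm (\<phi> x * f x) \<le> norm (C * f x)" by (simp add: abs_mult mult_right_mono)
  qed
qed (use assms(1,3) in measurable)

lemma L2_norm_nonneg [simp]: "0 \<le> L2_norm M f"
  by (simp add: L2_norm_def)

lemma L2_norm_squared: "(L2_norm M f)\<^sup>2 = (\<integral>x. (norm (f x))\<^sup>2 \<partial>M)"
  by (simp add: L2_norm_def)

lemma L2_norm_scaleR: "L2_norm M (\<lambda>x. c *\<^sub>R f x) = \<bar>c\<bar> * L2_norm M f"
  by (simp add: L2_norm_def power_mult_distrib real_sqrt_mult)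

lemma L2_norm_minus_commute: "L2_norm M (\<lambda>x. f x - g x) = L2_norm M (\<lambda>x. g x - f x)"
  by (simp add: L2_norm_def norm_minus_commute)

lemma L2_norm_cong_AE:
  assumes "f \<in> borel_measurable M" "g \<in> borel_measurable M" "AE x in M. f x = g x"
  shows "L2_norm M f = L2_norm M g"
  unfolding L2_norm_def using assms by (intro arg_cong[where f = sqrt] integral_cong_AE) auto

lemma L2_norm_eq_0_iff:
  assumes "f \<in> L2 M"
  shows "L2_norm M f = 0 \<longleftrightarrow> (AE x in M. f x = 0)"
  using integral_nonneg_eq_0_iff_AE[OF L2_integrable[OF assms]] by (simp add: L2_norm_def)

lemma L2_norm_add_squared:
  fixes f g :: "'a \<Rightarrow> 'b::{second_countable_topology,real_inner}"
  assumes "f \<in> L2 M" "g \<in> L2 M"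
  shows "(L2_norm M (\<lambda>x. f x + g x))\<^sup>2 =
    (L2_norm M f)\<^sup>2 + 2 * (\<integral>x. f x \<bullet> g x \<partial>M) + (L2_norm M g)\<^sup>2"
proof -
  have "(\<integral>x. (norm (f x + g x))\<^sup>2 \<partial>M)
      = (\<integral>x. (norm (f x))\<^sup>2 + 2 * (f x \<bullet> g x) + (norm (g x))\<^sup>2 \<partial>M)"
    by (intro Bochner_Integration.integral_cong)
       (auto simp: power2_norm_eq_inner inner_add_left inner_add_right inner_commute)
  thus ?thesis using assms[THEN L2_integrable] integrable_inner_L2[OF assms]
    by (simp add: L2_norm_squared)
qed

lemma Cauchy_Schwarz_L2:
  fixes f g :: "'a \<Rightarrow> 'b::{second_countable_topology,real_inner}"
  assumes "f \<in> L2 M" "g \<in> L2 M"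
  shows "\<bar>\<integral>x. f x \<bullet> g x \<partial>M\<bar> \<le> L2_norm M f * L2_norm M g"
proof (rule power2_le_imp_le)
  have "0 \<le> (L2_norm M f)\<^sup>2 * t\<^sup>2 + 2 * (\<integral>x. f x \<bullet> g x \<partial>M) * t + (L2_norm M g)\<^sup>2" for t
    using L2_norm_add_squared[OF L2_scaleR[OF assms(1), of t] assms(2)]
      zero_le_power2[of "L2_norm M (\<lambda>x. t *\<^sub>R f x + g x)"]
    by (simp add: L2_norm_scaleR power_mult_distrib mult_ac)
  from quadratic_nonneg_discriminant(2)[OF this]
  show "\<bar>\<integral>x. f x \<bullet> g x \<partial>M\<bar>\<^sup>2 \<le> (L2_norm M f * L2_norm M g)\<^sup>2"
    by (simp add: power_mult_distrib)
qed simp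

lemma L2_norm_triangle:
  fixes f g :: "'a \<Rightarrow> 'b::{second_countable_topology,real_inner}"
  assumes "f \<in> L2 M" "g \<in> L2 M"
  shows "L2_norm M (\<lambda>x. f x + g x) \<le> L2_norm M f + L2_norm M g"
proof (rule power2_le_imp_le)
  show "(L2_norm M (\<lambda>x. f x + g x))\<^sup>2 \<le> (L2_norm M f + L2_norm M g)\<^sup>2"
    unfolding L2_norm_add_squared[OF assms] power2_sum
    using Cauchy_Schwarz_L2[OF assms] by linarith
qed simp

lemma L2_norm_triangle_diff:
  fixes f g h :: "'a \<Rightarrow> 'b::{second_countable_topology,real_inner}"
  assumes "f \<in> L2 M" "g \<in> L2 M" "h \<in> L2 M"
  shows "L2_norm M (\<lambda>x. f x - h x) \<le> L2_norm M (\<lambda>x. f x - g x) + L2_norm M (\<lambda>x. g x - h x)"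
  using L2_norm_triangle[OF L2_diff[OF assms(1,2)] L2_diff[OF assms(2,3)]] by simp

lemma tendsto_L2_norm:
  fixes f :: "nat \<Rightarrow> 'a \<Rightarrow> 'b::{second_countable_topology,real_inner}"
  assumes "\<And>n. f n \<in> L2 M" "g \<in> L2 M" "(\<lambda>n. L2_norm M (\<lambda>x. f n x - g x)) \<longlonglongrightarrow> 0"
  shows "(\<lambda>n. L2_norm M (f n)) \<longlonglongrightarrow> L2_norm M g"
proof -
  have "norm (L2_norm M (f n) - L2_norm M g) \<le> L2_norm M (\<lambda>x. f n x - g x)" for n
    using L2_norm_triangle_diff[OF assms(1) assms(2) L2_zero, of n]
      L2_norm_triangle_diff[OF assms(2) assms(1) L2_zero, of n]
    unfolding L2_norm_minus_commute[of M g "f n"] diff_zero real_norm_def by linarith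
  hence "(\<lambda>n. L2_norm M (f n) - L2_norm M g) \<longlonglongrightarrow> 0"
    by (rule Lim_null_comparison[OF always_eventually[OF allI] assms(3)])
  thus ?thesis by (simp add: LIM_zero_iff)
qed

lemma tendsto_integral_mult_L2:
  fixes f :: "nat \<Rightarrow> 'a \<Rightarrow> real"
  assumes "\<And>n. f n \<in> L2 M" "g \<in> L2 M" "h \<in> L2 M" "L2_tendsto M f g"
  shows "(\<lambda>n. \<integral>x. f n x * h x \<partial>M) \<longlonglongrightarrow> (\<integral>x. g x * h x \<partial>M)"
proof -
  have "norm ((\<integral>x. f n x * h x \<partial>M) - (\<integral>x. g x * h x \<partial>M))
      \<le> L2_norm M (\<lambda>x. f n x - g x) * L2_norm M h" for n
    using Cauchy_Schwarz_L2[OF L2_diff[OF assms(1,2)] assms(3), of n]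
    by (simp add: left_diff_distrib Bochner_Integration.integral_diff
          [OF integrable_mult_L2[OF assms(1,3)] integrable_mult_L2[OF assms(2,3)]])
  moreover have "(\<lambda>n. L2_norm M (\<lambda>x. f n x - g x) * L2_norm M h) \<longlonglongrightarrow> 0"
    using assms(4) by (auto simp: L2_tendsto_def intro!: tendsto_eq_intros)
  ultimately have "(\<lambda>n. (\<integral>x. f n x * h x \<partial>M) - (\<integral>x. g x * h x \<partial>M)) \<longlonglongrightarrow> 0"
    by (rule Lim_null_comparison[OF always_eventually[OF allI]])
  thus ?thesis by (simp add: LIM_zero_iff)
qed

lemma L2_tendsto_unique:
  assumes "\<And>n. f n \<in> L2 M" "g \<in> L2 M" "h \<in> L2 M" "L2_tendsto M f g" "L2_tendsto M f h"
  shows "AE x in M. g x = h x"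
proof -
  have le: "L2_norm M (\<lambda>x. g x - h x)
      \<le> L2_norm M (\<lambda>x. f n x - g x) + L2_norm M (\<lambda>x. f n x - h x)" for n
    using L2_norm_triangle_diff[OF assms(2) assms(1) assms(3), of n]
    unfolding L2_norm_minus_commute[of M g "f n"] .
  have lim: "(\<lambda>n. L2_norm M (\<lambda>x. f n x - g x) + L2_norm M (\<lambda>x. f n x - h x)) \<longlonglongrightarrow> 0"
    using tendsto_add[OF assms(4,5)[unfolded L2_tendsto_def]] by simp
  have "L2_norm M (\<lambda>x. g x - h x) \<le> 0"
    using LIMSEQ_le_const[OF lim] le by blast
  hence "L2_norm M (\<lambda>x. g x - h x) = 0" by (rule order_antisym) simp
  thus ?thesis using L2_norm_eq_0_iff[OF L2_diff[OF assms(2,3)]] by simp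
qed

lemma L2_tendsto_lincomb:
  assumes "\<And>n. f n \<in> L2 M" "f' \<in> L2 M" "\<And>n. g n \<in> L2 M" "g' \<in> L2 M"
    and "L2_tendsto M f f'" "L2_tendsto M g g'"
  shows "L2_tendsto M (\<lambda>n x. a * f n x + b * g n x) (\<lambda>x. a * f' x + b * g' x)"
proof -
  have "norm (L2_norm M (\<lambda>x. (a * f n x + b * g n x) - (a * f' x + b * g' x)))
      \<le> \<bar>a\<bar> * L2_norm M (\<lambda>x. f n x - f' x) + \<bar>b\<bar> * L2_norm M (\<lambda>x. g n x - g' x)" for n
    using L2_norm_triangle[OF L2_scaleR[OF L2_diff[OF assms(1,2)], of a]
        L2_scaleR[OF L2_diff[OF assms(3,4)], of b], of n n]
      L2_norm_scaleR[of M a "\<lambda>x. f n x - f' x"] L2_norm_scaleR[of M b "\<lambda>x. g n x - g' x"]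
    by (simp add: algebra_simps)
  moreover have "(\<lambda>n. \<bar>a\<bar> * L2_norm M (\<lambda>x. f n x - f' x)
      + \<bar>b\<bar> * L2_norm M (\<lambda>x. g n x - g' x)) \<longlonglongrightarrow> 0"
    using assms(5,6) unfolding L2_tendsto_def by (auto intro!: tendsto_eq_intros)
  ultimately show ?thesis unfolding L2_tendsto_def
    by (rule Lim_null_comparison[OF always_eventually[OF allI]])
qed

lemma L2_tendsto_cong:
  assumes "\<And>n. AE x in M. f n x = g n x" "\<And>n. f n \<in> L2 M" "\<And>n. g n \<in> L2 M" "h \<in> L2 M"
  shows "L2_tendsto M f h \<longleftrightarrow> L2_tendsto M g h"
proof -
  have "L2_norm M (\<lambda>x. f n x - h x) = L2_norm M (\<lambda>x. g n x - h x)" for n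
    by (rule L2_norm_cong_AE)
       (use assms(1)[of n] in \<open>auto intro!: L2_measurable L2_diff assms(2-)\<close>)
  thus ?thesis by (simp add: L2_tendsto_def)
qed

lemma integral_abs_le_L2_norm:
  fixes f :: "'a \<Rightarrow> real"
  assumes "finite_measure M" "f \<in> L2 M"
  shows "integrable M f"
    and "(\<integral>x. \<bar>f x\<bar> \<partial>M) \<le> L2_norm M f * sqrt (measure M (space M))"
proof -
  interpret finite_measure M by fact
  have one: "(\<lambda>x. 1 :: real) \<in> L2 M" by (rule L2I) auto
  have abs: "(\<lambda>x. \<bar>f x\<bar>) \<in> L2 M"
    using L2_bound[OF assms(2), where C = 1 and g = "\<lambda>x. \<bar>f x\<bar>"] L2_measurable[OF assms(2)] by simp
  show "integrable M f" using integrable_mult_L2[OF assms(2) one] by simp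
  show "(\<integral>x. \<bar>f x\<bar> \<partial>M) \<le> L2_norm M f * sqrt (measure M (space M))"
    using Cauchy_Schwarz_L2[OF abs one] by (simp add: L2_norm_def)
qed

text \<open>
  On a finite measure a Cauchy sequence in \<open>L\<^sup>2\<close> is Cauchy in \<open>L\<^sup>1\<close>, so a subsequence
  converges almost everywhere; Fatou's lemma turns the pointwise limit into a limit in \<open>L\<^sup>2\<close>.
\<close>

lemma L2_complete:
  fixes s :: "nat \<Rightarrow> 'a \<Rightarrow> real"
  assumes fin: "finite_measure M" and s: "\<And>n. s n \<in> L2 M"
    and Cauchy: "\<And>e. 0 < e \<Longrightarrow> \<exists>n0. \<forall>p\<ge>n0. \<forall>q\<ge>n0. L2_norm M (\<lambda>x. s p x - s q x) < e"
  shows "\<exists>g\<in>L2 M. L2_tendsto M s g"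
proof -
  note [measurable] = L2_measurable[OF s]
  define c where "c = sqrt (measure M (space M)) + 1"
  have c: "0 < c" by (simp add: c_def add_nonneg_pos)
  have "\<exists>n0. \<forall>p\<ge>n0. \<forall>q\<ge>n0. (LINT x|M. norm (s p x - s q x)) < e" if "0 < e" for e
  proof -
    obtain n0 where n0: "\<And>p q. p \<ge> n0 \<Longrightarrow> q \<ge> n0 \<Longrightarrow> L2_norm M (\<lambda>x. s p x - s q x) < e / c"
      using Cauchy[of "e / c"] \<open>0 < e\<close> c by auto
    have "(LINT x|M. norm (s p x - s q x)) < e" if "p \<ge> n0" "q \<ge> n0" for p q
    proof -
      have "(LINT x|M. norm (s p x - s q x))
          \<le> L2_norm M (\<lambda>x. s p x - s q x) * sqrt (measure M (space M))"
        using integral_abs_le_L2_norm(2)[OF fin L2_diff[OF s s]] by simp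
      also have "\<dots> \<le> L2_norm M (\<lambda>x. s p x - s q x) * c"
        by (intro mult_left_mono) (auto simp: c_def)
      also have "\<dots> < e" using n0[OF that] c by (simp add: pos_less_divide_eq)
      finally show ?thesis .
    qed
    thus ?thesis by blast
  qed
  then obtain r where r: "strict_mono r" "AE x in M. Cauchy (\<lambda>i. s (r i) x)"
    by (rule cauchy_L1_AE_cauchy_subseq[OF integral_abs_le_L2_norm(1)[OF fin s]])
  define g where "g x = lim (\<lambda>i. s (r i) x)" for x
  have [measurable]: "g \<in> borel_measurable M" unfolding g_def by measurable
  have lim: "AE x in M. (\<lambda>i. s (r i) x) \<longlonglongrightarrow> g x"
    using r(2) by eventually_elim (simp add: g_def Cauchy_convergent convergent_LIMSEQ_iff[symmetric])
  have close: "(\<lambda>x. s p x - g x) \<in> L2 M \<and> L2_norm M (\<lambda>x. s p x - g x) \<le> e"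
    if e: "0 < e" and n0: "\<And>p q. p \<ge> n0 \<Longrightarrow> q \<ge> n0 \<Longrightarrow> L2_norm M (\<lambda>x. s p x - s q x) < e"
      and p: "p \<ge> n0" for e n0 p
  proof -
    have "(\<integral>\<^sup>+x. ennreal ((s p x - g x)\<^sup>2) \<partial>M)
        = (\<integral>\<^sup>+x. liminf (\<lambda>i. ennreal ((s p x - s (r i) x)\<^sup>2)) \<partial>M)"
    proof (rule nn_integral_cong_AE, use lim in eventually_elim)
      case (elim x)
      have "(\<lambda>i. ennreal ((s p x - s (r i) x)\<^sup>2)) \<longlonglongrightarrow> ennreal ((s p x - g x)\<^sup>2)"
        by (intro tendsto_intros elim)
      thus ?case by (rule lim_imp_Liminf[OF sequentially_bot, symmetric])
    qed
    also have "\<dots> \<le> liminf (\<lambda>i. \<integral>\<^sup>+x. ennreal ((s p x - s (r i) x)\<^sup>2) \<partial>M)"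
      by (rule nn_integral_liminf) measurable
    also have "\<dots> \<le> ennreal (e\<^sup>2)"
    proof (rule Liminf_le)
      have "(\<integral>\<^sup>+x. ennreal ((s p x - s (r i) x)\<^sup>2) \<partial>M) \<le> ennreal (e\<^sup>2)" if "i \<ge> n0" for i
      proof -
        have "(\<integral>\<^sup>+x. ennreal ((s p x - s (r i) x)\<^sup>2) \<partial>M)
            = ennreal ((L2_norm M (\<lambda>x. s p x - s (r i) x))\<^sup>2)"
          using L2_integrable[OF L2_diff[OF s s]] by (simp add: nn_integral_eq_integral L2_norm_squared)
        also have "\<dots> \<le> ennreal (e\<^sup>2)"
          using n0[OF p order_trans[OF that seq_suble[OF r(1)]]] e
          by (intro ennreal_leI power_mono) auto
        finally show ?thesis .
      qed
      thus "\<forall>\<^sub>F i in sequentially. (\<integral>\<^sup>+x. ennreal ((s p x - s (r i) x)\<^sup>2) \<partial>M) \<le> ennreal (e\<^sup>2)"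
        by (rule eventually_sequentiallyI)
    qed simp
    finally have le: "(\<integral>\<^sup>+x. ennreal ((s p x - g x)\<^sup>2) \<partial>M) \<le> ennreal (e\<^sup>2)" .
    have int: "integrable M (\<lambda>x. (s p x - g x)\<^sup>2)"
      using le by (intro integrableI_nonneg) (auto simp: less_top[symmetric] top_unique)
    have "(L2_norm M (\<lambda>x. s p x - g x))\<^sup>2 \<le> e\<^sup>2"
      using le e int by (simp add: L2_norm_squared nn_integral_eq_integral)
    hence "L2_norm M (\<lambda>x. s p x - g x) \<le> e" by (rule power2_le_imp_le) (use e in simp)
    thus ?thesis using int by (simp add: L2_def)
  qed
  have g: "g \<in> L2 M"
  proof -
    obtain n0 where n0: "\<And>p q. p \<ge> n0 \<Longrightarrow> q \<ge> n0 \<Longrightarrow> L2_norm M (\<lambda>x. s p x - s q x) < 1"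
      using Cauchy[of 1] by auto
    have "(\<lambda>x. s n0 x - g x) \<in> L2 M" using close[OF zero_less_one n0 order_refl] by simp
    from L2_diff[OF s[of n0] this] show ?thesis by simp
  qed
  have "L2_tendsto M s g"
    unfolding L2_tendsto_def
  proof (rule LIMSEQ_I)
    fix e :: real assume e: "0 < e"
    obtain n0 where n0: "\<And>p q. p \<ge> n0 \<Longrightarrow> q \<ge> n0 \<Longrightarrow> L2_norm M (\<lambda>x. s p x - s q x) < e / 2"
      using Cauchy[of "e / 2"] e by auto
    have "norm (L2_norm M (\<lambda>x. s p x - g x) - 0) < e" if "p \<ge> n0" for p
      using close[OF _ n0 that] e by auto
    thus "\<exists>n0. \<forall>p\<ge>n0. norm (L2_norm M (\<lambda>x. s p x - g x) - 0) < e" by blast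
  qed
  thus ?thesis using g by blast
qed

lemma L2_tendsto_const: "L2_tendsto M (\<lambda>_. f) f"
  by (simp add: L2_tendsto_def L2_norm_def)

lemma indicator_L2:
  assumes "finite_measure M" "A \<in> sets M"
  shows "(indicator A :: 'a \<Rightarrow> real) \<in> L2 M"
proof (rule L2I)
  interpret finite_measure M by fact
  have "(\<lambda>x. (norm (indicator A x :: real))\<^sup>2) = indicator A" by (auto split: split_indicator)
  thus "integrable M (\<lambda>x. (norm (indicator A x :: real))\<^sup>2)"
    using assms(2) by (simp add: emeasure_eq_measure)
qed (use assms in measurable)

text \<open>Simple functions are dense in \<open>L\<^sup>2\<close>, phrased as an induction principle.\<close>

lemma L2_induct [consumes 2, case_names indicator lincomb limit]:
  fixes f :: "'a \<Rightarrow> real"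
  assumes fin: "finite_measure M" and f: "f \<in> L2 M"
    and ind: "\<And>A. A \<in> sets M \<Longrightarrow> Q (indicator A)"
    and lin: "\<And>f g a b. f \<in> L2 M \<Longrightarrow> g \<in> L2 M \<Longrightarrow> Q f \<Longrightarrow> Q g \<Longrightarrow> Q (\<lambda>x. a * f x + b * g x)"
    and lim: "\<And>f g. (\<And>n. f n \<in> L2 M) \<Longrightarrow> (\<And>n. Q (f n)) \<Longrightarrow> g \<in> L2 M \<Longrightarrow> L2_tendsto M f g \<Longrightarrow> Q g"
  shows "Q f"
proof -
  note [measurable] = L2_measurable[OF f]
  obtain s where s0: "\<forall>i. simple_function M (s i)"
      "\<forall>x\<in>space M. (\<lambda>i. s i x) \<longlonglongrightarrow> f x"
      "\<forall>i. \<forall>x\<in>space M. dist (s i x) 0 \<le> 2 * dist (f x) 0"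
    using borel_measurable_implies_sequence_metric[OF L2_measurable[OF f], of 0] by blast
  have s: "simple_function M (s i)" "x \<in> space M \<Longrightarrow> (\<lambda>i. s i x) \<longlonglongrightarrow> f x"
      "x \<in> space M \<Longrightarrow> norm (s i x) \<le> 2 * norm (f x)" for i x
    using s0 by auto
  define t where "t i x = (\<Sum>y\<in>s i ` space M. y * indicator (s i -` {y} \<inter> space M) x)" for i x
  have t_eq: "t i x = s i x" if "x \<in> space M" for i x
    unfolding t_def
    by (rule trans[OF sum.cong[OF refl]
          simple_function_indicator_representation_banach[OF s(1) that, symmetric]]) simp
  have sum: "(\<lambda>x. \<Sum>y\<in>Y. y * indicator (B y) x) \<in> L2 M \<and> Q (\<lambda>x. \<Sum>y\<in>Y. y * indicator (B y) x)"
    if "finite Y" "\<And>y. y \<in> Y \<Longrightarrow> B y \<in> sets M" for Y :: "real set" and B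
    using that
  proof (induction Y)
    case empty
    show ?case using lin[of "indicator {}" "indicator {}" 0 0] ind[of "{}"] indicator_L2[OF fin, of "{}"]
      by simp
  next
    case (insert y Y)
    have IH: "(\<lambda>x. \<Sum>y\<in>Y. y * indicator (B y) x) \<in> L2 M" "Q (\<lambda>x. \<Sum>y\<in>Y. y * indicator (B y) x)"
      using insert by auto
    have B: "B y \<in> sets M" using insert by simp
    show ?case
      using lin[OF indicator_L2[OF fin B] IH(1) ind[OF B] IH(2), of y 1]
        L2_add[OF L2_mult[OF indicator_L2[OF fin B], of y] IH(1)]
      by (simp only: sum.insert[OF insert.hyps(1,2)] mult_1 simp_thms)
  qed
  have t: "t i \<in> L2 M" "Q (t i)" for i
    using sum[of "s i ` space M" "\<lambda>y. s i -` {y} \<inter> space M"] simple_functionD[OF s(1)[of i]]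
    by (auto simp: t_def[abs_def])
  have "(\<lambda>i. \<integral>x. (norm (t i x - f x))\<^sup>2 \<partial>M) \<longlonglongrightarrow> (\<integral>x. 0 \<partial>M)"
  proof (rule integral_dominated_convergence[where w = "\<lambda>x. 9 * (norm (f x))\<^sup>2"])
    show "AE x in M. (\<lambda>i. (norm (t i x - f x))\<^sup>2) \<longlonglongrightarrow> 0"
    proof (rule AE_I2)
      fix x assume x: "x \<in> space M"
      have "(\<lambda>i. (norm (s i x - f x))\<^sup>2) \<longlonglongrightarrow> (norm (f x - f x))\<^sup>2"
        by (intro tendsto_intros s x)
      thus "(\<lambda>i. (norm (t i x - f x))\<^sup>2) \<longlonglongrightarrow> 0" by (simp add: t_eq[OF x])
    qed
    show "AE x in M. norm ((norm (t i x - f x))\<^sup>2) \<le> 9 * (norm (f x))\<^sup>2" for i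
    proof (rule AE_I2)
      fix x assume x: "x \<in> space M"
      have "norm (t i x - f x) \<le> 3 * norm (f x)"
        using s(3)[OF x, of i] norm_triangle_ineq4[of "s i x" "f x"] by (simp add: t_eq[OF x])
      from power_mono[OF this norm_ge_zero, of 2]
      show "norm ((norm (t i x - f x))\<^sup>2) \<le> 9 * (norm (f x))\<^sup>2" by (simp add: power_mult_distrib)
    qed
  qed (use L2_integrable[OF f] L2_measurable[OF t(1)] in auto)
  hence "(\<lambda>i. sqrt (\<integral>x. (norm (t i x - f x))\<^sup>2 \<partial>M)) \<longlonglongrightarrow> sqrt 0"
    by (intro tendsto_real_sqrt) simp
  hence "L2_tendsto M t f" by (simp add: L2_tendsto_def L2_norm_def)
  with t f show ?thesis by (rule lim)
qed


section \<open>Isometric extension of orthogonal random measures\<close>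

text \<open>
  The closed linear hull of the pairs \<open>(1\<^sub>A, lam A)\<close>. It is the graph of the stochastic
  integral: working with the graph avoids a canonical form of simple functions.
\<close>

inductive wn_graph :: "'o measure \<Rightarrow> 'e measure \<Rightarrow> ('e set \<Rightarrow> 'o \<Rightarrow> real)
    \<Rightarrow> ('e \<Rightarrow> real) \<Rightarrow> ('o \<Rightarrow> real) \<Rightarrow> bool"
  for P \<mu> lam where
  indicator: "A \<in> sets \<mu> \<Longrightarrow> wn_graph P \<mu> lam (indicator A) (lam A)"
| lincomb: "wn_graph P \<mu> lam f Y \<Longrightarrow> wn_graph P \<mu> lam g Z \<Longrightarrow>
    wn_graph P \<mu> lam (\<lambda>x. a * f x + b * g x) (\<lambda>\<omega>. a * Y \<omega> + b * Z \<omega>)"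
| limit: "(\<And>n. wn_graph P \<mu> lam (f n) (Y n)) \<Longrightarrow> g \<in> L2 \<mu> \<Longrightarrow> Z \<in> L2 P \<Longrightarrow>
    L2_tendsto \<mu> f g \<Longrightarrow> L2_tendsto P Y Z \<Longrightarrow> wn_graph P \<mu> lam g Z"

text \<open>
  The covariances determine the inner products of step functions, hence the integral.
\<close>

definition orthogonal_measure :: "'o measure \<Rightarrow> 'e measure \<Rightarrow> ('e set \<Rightarrow> 'o \<Rightarrow> real) \<Rightarrow> bool" where
  "orthogonal_measure P \<mu> lam \<longleftrightarrow> (\<forall>A\<in>sets \<mu>. lam A \<in> L2 P) \<and>
     (\<forall>A\<in>sets \<mu>. \<forall>B\<in>sets \<mu>. (\<integral>\<omega>. lam A \<omega> * lam B \<omega> \<partial>P) = measure \<mu> (A \<inter> B))"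

context
  fixes P :: "'o measure" and \<mu> :: "'e measure" and lam :: "'e set \<Rightarrow> 'o \<Rightarrow> real"
  assumes fin_P: "finite_measure P" and fin: "finite_measure \<mu>"
    and orth: "orthogonal_measure P \<mu> lam"
begin

lemma wn_graph_L2:
  assumes "wn_graph P \<mu> lam f Y" shows "f \<in> L2 \<mu>" "Y \<in> L2 P"
proof -
  have "f \<in> L2 \<mu> \<and> Y \<in> L2 P"
    using assms
  proof induction
    case (indicator A)
    thus ?case using orth indicator_L2[OF fin] by (auto simp: orthogonal_measure_def)
  qed (auto intro: L2_add L2_mult)
  thus "f \<in> L2 \<mu>" "Y \<in> L2 P" by auto
qed

text \<open>
  Linearity and continuity carry the covariance identity from sets to the closed hull, first in
  one argument and then, in the next lemma, in the other.
\<close>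

lemma wn_graph_inner_indicator:
  assumes "wn_graph P \<mu> lam f Y" "B \<in> sets \<mu>"
  shows "(\<integral>\<omega>. Y \<omega> * lam B \<omega> \<partial>P) = (\<integral>x. f x * indicator B x \<partial>\<mu>)"
  using assms(1)
proof induction
  case (indicator A)
  thus ?case using orth assms(2)
    by (auto simp: orthogonal_measure_def indicator_inter_arith[symmetric])
next
  case (lincomb f Y g Z a b)
  note * = integrable_mult_L2[OF wn_graph_L2(2) wn_graph_L2(2)[OF wn_graph.indicator[OF assms(2)]]]
    integrable_mult_L2[OF wn_graph_L2(1) wn_graph_L2(1)[OF wn_graph.indicator[OF assms(2)]]]
  show ?case
    using lincomb.IH *[OF lincomb.hyps(1)] *[OF lincomb.hyps(2)]
    by (simp add: distrib_right mult.assoc)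
next
  case (limit f Y g Z)
  note B = wn_graph_L2[OF wn_graph.indicator[OF assms(2)]]
  have "(\<lambda>n. \<integral>\<omega>. Y n \<omega> * lam B \<omega> \<partial>P) \<longlonglongrightarrow> (\<integral>\<omega>. Z \<omega> * lam B \<omega> \<partial>P)"
    by (intro tendsto_integral_mult_L2 wn_graph_L2(2)[OF limit.hyps(1)] limit B)
  moreover have "(\<lambda>n. \<integral>x. f n x * indicator B x \<partial>\<mu>) \<longlonglongrightarrow> (\<integral>x. g x * indicator B x \<partial>\<mu>)"
    by (intro tendsto_integral_mult_L2 wn_graph_L2(1)[OF limit.hyps(1)] limit B)
  ultimately show ?case using LIMSEQ_unique unfolding limit.IH by blast
qed

lemma wn_graph_inner:
  assumes "wn_graph P \<mu> lam f Y" "wn_graph P \<mu> lam g Z"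
  shows "(\<integral>\<omega>. Y \<omega> * Z \<omega> \<partial>P) = (\<integral>x. f x * g x \<partial>\<mu>)"
  using assms(1)
proof induction
  case (indicator A)
  show ?case using wn_graph_inner_indicator[OF assms(2) indicator] by (simp add: mult.commute)
next
  case (lincomb f Y f' Y' a b)
  note * = integrable_mult_L2[OF wn_graph_L2(2) wn_graph_L2(2)[OF assms(2)]]
    integrable_mult_L2[OF wn_graph_L2(1) wn_graph_L2(1)[OF assms(2)]]
  show ?case
    using lincomb.IH *[OF lincomb.hyps(1)] *[OF lincomb.hyps(2)]
    by (simp add: distrib_right mult.assoc)
next
  case (limit f Y f' Y')
  note gZ = wn_graph_L2[OF assms(2)]
  have "(\<lambda>n. \<integral>\<omega>. Y n \<omega> * Z \<omega> \<partial>P) \<longlonglongrightarrow> (\<integral>\<omega>. Y' \<omega> * Z \<omega> \<partial>P)"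
    by (intro tendsto_integral_mult_L2 wn_graph_L2(2)[OF limit.hyps(1)] limit gZ)
  moreover have "(\<lambda>n. \<integral>x. f n x * g x \<partial>\<mu>) \<longlonglongrightarrow> (\<integral>x. f' x * g x \<partial>\<mu>)"
    by (intro tendsto_integral_mult_L2 wn_graph_L2(1)[OF limit.hyps(1)] limit gZ)
  ultimately show ?case using LIMSEQ_unique unfolding limit.IH by blast
qed

lemma wn_graph_isometry:
  assumes "wn_graph P \<mu> lam f Y" shows "L2_norm P Y = L2_norm \<mu> f"
  using wn_graph_inner[OF assms assms] by (simp add: L2_norm_def power2_eq_square)

lemma wn_graph_unique:
  assumes "wn_graph P \<mu> lam f Y" "wn_graph P \<mu> lam f Z" shows "AE \<omega> in P. Y \<omega> = Z \<omega>"
proof -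
  have *: "wn_graph P \<mu> lam (\<lambda>x. 1 * f x + (-1) * f x) (\<lambda>\<omega>. 1 * Y \<omega> + (-1) * Z \<omega>)"
    using assms by (rule wn_graph.lincomb)
  have "L2_norm P (\<lambda>\<omega>. 1 * Y \<omega> + (-1) * Z \<omega>) = 0"
    unfolding wn_graph_isometry[OF *] by (simp add: L2_norm_def)
  thus ?thesis using L2_norm_eq_0_iff[OF wn_graph_L2(2)[OF *]] by simp
qed

text \<open>
  By isometry the integrals of an \<open>L\<^sup>2\<close>-convergent sequence form a Cauchy sequence.
\<close>

lemma wn_graph_total:
  assumes "f \<in> L2 \<mu>" shows "\<exists>Y. wn_graph P \<mu> lam f Y"
  using fin assms
proof (induction rule: L2_induct)
  case (indicator A)
  thus ?case by (blast intro: wn_graph.indicator)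
next
  case (lincomb f g a b)
  thus ?case by (blast intro: wn_graph.lincomb)
next
  case (limit f g)
  obtain Y where Y: "\<And>n. wn_graph P \<mu> lam (f n) (Y n)" using limit.IH by metis
  have diff: "L2_norm P (\<lambda>\<omega>. Y p \<omega> - Y q \<omega>) = L2_norm \<mu> (\<lambda>x. f p x - f q x)" for p q
    using wn_graph_isometry[OF wn_graph.lincomb[OF Y[of p] Y[of q], of 1 "-1"]] by simp
  have "\<exists>Z\<in>L2 P. L2_tendsto P Y Z"
  proof (rule L2_complete[OF fin_P])
    show "Y n \<in> L2 P" for n by (rule wn_graph_L2(2)[OF Y])
    fix e :: real assume "0 < e"
    then obtain n0 where n0: "\<And>p. p \<ge> n0 \<Longrightarrow> L2_norm \<mu> (\<lambda>x. f p x - g x) < e / 2"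
      using limit.hyps unfolding L2_tendsto_def
      by (fastforce dest: LIMSEQ_D[where r = "e / 2"])
    have "L2_norm P (\<lambda>\<omega>. Y p \<omega> - Y q \<omega>) < e" if "p \<ge> n0" "q \<ge> n0" for p q
      using n0[OF that(1)] n0[OF that(2)]
        L2_norm_triangle_diff[OF limit.hyps(1)[of p] limit.hyps(2) limit.hyps(1)[of q]]
      unfolding diff L2_norm_minus_commute[of \<mu> g] by linarith
    thus "\<exists>n0. \<forall>p\<ge>n0. \<forall>q\<ge>n0. L2_norm P (\<lambda>\<omega>. Y p \<omega> - Y q \<omega>) < e" by blast
  qed
  thus ?case using wn_graph.limit[OF Y limit.hyps(2) _ limit.hyps(3)] by blast
qed

lemma isometric_extension_exists: "\<exists>J. isometric_extension P \<mu> lam J"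
proof -
  define J where "J f = (SOME Y. wn_graph P \<mu> lam f Y)" for f :: "'e \<Rightarrow> real"
  have J: "wn_graph P \<mu> lam f (J f)" if "f \<in> L2 \<mu>" for f
    unfolding J_def using wn_graph_total[OF that] by (rule someI_ex)
  have "isometric_extension P \<mu> lam J"
    unfolding isometric_extension_def
  proof (intro conjI ballI allI)
    fix f :: "'e \<Rightarrow> real" assume f: "f \<in> L2 \<mu>"
    show "J f \<in> L2 P" "L2_norm P (J f) = L2_norm \<mu> f"
      using wn_graph_L2(2)[OF J[OF f]] wn_graph_isometry[OF J[OF f]] by auto
    fix g :: "'e \<Rightarrow> real" and a b assume g: "g \<in> L2 \<mu>"
    show "AE \<omega> in P. J (\<lambda>x. a * f x + b * g x) \<omega> = a * J f \<omega> + b * J g \<omega>"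
      using f g by (intro wn_graph_unique[OF J wn_graph.lincomb[OF J J]] L2_add L2_mult)
  next
    fix A assume "A \<in> sets \<mu>"
    thus "AE \<omega> in P. J (indicator A) \<omega> = lam A \<omega>"
      by (intro wn_graph_unique[OF J] indicator_L2[OF fin] wn_graph.indicator)
  qed
  thus ?thesis by blast
qed

end

lemma isometric_extensionD:
  fixes f g :: "'e \<Rightarrow> real"
  assumes "isometric_extension P \<mu> lam J"
  shows "f \<in> L2 \<mu> \<Longrightarrow> J f \<in> L2 P"
    and "f \<in> L2 \<mu> \<Longrightarrow> L2_norm P (J f) = L2_norm \<mu> f"
    and "f \<in> L2 \<mu> \<Longrightarrow> g \<in> L2 \<mu> \<Longrightarrow> AE \<omega> in P. J (\<lambda>x. a * f x + b * g x) \<omega> = a * J f \<omega> + b * J g \<omega>"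
    and "A \<in> sets \<mu> \<Longrightarrow> AE \<omega> in P. J (indicator A) \<omega> = lam A \<omega>"
  using assms by (auto simp: isometric_extension_def)

lemma isometric_extension_diff:
  fixes f g :: "'e \<Rightarrow> real"
  assumes J: "isometric_extension P \<mu> lam J" and f: "f \<in> L2 \<mu>" and g: "g \<in> L2 \<mu>"
  shows "L2_norm P (\<lambda>\<omega>. J f \<omega> - J g \<omega>) = L2_norm \<mu> (\<lambda>x. f x - g x)"
proof -
  note D = isometric_extensionD[OF J]
  have "L2_norm P (\<lambda>\<omega>. J f \<omega> - J g \<omega>) = L2_norm P (J (\<lambda>x. 1 * f x + (-1) * g x))"
  proof (rule L2_norm_cong_AE)
    show "AE \<omega> in P. J f \<omega> - J g \<omega> = J (\<lambda>x. 1 * f x + (-1) * g x) \<omega>"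
      using D(3)[OF f g, of 1 "-1"] by eventually_elim simp
  qed (intro L2_measurable L2_diff L2_add L2_mult D(1) f g)+
  also have "\<dots> = L2_norm \<mu> (\<lambda>x. f x - g x)"
    using D(2)[OF L2_add[OF L2_mult[OF f, of 1] L2_mult[OF g, of "-1"]]] by simp
  finally show ?thesis .
qed

lemma isometric_extension_tendsto:
  fixes g :: "'e \<Rightarrow> real"
  assumes "isometric_extension P \<mu> lam J" "\<And>n. f n \<in> L2 \<mu>" "g \<in> L2 \<mu>" "L2_tendsto \<mu> f g"
  shows "L2_tendsto P (\<lambda>n. J (f n)) (J g)"
  using assms(4) unfolding L2_tendsto_def isometric_extension_diff[OF assms(1-3)] .

text \<open>
  The integral is a choice among all isometric extensions; uniqueness lets any explicit extension
  stand in for it.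
\<close>

lemma isometric_extension_unique:
  fixes f :: "'e \<Rightarrow> real"
  assumes fin: "finite_measure \<mu>" and J: "isometric_extension P \<mu> lam J"
    and J': "isometric_extension P \<mu> lam J'" and f: "f \<in> L2 \<mu>"
  shows "AE \<omega> in P. J f \<omega> = J' f \<omega>"
  using fin f
proof (induction rule: L2_induct)
  case (indicator A)
  show ?case using isometric_extensionD(4)[OF J indicator] isometric_extensionD(4)[OF J' indicator]
    by eventually_elim simp
next
  case (lincomb f g a b)
  show ?case
    using isometric_extensionD(3)[OF J lincomb.hyps, of a b]
      isometric_extensionD(3)[OF J' lincomb.hyps, of a b] lincomb.IH
    by eventually_elim simp
next
  case (limit f g)
  note D = isometric_extensionD(1)[OF J] isometric_extensionD(1)[OF J']
  have "L2_tendsto P (\<lambda>n. J (f n)) (J g)"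
    by (intro isometric_extension_tendsto[OF J] limit)
  moreover have "L2_tendsto P (\<lambda>n. J (f n)) (J' g)"
    using L2_tendsto_cong[OF limit.IH D(1)[OF limit.hyps(1)] D(2)[OF limit.hyps(1)]
        D(2)[OF limit.hyps(2)]] isometric_extension_tendsto[OF J' limit.hyps] by simp
  ultimately show ?case by (rule L2_tendsto_unique[rotated 3]) (intro D limit.hyps)+
qed

lemma wn_integral_isometric_extension:
  assumes "isometric_extension P \<mu> lam J"
  shows "isometric_extension P \<mu> lam (wn_integral P \<mu> lam)"
  unfolding wn_integral_def by (rule someI[of _ J]) fact


section \<open>White noise measures are orthogonal\<close>

lemma centered_gaussian_moments:
  assumes "0 \<le> v"
  shows "(\<integral>x. x \<partial>centered_gaussian v) = 0" and "(\<integral>x. x\<^sup>2 \<partial>centered_gaussian v) = v"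
proof -
  have "(\<integral>x. x \<partial>centered_gaussian v) = 0 \<and> (\<integral>x. x\<^sup>2 \<partial>centered_gaussian v) = v"
  proof (cases "v = 0")
    case True
    thus ?thesis by (simp add: centered_gaussian_def integral_return)
  next
    case False
    hence v: "0 < sqrt v" using assms by simp
    have "(\<integral>x. x \<partial>centered_gaussian v) = (\<integral>x. normal_density 0 (sqrt v) x * x \<partial>lborel)"
      using False by (simp add: centered_gaussian_def integral_density)
    also have "\<dots> = 0" by (rule integral_normal_moment_nz_1[OF v])
    finally have mean: "(\<integral>x. x \<partial>centered_gaussian v) = 0" .
    have "(\<integral>x. x\<^sup>2 \<partial>centered_gaussian v) = (\<integral>x. normal_density 0 (sqrt v) x * (x - 0)^(2 * 1) \<partial>lborel)"
      using False by (simp add: centered_gaussian_def integral_density)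
    also have "\<dots> = v"
      using assms by (subst integral_normal_moment_even[OF v]) (simp add: fact_numeral)
    finally show ?thesis using mean by simp
  qed
  thus "(\<integral>x. x \<partial>centered_gaussian v) = 0" "(\<integral>x. x\<^sup>2 \<partial>centered_gaussian v) = v" by auto
qed

lemma indep_vars_mult_integral:
  fixes X :: "'i \<Rightarrow> 'o \<Rightarrow> real"
  assumes P: "prob_space P" and "i \<noteq> j"
    and indep: "prob_space.indep_vars P (\<lambda>_. borel) X {i, j}"
    and int: "integrable P (X i)" "integrable P (X j)" and mean: "(\<integral>\<omega>. X i \<omega> \<partial>P) = 0"
  shows "(\<integral>\<omega>. X i \<omega> * X j \<omega> \<partial>P) = 0"
proof -
  interpret prob_space P by fact
  have "(\<integral>\<omega>. (\<Prod>k\<in>{i, j}. X k \<omega>) \<partial>P) = (\<Prod>k\<in>{i, j}. \<integral>\<omega>. X k \<omega> \<partial>P)"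
    by (rule indep_vars_lebesgue_integral) (use indep int in auto)
  thus ?thesis using \<open>i \<noteq> j\<close> mean by simp
qed

context
  fixes P :: "'o measure" and \<mu> :: "'e measure" and lam :: "'e set \<Rightarrow> 'o \<Rightarrow> real"
  assumes wn: "white_noise P \<mu> lam"
begin

lemma white_noise_prob: "prob_space P" and white_noise_finite: "finite_measure \<mu>"
  using wn by (auto simp: white_noise_def)

lemma white_noise_L2: "A \<in> sets \<mu> \<Longrightarrow> lam A \<in> L2 P"
  using wn by (auto simp: white_noise_def)

lemma white_noise_moments:
  assumes A: "A \<in> sets \<mu>"
  shows "integrable P (lam A)" "(\<integral>\<omega>. lam A \<omega> \<partial>P) = 0" "(\<integral>\<omega>. (lam A \<omega>)\<^sup>2 \<partial>P) = measure \<mu> A"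
proof -
  note [measurable] = L2_measurable[OF white_noise_L2[OF A]]
  have distr: "distr P borel (lam A) = centered_gaussian (measure \<mu> A)"
    using wn A by (auto simp: white_noise_def)
  show "integrable P (lam A)"
    by (rule integral_abs_le_L2_norm(1)[OF prob_space.finite_measure[OF white_noise_prob] white_noise_L2[OF A]])
  have "(\<integral>\<omega>. lam A \<omega> \<partial>P) = (\<integral>x. x \<partial>distr P borel (lam A))"
    by (subst integral_distr) auto
  thus "(\<integral>\<omega>. lam A \<omega> \<partial>P) = 0" by (simp add: distr centered_gaussian_moments)
  have "(\<integral>\<omega>. (lam A \<omega>)\<^sup>2 \<partial>P) = (\<integral>x. x\<^sup>2 \<partial>distr P borel (lam A))"
    by (subst integral_distr) auto
  thus "(\<integral>\<omega>. (lam A \<omega>)\<^sup>2 \<partial>P) = measure \<mu> A" by (simp add: distr centered_gaussian_moments)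
qed

lemma white_noise_disjoint_orthogonal:
  assumes A: "A \<in> sets \<mu>" and B: "B \<in> sets \<mu>" and AB: "A \<inter> B = {}"
  shows "(\<integral>\<omega>. lam A \<omega> * lam B \<omega> \<partial>P) = 0"
proof -
  define C where "C i = (if i = 0 then A else B)" for i :: nat
  have "\<forall>k::nat. \<forall>A. A ` {..<k} \<subseteq> sets \<mu> \<and> disjoint_family_on A {..<k} \<longrightarrow>
      prob_space.indep_vars P (\<lambda>_. borel) (\<lambda>i. lam (A i)) {..<k}"
    using wn by (auto simp: white_noise_def)
  moreover have "C ` {..<2} \<subseteq> sets \<mu> \<and> disjoint_family_on C {..<2}"
    using A B AB by (auto simp: C_def disjoint_family_on_def)
  ultimately have "prob_space.indep_vars P (\<lambda>_. borel) (\<lambda>i. lam (C i)) {..<2}" by blast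
  moreover have "{..<2} = {0, 1 :: nat}" by auto
  ultimately have "(\<integral>\<omega>. lam (C 0) \<omega> * lam (C 1) \<omega> \<partial>P) = 0"
    using white_noise_moments[OF A] white_noise_moments[OF B]
    by (intro indep_vars_mult_integral[where X = "\<lambda>i. lam (C i)"] white_noise_prob) (auto simp: C_def)
  thus ?thesis by (simp add: C_def)
qed

text \<open>
  \<open>\<sigma>\<close>-additivity for the sequence \<open>A, B, {}, {}, \<dots>\<close>; the value on \<open>{}\<close> has variance \<open>0\<close>.
\<close>

lemma white_noise_additive:
  assumes A: "A \<in> sets \<mu>" and B: "B \<in> sets \<mu>" and AB: "A \<inter> B = {}"
  shows "AE \<omega> in P. lam (A \<union> B) \<omega> = lam A \<omega> + lam B \<omega>"
proof -
  have empty: "AE \<omega> in P. lam {} \<omega> = 0"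
    using L2_norm_eq_0_iff[OF white_noise_L2[OF sets.empty_sets]]
      white_noise_moments(3)[OF sets.empty_sets] by (simp add: L2_norm_def)
  define C where "C i = (if i = 0 then A else if i = 1 then B else {})" for i :: nat
  have C: "C i \<in> sets \<mu>" for i using A B by (auto simp: C_def)
  have sum_L2: "(\<lambda>\<omega>. \<Sum>i<n. lam (C i) \<omega>) \<in> L2 P" for n by (intro L2_sum white_noise_L2 C)
  have "range C \<subseteq> sets \<mu> \<and> disjoint_family C"
    using C AB by (auto simp: disjoint_family_on_def) (auto simp: C_def split: if_splits)
  hence lim: "L2_tendsto P (\<lambda>n \<omega>. \<Sum>i<n. lam (C i) \<omega>) (lam (\<Union>i. C i))"
    using wn unfolding white_noise_def by blast
  have UN: "(\<Union>i. C i) = A \<union> B"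
    by (auto simp: C_def split: if_splits)
  have const: "AE \<omega> in P. (\<Sum>i<Suc (Suc n). lam (C i) \<omega>) = lam A \<omega> + lam B \<omega>" for n
    using empty
  proof eventually_elim
    case (elim \<omega>)
    have "(\<Sum>i<Suc (Suc n). lam (C i) \<omega>) = (\<Sum>i\<in>{0, 1}. lam (C i) \<omega>)"
      by (intro sum.mono_neutral_right) (auto simp: C_def elim)
    thus ?case by (simp add: C_def)
  qed
  have "L2_tendsto P (\<lambda>n \<omega>. \<Sum>i<Suc (Suc n). lam (C i) \<omega>) (lam (A \<union> B))"
    using lim LIMSEQ_ignore_initial_segment[where k = 2] unfolding L2_tendsto_def UN by fastforce
  hence "L2_tendsto P (\<lambda>n \<omega>. lam A \<omega> + lam B \<omega>) (lam (A \<union> B))"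
    by (subst (asm) L2_tendsto_cong[OF const])
       (use A B in \<open>auto intro!: sum_L2 L2_add white_noise_L2 simp del: sum.lessThan_Suc\<close>)
  from L2_tendsto_unique[OF _ _ _ this L2_tendsto_const] show ?thesis
    using A B by (auto intro: L2_add white_noise_L2)
qed

text \<open>
  Splitting \<open>A\<close> and \<open>B\<close> along \<open>A \<inter> B\<close> leaves the variance on \<open>A \<inter> B\<close> as the only nonzero term.
\<close>

lemma white_noise_orthogonal: "orthogonal_measure P \<mu> lam"
  unfolding orthogonal_measure_def
proof (intro conjI ballI)
  fix A B assume A: "A \<in> sets \<mu>" and B: "B \<in> sets \<mu>"
  let ?C = "A \<inter> B"
  have C: "?C \<in> sets \<mu>" and DA: "A - ?C \<in> sets \<mu>" and DB: "B - ?C \<in> sets \<mu>" using A B by auto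
  note L = white_noise_L2
  have A': "AE \<omega> in P. lam A \<omega> = lam ?C \<omega> + lam (A - ?C) \<omega>"
    using white_noise_additive[OF C DA] by (simp add: Un_absorb1)
  have B': "AE \<omega> in P. lam B \<omega> = lam ?C \<omega> + lam (B - ?C) \<omega>"
    using white_noise_additive[OF C DB] by (simp add: Un_absorb1)
  have "(\<integral>\<omega>. lam A \<omega> * lam B \<omega> \<partial>P) = (\<integral>\<omega>. (lam ?C \<omega>)\<^sup>2 + lam ?C \<omega> * lam (B - ?C) \<omega>
      + lam (A - ?C) \<omega> * lam ?C \<omega> + lam (A - ?C) \<omega> * lam (B - ?C) \<omega> \<partial>P)"
  proof (rule integral_cong_AE)
    show "AE \<omega> in P. lam A \<omega> * lam B \<omega> = (lam ?C \<omega>)\<^sup>2 + lam ?C \<omega> * lam (B - ?C) \<omega>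
      + lam (A - ?C) \<omega> * lam ?C \<omega> + lam (A - ?C) \<omega> * lam (B - ?C) \<omega>"
      using A' B' by eventually_elim (simp add: algebra_simps power2_eq_square)
  qed (use L2_measurable[OF L] A B C DA DB in measurable)
  also have "\<dots> = (\<integral>\<omega>. (lam ?C \<omega>)\<^sup>2 \<partial>P)"
    using L2_integrable[OF L[OF C]] integrable_mult_L2[OF L[OF C] L[OF DB]]
      integrable_mult_L2[OF L[OF DA] L[OF C]] integrable_mult_L2[OF L[OF DA] L[OF DB]]
      white_noise_disjoint_orthogonal[OF C DB] white_noise_disjoint_orthogonal[OF DA C]
      white_noise_disjoint_orthogonal[OF DA DB]
    by (simp add: Int_Diff Diff_Int_distrib Diff_Int_distrib2 Diff_Int Int_Un_distrib)
  finally show "(\<integral>\<omega>. lam A \<omega> * lam B \<omega> \<partial>P) = measure \<mu> (A \<inter> B)"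
    using white_noise_moments(3)[OF C] by simp
qed (rule white_noise_L2)

lemma white_noise_integral: "isometric_extension P \<mu> lam (wn_integral P \<mu> lam)"
  using isometric_extension_exists[OF prob_space.finite_measure[OF white_noise_prob]
      white_noise_finite white_noise_orthogonal] wn_integral_isometric_extension by blast

end


section \<open>Orthonormal expansions\<close>

lemma inner_projection:
  fixes e :: "nat \<Rightarrow> 'h::real_inner"
  assumes e: "complete_orthonormal N e" and I: "finite I" "I \<subseteq> N" and n: "n \<in> I"
  shows "(\<Sum>k\<in>I. (h \<bullet> e k) *\<^sub>R e k) \<bullet> e n = h \<bullet> e n"
proof -
  have "(\<Sum>k\<in>I. (h \<bullet> e k) *\<^sub>R e k) \<bullet> e n = (\<Sum>k\<in>I. (h \<bullet> e k) * (e k \<bullet> e n))"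
    by (simp add: inner_sum_left)
  also have "\<dots> = (\<Sum>k\<in>I. if k = n then h \<bullet> e n else 0)"
    using e I n by (intro sum.cong) (auto simp: complete_orthonormal_def subset_iff)
  finally show ?thesis using I n by simp
qed

lemma norm_squared_minus_projection:
  fixes e :: "nat \<Rightarrow> 'h::real_inner"
  assumes e: "complete_orthonormal N e" and I: "finite I" "I \<subseteq> N"
  shows "(norm (h - (\<Sum>n\<in>I. (h \<bullet> e n) *\<^sub>R e n)))\<^sup>2 = (norm h)\<^sup>2 - (\<Sum>n\<in>I. (h \<bullet> e n)\<^sup>2)"
proof -
  define p where "p = (\<Sum>n\<in>I. (h \<bullet> e n) *\<^sub>R e n)"
  have "p \<bullet> e n = h \<bullet> e n" if "n \<in> I" for n
    unfolding p_def by (rule inner_projection[OF e I that])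
  hence "p \<bullet> p = (\<Sum>n\<in>I. (h \<bullet> e n)\<^sup>2)"
    by (subst (2) p_def) (simp add: inner_sum_right power2_eq_square)
  moreover have "h \<bullet> p = (\<Sum>n\<in>I. (h \<bullet> e n)\<^sup>2)"
    by (simp add: p_def inner_sum_right power2_eq_square)
  ultimately show ?thesis
    unfolding p_def[symmetric]
    by (simp add: power2_norm_eq_inner inner_diff_left inner_diff_right inner_commute)
qed

lemma Bessel_inequality:
  fixes e :: "nat \<Rightarrow> 'h::real_inner"
  assumes "complete_orthonormal N e" "finite I" "I \<subseteq> N"
  shows "(\<Sum>n\<in>I. (h \<bullet> e n)\<^sup>2) \<le> (norm h)\<^sup>2"
  using norm_squared_minus_projection[OF assms, of h]
    zero_le_power2[of "norm (h - (\<Sum>n\<in>I. (h \<bullet> e n) *\<^sub>R e n))"] by linarith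

text \<open>
  Some element of the span of finitely many \<open>e\<^sub>n\<close> is close to \<open>h\<close>, and the orthogonal projection
  onto that span is closer still.
\<close>

lemma Parseval_limit:
  fixes e :: "nat \<Rightarrow> 'h::real_inner"
  assumes e: "complete_orthonormal N e"
  shows "(\<lambda>k. \<Sum>n\<in>N \<inter> {..<k}. (h \<bullet> e n)\<^sup>2) \<longlonglongrightarrow> (norm h)\<^sup>2"
proof (rule LIMSEQ_I)
  fix r :: real assume r: "0 < r"
  have "h \<in> closure (span (e ` N))" using e by (simp add: complete_orthonormal_def)
  then obtain y where y: "y \<in> span (e ` N)" "dist y h < sqrt r"
    unfolding closure_approachable using r by (metis real_sqrt_gt_0_iff)
  then obtain t where t: "finite t" "t \<subseteq> e ` N" "y \<in> span t"
    unfolding span_explicit by (auto intro: that span_sum span_scale span_base)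
  then obtain I where I: "I \<subseteq> N" "finite I" "t = e ` I" by (meson finite_subset_image)
  then obtain k0 where k0: "I \<subseteq> {..<k0}" using finite_nat_iff_bounded by blast
  have "norm ((\<Sum>n\<in>N \<inter> {..<k}. (h \<bullet> e n)\<^sup>2) - (norm h)\<^sup>2) < r" if k: "k0 \<le> k" for k
  proof -
    let ?I = "N \<inter> {..<k}"
    define p where "p = (\<Sum>n\<in>?I. (h \<bullet> e n) *\<^sub>R e n)"
    have "orthogonal (h - p) (p - y)"
    proof (rule orthogonal_to_span[of _ "e ` ?I"])
      have "I \<subseteq> ?I" using I k0 k by auto
      hence "y \<in> span (e ` ?I)" using t(3) I(3) span_mono[of "e ` I" "e ` ?I"] by auto
      moreover have "p \<in> span (e ` ?I)"
        unfolding p_def by (intro span_sum span_scale span_base) auto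
      ultimately show "p - y \<in> span (e ` ?I)" by (intro span_diff)
      fix z assume "z \<in> e ` ?I"
      then obtain n where n: "n \<in> ?I" "z = e n" by auto
      have "p \<bullet> e n = h \<bullet> e n"
        unfolding p_def by (rule inner_projection[OF e _ _ n(1)]) auto
      thus "orthogonal (h - p) z" by (simp add: orthogonal_def n inner_diff_left)
    qed
    hence "(norm (h - y))\<^sup>2 = (norm (h - p))\<^sup>2 + (norm (p - y))\<^sup>2"
      using norm_add_Pythagorean[of "h - p" "p - y"] by simp
    hence "(norm (h - p))\<^sup>2 \<le> (norm (h - y))\<^sup>2" by simp
    also have "\<dots> < r"
      using power_strict_mono[OF y(2) zero_le_dist, of 2] r by (simp add: dist_norm norm_minus_commute)
    finally have "(norm h)\<^sup>2 - (\<Sum>n\<in>?I. (h \<bullet> e n)\<^sup>2) < r"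
      using norm_squared_minus_projection[OF e, of ?I h] by (simp add: p_def)
    moreover have "(\<Sum>n\<in>?I. (h \<bullet> e n)\<^sup>2) \<le> (norm h)\<^sup>2" by (rule Bessel_inequality[OF e]) auto
    ultimately show ?thesis by simp
  qed
  thus "\<exists>k0. \<forall>k\<ge>k0. norm ((\<Sum>n\<in>N \<inter> {..<k}. (h \<bullet> e n)\<^sup>2) - (norm h)\<^sup>2) < r" by blast
qed


section \<open>The isometry defined by a Hilbert space valued white noise\<close>

definition L2_isometry :: "'o measure \<Rightarrow> 'w measure
    \<Rightarrow> (('w \<Rightarrow> 'h::{second_countable_topology,real_inner}) \<Rightarrow> 'o \<Rightarrow> real) \<Rightarrow> bool" where
  "L2_isometry P m T \<longleftrightarrow>
     (\<forall>\<psi>\<in>L2 m. T \<psi> \<in> L2 P \<and> L2_norm P (T \<psi>) = L2_norm m \<psi>) \<and>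
     (\<forall>\<psi>\<in>L2 m. \<forall>\<phi>\<in>L2 m. \<forall>a b.
        AE \<omega> in P. T (\<lambda>w. a *\<^sub>R \<psi> w + b *\<^sub>R \<phi> w) \<omega> = a * T \<psi> \<omega> + b * T \<phi> \<omega>)"

context
  fixes P :: "'o measure" and m :: "'w measure"
    and T :: "('w \<Rightarrow> 'h::{second_countable_topology,real_inner}) \<Rightarrow> 'o \<Rightarrow> real"
  assumes T: "L2_isometry P m T"
begin

lemma L2_isometry_L2: "\<psi> \<in> L2 m \<Longrightarrow> T \<psi> \<in> L2 P"
  and L2_isometry_norm: "\<psi> \<in> L2 m \<Longrightarrow> L2_norm P (T \<psi>) = L2_norm m \<psi>"
  and L2_isometry_lincomb: "\<psi> \<in> L2 m \<Longrightarrow> \<phi> \<in> L2 m \<Longrightarrow>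
      AE \<omega> in P. T (\<lambda>w. a *\<^sub>R \<psi> w + b *\<^sub>R \<phi> w) \<omega> = a * T \<psi> \<omega> + b * T \<phi> \<omega>"
  using T unfolding L2_isometry_def by blast+

lemma L2_isometry_diff:
  assumes "\<psi> \<in> L2 m" "\<phi> \<in> L2 m"
  shows "L2_norm P (\<lambda>\<omega>. T \<psi> \<omega> - T \<phi> \<omega>) = L2_norm m (\<lambda>w. \<psi> w - \<phi> w)"
proof -
  note L = L2_add[OF L2_scaleR[OF assms(1), of 1] L2_scaleR[OF assms(2), of "-1"]]
  have "L2_norm P (\<lambda>\<omega>. T \<psi> \<omega> - T \<phi> \<omega>) = L2_norm P (T (\<lambda>w. 1 *\<^sub>R \<psi> w + (-1) *\<^sub>R \<phi> w))"
  proof (rule L2_norm_cong_AE)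
    show "AE \<omega> in P. T \<psi> \<omega> - T \<phi> \<omega> = T (\<lambda>w. 1 *\<^sub>R \<psi> w + (-1) *\<^sub>R \<phi> w) \<omega>"
      using L2_isometry_lincomb[OF assms, of 1 "-1"] by eventually_elim simp
  qed (intro L2_measurable L2_diff L2_isometry_L2 L assms)+
  also have "\<dots> = L2_norm m (\<lambda>w. \<psi> w - \<phi> w)" using L2_isometry_norm[OF L] by simp
  finally show ?thesis .
qed

lemma L2_isometry_cong:
  assumes "\<psi> \<in> L2 m" "\<phi> \<in> L2 m" "AE w in m. \<psi> w = \<phi> w"
  shows "AE \<omega> in P. T \<psi> \<omega> = T \<phi> \<omega>"
proof -
  have "L2_norm P (\<lambda>\<omega>. T \<psi> \<omega> - T \<phi> \<omega>) = 0"
    unfolding L2_isometry_diff[OF assms(1,2)] using L2_norm_eq_0_iff[OF L2_diff[OF assms(1,2)]] assms(3)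
    by simp
  thus ?thesis using L2_norm_eq_0_iff[OF L2_diff[OF assms(1,2)[THEN L2_isometry_L2]]] by simp
qed

lemma L2_isometry_sum:
  assumes "finite I" "\<And>i. i \<in> I \<Longrightarrow> \<psi> i \<in> L2 m"
  shows "AE \<omega> in P. T (\<lambda>w. \<Sum>i\<in>I. \<psi> i w) \<omega> = (\<Sum>i\<in>I. T (\<psi> i) \<omega>)"
  using assms
proof (induction I)
  case empty
  show ?case using L2_isometry_lincomb[OF L2_zero L2_zero, of 0 0] by simp
next
  case (insert i I)
  have "AE \<omega> in P. T (\<lambda>w. 1 *\<^sub>R \<psi> i w + 1 *\<^sub>R (\<Sum>i\<in>I. \<psi> i w)) \<omega>
      = 1 * T (\<psi> i) \<omega> + 1 * T (\<lambda>w. \<Sum>i\<in>I. \<psi> i w) \<omega>"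
    using insert by (intro L2_isometry_lincomb L2_sum) auto
  moreover have "AE \<omega> in P. T (\<lambda>w. \<Sum>i\<in>I. \<psi> i w) \<omega> = (\<Sum>i\<in>I. T (\<psi> i) \<omega>)"
    using insert by auto
  ultimately show ?case by eventually_elim (use insert in simp)
qed

end

text \<open>
  The value of a pairing on \<open>A\<close> is obtained by cutting the field down to \<open>A\<close>, so a single map on
  fields carries all of them.
\<close>

definition H_integral :: "'o measure \<Rightarrow> 'w measure \<Rightarrow> nat set \<Rightarrow> (nat \<Rightarrow> 'h::real_inner)
    \<Rightarrow> (nat \<Rightarrow> 'w set \<Rightarrow> 'o \<Rightarrow> real) \<Rightarrow> ('w \<Rightarrow> 'h) \<Rightarrow> 'o \<Rightarrow> real" where
  "H_integral P m N e \<nu> \<psi> =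
     L2_lim P (\<lambda>k \<omega>. \<Sum>n\<in>N \<inter> {..<k}. wn_integral P m (\<nu> n) (\<lambda>w. \<psi> w \<bullet> e n) \<omega>)"

lemma H_pairing_eq_H_integral:
  "H_pairing P m N e \<nu> \<psi> A = H_integral P m N e \<nu> (\<lambda>w. indicator A w *\<^sub>R \<psi> w)"
  by (simp add: H_pairing_def H_integral_def)

lemma L2_lim_works:
  assumes "g \<in> L2 M" "L2_tendsto M f g"
  shows "L2_lim M f \<in> L2 M" "L2_tendsto M f (L2_lim M f)"
  using someI[of "\<lambda>g. g \<in> L2 M \<and> L2_tendsto M f g" g] assms unfolding L2_lim_def by auto

context
  fixes P :: "'o measure" and m :: "'w measure" and N :: "nat set"
    and e :: "nat \<Rightarrow> 'h::{second_countable_topology,real_inner}" and \<nu> :: "nat \<Rightarrow> 'w set \<Rightarrow> 'o \<Rightarrow> real"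
  assumes fin: "finite_measure m" and \<nu>: "H_white_noise P m N e \<nu>"
begin

lemma H_white_noise_component: "n \<in> N \<Longrightarrow> white_noise P m (\<nu> n)"
  and H_white_noise_prob: "prob_space P" and H_white_noise_basis: "complete_orthonormal N e"
  using \<nu> by (auto simp: H_white_noise_def)

abbreviation (input) J where "J n \<equiv> wn_integral P m (\<nu> n)"

lemma component_integral: "n \<in> N \<Longrightarrow> isometric_extension P m (\<nu> n) (J n)"
  by (intro white_noise_integral H_white_noise_component)

lemmas J_L2 = isometric_extensionD(1)[OF component_integral]
lemmas J_norm = isometric_extensionD(2)[OF component_integral]
lemmas J_lincomb = isometric_extensionD(3)[OF component_integral]
lemmas J_indicator = isometric_extensionD(4)[OF component_integral]

lemma components_orthogonal_on_sets:
  assumes n: "n \<in> N" and k: "k \<in> N" and nk: "n \<noteq> k" and A: "A \<in> sets m" and B: "B \<in> sets m"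
  shows "(\<integral>\<omega>. \<nu> n A \<omega> * \<nu> k B \<omega> \<partial>P) = 0"
proof -
  interpret prob_space P by (rule H_white_noise_prob)
  define C where "C i = (if i = n then A else B)" for i
  have C: "C i \<in> sets m" for i using A B by (simp add: C_def)
  have "indep_vars (\<lambda>_. PiM (sets m) (\<lambda>_. borel))
       (\<lambda>n \<omega>. restrict (\<lambda>A. \<nu> n A \<omega>) (sets m)) N"
    using \<nu> by (auto simp: H_white_noise_def)
  hence "indep_vars (\<lambda>_. PiM (sets m) (\<lambda>_. borel))
       (\<lambda>n \<omega>. restrict (\<lambda>A. \<nu> n A \<omega>) (sets m)) {n, k}"
    by (rule indep_vars_subset) (use n k in auto)
  hence "indep_vars (\<lambda>_. borel) (\<lambda>i \<omega>. (restrict (\<lambda>A. \<nu> i A \<omega>) (sets m)) (C i)) {n, k}"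
    by (rule indep_vars_compose2[where Y = "\<lambda>i f. f (C i)"])
       (intro measurable_component_singleton C)
  hence "indep_vars (\<lambda>_. borel) (\<lambda>i. \<nu> i (C i)) {n, k}" by (simp add: C)
  hence "(\<integral>\<omega>. \<nu> n (C n) \<omega> * \<nu> k (C k) \<omega> \<partial>P) = 0"
    using white_noise_moments(1,2)[OF H_white_noise_component[OF n] C]
      white_noise_moments(1)[OF H_white_noise_component[OF k] C]
    by (intro indep_vars_mult_integral[where X = "\<lambda>i. \<nu> i (C i)"] H_white_noise_prob nk) auto
  thus ?thesis using nk by (simp add: C_def)
qed

text \<open>
  Independence gives the claim on indicators; \<open>step\<close> below extends it by density in one argument
  and is applied to each of them in turn.
\<close>

lemma components_orthogonal:
  assumes n: "n \<in> N" and k: "k \<in> N" and nk: "n \<noteq> k" and f: "f \<in> L2 m" and g: "g \<in> L2 m"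
  shows "(\<integral>\<omega>. J n f \<omega> * J k g \<omega> \<partial>P) = 0"
proof -
  have step: "(\<integral>\<omega>. J i h \<omega> * Z \<omega> \<partial>P) = 0"
    if i: "i \<in> N" and Z: "Z \<in> L2 P" and h: "h \<in> L2 m"
      and ind: "\<And>A. A \<in> sets m \<Longrightarrow> (\<integral>\<omega>. J i (indicator A) \<omega> * Z \<omega> \<partial>P) = 0" for i Z h
    using fin h
  proof (induction rule: L2_induct)
    case (indicator A)
    thus ?case by (rule ind)
  next
    case (lincomb f g a b)
    note L = J_L2[OF i lincomb.hyps(1)] J_L2[OF i lincomb.hyps(2)]
    have "(\<integral>\<omega>. J i (\<lambda>x. a * f x + b * g x) \<omega> * Z \<omega> \<partial>P)
        = (\<integral>\<omega>. a * (J i f \<omega> * Z \<omega>) + b * (J i g \<omega> * Z \<omega>) \<partial>P)"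
    proof (rule integral_cong_AE)
      show "AE \<omega> in P. J i (\<lambda>x. a * f x + b * g x) \<omega> * Z \<omega> = a * (J i f \<omega> * Z \<omega>) + b * (J i g \<omega> * Z \<omega>)"
        using J_lincomb[OF i lincomb.hyps, of a b] by eventually_elim (simp add: algebra_simps)
      have [measurable]: "J i (\<lambda>x. a * f x + b * g x) \<in> borel_measurable P"
        by (intro L2_measurable J_L2 i L2_add L2_mult lincomb.hyps)
      note [measurable] = L2_measurable[OF Z] L[THEN L2_measurable]
      show "(\<lambda>\<omega>. J i (\<lambda>x. a * f x + b * g x) \<omega> * Z \<omega>) \<in> borel_measurable P" by measurable
      show "(\<lambda>\<omega>. a * (J i f \<omega> * Z \<omega>) + b * (J i g \<omega> * Z \<omega>)) \<in> borel_measurable P" by measurable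
    qed
    also have "\<dots> = 0"
      using lincomb.IH integrable_mult_L2[OF L(1) Z] integrable_mult_L2[OF L(2) Z] by simp
    finally show ?case .
  next
    case (limit f g)
    have "(\<lambda>n. \<integral>\<omega>. J i (f n) \<omega> * Z \<omega> \<partial>P) \<longlonglongrightarrow> (\<integral>\<omega>. J i g \<omega> * Z \<omega> \<partial>P)"
      by (intro tendsto_integral_mult_L2 J_L2 i Z limit.hyps
          isometric_extension_tendsto[OF component_integral])
    thus ?case unfolding limit.IH by (simp add: LIMSEQ_const_iff)
  qed
  show ?thesis
  proof (rule step[OF n J_L2[OF k g] f])
    fix A assume A: "A \<in> sets m"
    have "(\<integral>\<omega>. J k g \<omega> * J n (indicator A) \<omega> \<partial>P) = 0"
    proof (rule step[OF k J_L2[OF n indicator_L2[OF fin A]] g])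
      fix B assume B: "B \<in> sets m"
      have "(\<integral>\<omega>. J k (indicator B) \<omega> * J n (indicator A) \<omega> \<partial>P) = (\<integral>\<omega>. \<nu> k B \<omega> * \<nu> n A \<omega> \<partial>P)"
      proof (rule integral_cong_AE)
        show "AE \<omega> in P. J k (indicator B) \<omega> * J n (indicator A) \<omega> = \<nu> k B \<omega> * \<nu> n A \<omega>"
          using J_indicator[OF k B] J_indicator[OF n A] by eventually_elim simp
      qed (intro borel_measurable_times L2_measurable J_L2 n k indicator_L2[OF fin] A B
          white_noise_L2[OF H_white_noise_component])+
      also have "\<dots> = 0" using nk by (intro components_orthogonal_on_sets k n A B) auto
      finally show "(\<integral>\<omega>. J k (indicator B) \<omega> * J n (indicator A) \<omega> \<partial>P) = 0" .
    qed
    thus "(\<integral>\<omega>. J n (indicator A) \<omega> * J k g \<omega> \<partial>P) = 0" by (simp add: mult.commute)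
  qed
qed

lemma partial_sum_norm:
  assumes "finite I" "I \<subseteq> N" "\<And>n. n \<in> I \<Longrightarrow> f n \<in> L2 m"
  shows "(L2_norm P (\<lambda>\<omega>. \<Sum>n\<in>I. J n (f n) \<omega>))\<^sup>2 = (\<Sum>n\<in>I. (L2_norm m (f n))\<^sup>2)"
  using assms
proof (induction I)
  case empty
  show ?case by (simp add: L2_norm_def)
next
  case (insert n I)
  have L: "J k (f k) \<in> L2 P" if "k \<in> insert n I" for k
    using insert.prems that by (intro J_L2) auto
  have S: "(\<lambda>\<omega>. \<Sum>n\<in>I. J n (f n) \<omega>) \<in> L2 P" by (intro L2_sum L) auto
  have "(\<integral>\<omega>. J n (f n) \<omega> * (\<Sum>k\<in>I. J k (f k) \<omega>) \<partial>P) = (\<Sum>k\<in>I. \<integral>\<omega>. J n (f n) \<omega> * J k (f k) \<omega> \<partial>P)"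
    unfolding sum_distrib_left by (intro Bochner_Integration.integral_sum integrable_mult_L2 L) auto
  also have "\<dots> = 0"
    using insert.prems insert.hyps by (intro sum.neutral ballI components_orthogonal) auto
  finally have "(L2_norm P (\<lambda>\<omega>. J n (f n) \<omega> + (\<Sum>k\<in>I. J k (f k) \<omega>)))\<^sup>2
      = (L2_norm P (J n (f n)))\<^sup>2 + (L2_norm P (\<lambda>\<omega>. \<Sum>k\<in>I. J k (f k) \<omega>))\<^sup>2"
    using L2_norm_add_squared[OF L[of n] S] by simp
  thus ?case using insert J_norm[of n "f n"] by simp
qed

text \<open>
  The partial sums are orthogonal series: the squared norm of an increment is an increment of
  \<open>a\<close>, the integrated partial Parseval sums, which converge by dominated convergence.
\<close>

lemma H_integral_converges:
  assumes \<psi>: "\<psi> \<in> L2 m"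
  defines "S \<equiv> \<lambda>k \<omega>. \<Sum>n\<in>N \<inter> {..<k}. J n (\<lambda>w. \<psi> w \<bullet> e n) \<omega>"
  shows "S k \<in> L2 P" "H_integral P m N e \<nu> \<psi> \<in> L2 P" "L2_tendsto P S (H_integral P m N e \<nu> \<psi>)"
    and "L2_norm P (H_integral P m N e \<nu> \<psi>) = L2_norm m \<psi>"
proof -
  note [measurable] = L2_measurable[OF \<psi>]
  have coord: "(\<lambda>w. \<psi> w \<bullet> e n) \<in> L2 m" for n by (rule L2_inner_const[OF \<psi>])
  define a where "a k = (\<Sum>n\<in>N \<inter> {..<k}. (L2_norm m (\<lambda>w. \<psi> w \<bullet> e n))\<^sup>2)" for k
  have S: "S k \<in> L2 P" for k unfolding S_def by (intro L2_sum J_L2 coord) auto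
  thus "S k \<in> L2 P" .
  have a_int: "a k = (\<integral>w. (\<Sum>n\<in>N \<inter> {..<k}. (\<psi> w \<bullet> e n)\<^sup>2) \<partial>m)" for k
    using L2_integrable[OF coord] by (simp add: a_def L2_norm_squared)
  have a_lim: "a \<longlonglongrightarrow> (\<integral>w. (norm (\<psi> w))\<^sup>2 \<partial>m)"
    unfolding a_int
  proof (rule integral_dominated_convergence[where w = "\<lambda>w. (norm (\<psi> w))\<^sup>2"])
    show "AE w in m. (\<lambda>k. \<Sum>n\<in>N \<inter> {..<k}. (\<psi> w \<bullet> e n)\<^sup>2) \<longlonglongrightarrow> (norm (\<psi> w))\<^sup>2"
      by (intro AE_I2 Parseval_limit H_white_noise_basis)
    show "AE w in m. norm (\<Sum>n\<in>N \<inter> {..<k}. (\<psi> w \<bullet> e n)\<^sup>2) \<le> (norm (\<psi> w))\<^sup>2" for k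
      using Bessel_inequality[OF H_white_noise_basis, of "N \<inter> {..<k}"]
      by (intro AE_I2) (simp add: sum_nonneg)
  qed (use L2_integrable[OF \<psi>] in auto)
  have diff: "(L2_norm P (\<lambda>\<omega>. S p \<omega> - S q \<omega>))\<^sup>2 = a p - a q" if "q \<le> p" for p q
  proof -
    have split: "N \<inter> {..<p} = (N \<inter> {..<q}) \<union> (N \<inter> {q..<p})" using that by auto
    have "S p \<omega> - S q \<omega> = (\<Sum>n\<in>N \<inter> {q..<p}. J n (\<lambda>w. \<psi> w \<bullet> e n) \<omega>)" for \<omega>
      unfolding S_def split by (subst sum.union_disjoint) auto
    moreover have "a p - a q = (\<Sum>n\<in>N \<inter> {q..<p}. (L2_norm m (\<lambda>w. \<psi> w \<bullet> e n))\<^sup>2)"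
      unfolding a_def split by (subst sum.union_disjoint) auto
    ultimately show ?thesis
      using partial_sum_norm[of "N \<inter> {q..<p}" "\<lambda>n w. \<psi> w \<bullet> e n"] coord by simp
  qed
  have "\<exists>Z\<in>L2 P. L2_tendsto P S Z"
  proof (rule L2_complete[OF prob_space.finite_measure[OF H_white_noise_prob] S])
    fix r :: real assume r: "0 < r"
    have "Cauchy a" using a_lim by (intro LIMSEQ_imp_Cauchy)
    then obtain M where M: "\<And>p q. p \<ge> M \<Longrightarrow> q \<ge> M \<Longrightarrow> norm (a p - a q) < r\<^sup>2"
      using CauchyD[of a "r\<^sup>2"] r by auto
    have lt: "L2_norm P (\<lambda>\<omega>. S p \<omega> - S q \<omega>) < r" if "M \<le> q" "q \<le> p" for p q
    proof (rule power2_less_imp_less)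
      show "(L2_norm P (\<lambda>\<omega>. S p \<omega> - S q \<omega>))\<^sup>2 < r\<^sup>2"
        unfolding diff[OF that(2)] using M[of p q] that by (simp add: abs_less_iff)
    qed (use r in simp)
    have "L2_norm P (\<lambda>\<omega>. S p \<omega> - S q \<omega>) < r" if "p \<ge> M" "q \<ge> M" for p q
      using lt[of q p] lt[of p q] that L2_norm_minus_commute[of P "S p" "S q"]
      by (cases "q \<le> p") auto
    thus "\<exists>M. \<forall>p\<ge>M. \<forall>q\<ge>M. L2_norm P (\<lambda>\<omega>. S p \<omega> - S q \<omega>) < r" by blast
  qed
  then obtain Z where Z: "Z \<in> L2 P" "L2_tendsto P S Z" by blast
  have lim: "H_integral P m N e \<nu> \<psi> = L2_lim P S"
    by (simp add: H_integral_def S_def)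
  show "H_integral P m N e \<nu> \<psi> \<in> L2 P" "L2_tendsto P S (H_integral P m N e \<nu> \<psi>)"
    unfolding lim using L2_lim_works[OF Z] by auto
  hence "(\<lambda>k. L2_norm P (S k)) \<longlonglongrightarrow> L2_norm P (H_integral P m N e \<nu> \<psi>)"
    using S by (intro tendsto_L2_norm) (auto simp: L2_tendsto_def)
  moreover have "L2_norm P (S k) = sqrt (a k)" for k
    using diff[of 0 k] by (simp add: a_def S_def real_sqrt_unique)
  hence "(\<lambda>k. L2_norm P (S k)) \<longlonglongrightarrow> L2_norm m \<psi>"
    unfolding L2_norm_def[of m] using tendsto_real_sqrt[OF a_lim] by simp
  ultimately show "L2_norm P (H_integral P m N e \<nu> \<psi>) = L2_norm m \<psi>" by (rule LIMSEQ_unique)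
qed

lemma H_integral_isometry: "L2_isometry P m (H_integral P m N e \<nu>)"
  unfolding L2_isometry_def
proof (intro conjI ballI allI)
  fix \<psi> :: "'w \<Rightarrow> 'h" assume \<psi>: "\<psi> \<in> L2 m"
  show "H_integral P m N e \<nu> \<psi> \<in> L2 P" "L2_norm P (H_integral P m N e \<nu> \<psi>) = L2_norm m \<psi>"
    by (rule H_integral_converges[OF \<psi>])+
  fix \<phi> :: "'w \<Rightarrow> 'h" and a b assume \<phi>: "\<phi> \<in> L2 m"
  let ?\<chi> = "\<lambda>w. a *\<^sub>R \<psi> w + b *\<^sub>R \<phi> w"
  let ?S = "\<lambda>\<psi> k \<omega>. \<Sum>n\<in>N \<inter> {..<k}. J n (\<lambda>w. \<psi> w \<bullet> e n) \<omega>"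
  have \<chi>: "?\<chi> \<in> L2 m" by (intro L2_add L2_scaleR \<psi> \<phi>)
  note C = H_integral_converges
  have "AE \<omega> in P. \<forall>n\<in>N. J n (\<lambda>w. ?\<chi> w \<bullet> e n) \<omega>
      = a * J n (\<lambda>w. \<psi> w \<bullet> e n) \<omega> + b * J n (\<lambda>w. \<phi> w \<bullet> e n) \<omega>"
  proof (subst AE_ball_countable, intro countableI_type, intro ballI)
    fix n assume n: "n \<in> N"
    show "AE \<omega> in P. J n (\<lambda>w. ?\<chi> w \<bullet> e n) \<omega>
      = a * J n (\<lambda>w. \<psi> w \<bullet> e n) \<omega> + b * J n (\<lambda>w. \<phi> w \<bullet> e n) \<omega>"
      using J_lincomb[OF n L2_inner_const[OF \<psi>, of "e n"] L2_inner_const[OF \<phi>, of "e n"], of a b]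
      by (simp add: inner_add_left)
  qed
  hence sums: "AE \<omega> in P. ?S ?\<chi> k \<omega> = a * ?S \<psi> k \<omega> + b * ?S \<phi> k \<omega>" for k
    by eventually_elim (simp add: sum.distrib sum_distrib_left)
  have "L2_tendsto P (\<lambda>k \<omega>. a * ?S \<psi> k \<omega> + b * ?S \<phi> k \<omega>)
      (\<lambda>\<omega>. a * H_integral P m N e \<nu> \<psi> \<omega> + b * H_integral P m N e \<nu> \<phi> \<omega>)"
    by (intro L2_tendsto_lincomb C \<psi> \<phi>)
  hence "L2_tendsto P (?S ?\<chi>)
      (\<lambda>\<omega>. a * H_integral P m N e \<nu> \<psi> \<omega> + b * H_integral P m N e \<nu> \<phi> \<omega>)"
    by (subst L2_tendsto_cong[OF sums]) (intro L2_add L2_mult C \<psi> \<phi> \<chi> | assumption)+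
  thus "AE \<omega> in P. H_integral P m N e \<nu> ?\<chi> \<omega>
      = a * H_integral P m N e \<nu> \<psi> \<omega> + b * H_integral P m N e \<nu> \<phi> \<omega>"
    by (rule L2_tendsto_unique[OF C(1)[OF \<chi>] C(2)[OF \<chi>] _ C(3)[OF \<chi>], rotated])
       (intro L2_add L2_mult C \<psi> \<phi>)
qed

end


section \<open>Combinations of fields with coefficients on a base space\<close>

definition quad_form :: "('k::finite \<Rightarrow> 'k \<Rightarrow> real) \<Rightarrow> ('k \<Rightarrow> real) \<Rightarrow> real" where
  "quad_form g c = (\<Sum>k\<in>UNIV. \<Sum>l\<in>UNIV. c k * c l * g k l)"

lemma quad_form_scale: "quad_form g (\<lambda>k. t * c k) = t\<^sup>2 * quad_form g c"
  by (simp add: quad_form_def sum_distrib_left power2_eq_square mult_ac)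

text \<open>
  Fields \<open>K k\<close> on \<open>m\<close> whose Gram matrix, averaged over the fibres of \<open>\<pi>\<close>, is \<open>G\<close>. The case
  \<open>\<pi> = X\<close> with \<open>G\<close> a conditional expectation and the case \<open>\<pi> = id\<close> with \<open>G\<close> the pointwise Gram
  matrix are both instances, so that the image structure and the initial structure are
  treated together.
\<close>

locale gram_fields =
  fixes m :: "'w measure" and M :: "'x measure" and \<pi> :: "'w \<Rightarrow> 'x"
    and K :: "'k::finite \<Rightarrow> 'w \<Rightarrow> 'h::{second_countable_topology,real_inner}"
    and G :: "'x \<Rightarrow> 'k \<Rightarrow> 'k \<Rightarrow> real"
  assumes proj [measurable]: "\<pi> \<in> measurable m M"
    and base: "distr m M \<pi> = M"
    and field_L2: "K k \<in> L2 m"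
    and gram_integrable: "integrable M (\<lambda>x. G x k l)"
    and gram: "\<lbrakk>\<phi> \<in> borel_measurable M; \<And>x. x \<in> space M \<Longrightarrow> \<bar>\<phi> x\<bar> \<le> C\<rbrakk> \<Longrightarrow>
      (\<integral>w. \<phi> (\<pi> w) * (K k w \<bullet> K l w) \<partial>m) = (\<integral>x. \<phi> x * G x k l \<partial>M)"
begin

definition comb :: "('k \<Rightarrow> 'x \<Rightarrow> real) \<Rightarrow> 'w \<Rightarrow> 'h" where
  "comb a w = (\<Sum>k\<in>UNIV. a k (\<pi> w) *\<^sub>R K k w)"

lemma gram_measurable [measurable]: "(\<lambda>x. G x k l) \<in> borel_measurable M"
  using gram_integrable by (rule borel_measurable_integrable)

lemma field_measurable [measurable]: "K k \<in> borel_measurable m"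
  using field_L2 by (rule L2_measurable)

lemma quad_form_measurable:
  "\<forall>k. a k \<in> borel_measurable M \<Longrightarrow> (\<lambda>x. quad_form (G x) (\<lambda>k. a k x)) \<in> borel_measurable M"
  unfolding quad_form_def
  by (intro borel_measurable_sum borel_measurable_times gram_measurable) simp_all

lemma comb_measurable:
  "\<forall>k. a k \<in> borel_measurable M \<Longrightarrow> comb a \<in> borel_measurable m"
  unfolding comb_def[abs_def]
  by (intro borel_measurable_sum borel_measurable_scaleR field_measurable
      measurable_compose[OF proj]) simp_all

lemma norm_comb_squared:
  "(norm (comb a w))\<^sup>2 = (\<Sum>k\<in>UNIV. \<Sum>l\<in>UNIV. a k (\<pi> w) * a l (\<pi> w) * (K k w \<bullet> K l w))"
  unfolding comb_def power2_norm_eq_inner inner_sum_left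
  by (intro sum.cong refl) (simp add: inner_sum_right sum_distrib_left mult_ac)

lemma bounded_comb:
  assumes a: "\<forall>k. a k \<in> borel_measurable M" and C: "\<And>k x. x \<in> space M \<Longrightarrow> \<bar>a k x\<bar> \<le> C"
  shows "comb a \<in> L2 m" and "integrable M (\<lambda>x. quad_form (G x) (\<lambda>k. a k x))"
    and "(\<integral>w. (norm (comb a w))\<^sup>2 \<partial>m) = (\<integral>x. quad_form (G x) (\<lambda>k. a k x) \<partial>M)"
proof -
  note [measurable] = a[rule_format] quad_form_measurable[OF a] comb_measurable[OF a]
  have bound: "\<bar>a k x * a l x\<bar> \<le> C * C" if "x \<in> space M" for k l x
    unfolding abs_mult using C[OF that, of k] C[OF that, of l] by (intro mult_mono) auto
  have sp: "\<pi> w \<in> space M" if "w \<in> space m" for w using measurable_space[OF proj that] .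
  have int_m: "integrable m (\<lambda>w. a k (\<pi> w) * a l (\<pi> w) * (K k w \<bullet> K l w))" for k l
    using bound sp
    by (intro bounded_times_integrable[where C = "C * C"] integrable_inner_L2 field_L2) simp_all
  have int_M: "integrable M (\<lambda>x. a k x * a l x * G x k l)" for k l
    using bound by (intro bounded_times_integrable[where C = "C * C"] gram_integrable) auto
  show "comb a \<in> L2 m"
    using int_m by (intro L2I comb_measurable a) (simp add: norm_comb_squared)
  show "integrable M (\<lambda>x. quad_form (G x) (\<lambda>k. a k x))"
    using int_M by (simp add: quad_form_def)
  have "(\<integral>w. (norm (comb a w))\<^sup>2 \<partial>m)
      = (\<Sum>k\<in>UNIV. \<Sum>l\<in>UNIV. \<integral>w. (\<lambda>x. a k x * a l x) (\<pi> w) * (K k w \<bullet> K l w) \<partial>m)"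
    using int_m by (simp add: norm_comb_squared)
  also have "\<dots> = (\<Sum>k\<in>UNIV. \<Sum>l\<in>UNIV. \<integral>x. a k x * a l x * G x k l \<partial>M)"
    using bound by (intro sum.cong refl gram[where C = "C * C"]) auto
  also have "\<dots> = (\<integral>x. quad_form (G x) (\<lambda>k. a k x) \<partial>M)"
    using int_M by (simp add: quad_form_def)
  finally show "(\<integral>w. (norm (comb a w))\<^sup>2 \<partial>m) = (\<integral>x. quad_form (G x) (\<lambda>k. a k x) \<partial>M)" .
qed

text \<open>
  Over the set where the form is negative its integral is a squared norm, so that set is null.
\<close>

lemma bounded_quad_form_nonneg:
  assumes a: "\<forall>k. a k \<in> borel_measurable M" and C: "\<And>k x. x \<in> space M \<Longrightarrow> \<bar>a k x\<bar> \<le> C"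
  shows "AE x in M. 0 \<le> quad_form (G x) (\<lambda>k. a k x)"
proof -
  note [measurable] = a[rule_format] quad_form_measurable[OF a] comb_measurable[OF a]
  let ?q = "\<lambda>x. quad_form (G x) (\<lambda>k. a k x)"
  define B where "B = {x\<in>space M. ?q x < 0}"
  have B [measurable]: "B \<in> sets M" unfolding B_def by measurable
  define b where "b k x = indicator B x * a k x" for k x
  have b: "\<forall>k. b k \<in> borel_measurable M" unfolding b_def[abs_def] by measurable
  have bC: "\<bar>b k x\<bar> \<le> C" if "x \<in> space M" for k x
    using C[OF that, of k] by (auto simp: b_def split: split_indicator)
  have q_b: "quad_form (G x) (\<lambda>k. b k x) = indicator B x * ?q x" for x
    by (simp add: b_def quad_form_scale power2_eq_square indicator_inter_arith[symmetric])
  have "0 \<le> (\<integral>x. indicator B x * ?q x \<partial>M)"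
    using bounded_comb(3)[OF b bC, THEN sym] unfolding q_b by simp
  moreover have int: "integrable M (\<lambda>x. - (indicator B x * ?q x))"
    using bounded_comb(2)[OF b bC] by (simp add: q_b)
  moreover have nonneg: "0 \<le> - (indicator B x * ?q x)" for x
    by (auto simp: B_def split: split_indicator)
  ultimately have "(\<integral>x. - (indicator B x * ?q x) \<partial>M) = 0"
    using integral_nonneg_AE[where M = M and f = "\<lambda>x. - (indicator B x * ?q x)"] by (simp add: order_antisym)
  hence "AE x in M. - (indicator B x * ?q x) = 0"
    using integral_nonneg_eq_0_iff_AE[OF int] nonneg by simp
  with AE_space show ?thesis
  proof eventually_elim
    case (elim x)
    show ?case
    proof (rule ccontr)
      assume neg: "\<not> 0 \<le> ?q x"
      hence "x \<in> B" using elim(1) by (simp add: B_def)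
      thus False using elim(2) neg by simp
    qed
  qed
qed

definition truncate :: "('k \<Rightarrow> 'x \<Rightarrow> real) \<Rightarrow> nat \<Rightarrow> 'k \<Rightarrow> 'x \<Rightarrow> real" where
  "truncate a j k x = (if \<forall>l. \<bar>a l x\<bar> \<le> real j then a k x else 0)"

lemma truncate_measurable:
  assumes "\<forall>k. a k \<in> borel_measurable M"
  shows "\<forall>k. truncate a j k \<in> borel_measurable M"
proof -
  note [measurable] = assms[rule_format]
  show ?thesis unfolding truncate_def[abs_def] by measurable
qed

lemma truncate_bounded: "\<bar>truncate a j k x\<bar> \<le> real j"
  by (simp add: truncate_def)

lemma eventually_truncate: "\<forall>\<^sub>F j in sequentially. \<forall>k. truncate a j k x = a k x"
proof -
  obtain j0 :: nat where j0: "Max (range (\<lambda>l. \<bar>a l x\<bar>)) \<le> real j0" using real_arch_simple by blast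
  have "\<bar>a l x\<bar> \<le> real j" if "j0 \<le> j" for l j
  proof -
    have "\<bar>a l x\<bar> \<le> Max (range (\<lambda>l. \<bar>a l x\<bar>))" by (intro Max_ge) auto
    thus ?thesis using j0 that by linarith
  qed
  thus ?thesis by (intro eventually_sequentiallyI[of j0]) (auto simp: truncate_def)
qed

lemma quad_form_truncate:
  "quad_form (G x) (\<lambda>k. truncate a j k x)
    = (if \<forall>l. \<bar>a l x\<bar> \<le> real j then quad_form (G x) (\<lambda>k. a k x) else 0)"
  by (cases "\<forall>l. \<bar>a l x\<bar> \<le> real j") (simp_all only: truncate_def quad_form_def if_True if_False
      mult_zero_left sum.neutral_const simp_thms)

lemma comb_truncate:
  "comb (truncate a j) w = (if \<forall>l. \<bar>a l (\<pi> w)\<bar> \<le> real j then comb a w else 0)"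
  by (cases "\<forall>l. \<bar>a l (\<pi> w)\<bar> \<le> real j") (simp_all only: truncate_def comb_def if_True if_False
      scaleR_zero_left sum.neutral_const simp_thms)

lemma quad_form_nonneg:
  assumes a: "\<forall>k. a k \<in> borel_measurable M"
  shows "AE x in M. 0 \<le> quad_form (G x) (\<lambda>k. a k x)"
proof -
  have "AE x in M. \<forall>j. 0 \<le> quad_form (G x) (\<lambda>k. truncate a j k x)"
    unfolding AE_all_countable
    using truncate_bounded by (intro allI bounded_quad_form_nonneg truncate_measurable a)
  thus ?thesis
  proof eventually_elim
    case (elim x)
    obtain j where "\<forall>k. truncate a j k x = a k x"
      using eventually_happens'[OF sequentially_bot eventually_truncate[of a x]] by blast
    thus ?case using elim[rule_format, of j] by simp
  qed
qed

text \<open>For unbounded coefficients both sides are monotone limits along truncations.\<close>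

lemma nn_integral_comb:
  assumes a: "\<forall>k. a k \<in> borel_measurable M"
  shows "(\<integral>\<^sup>+w. ennreal ((norm (comb a w))\<^sup>2) \<partial>m)
    = (\<integral>\<^sup>+x. ennreal (quad_form (G x) (\<lambda>k. a k x)) \<partial>M)"
proof -
  note t = truncate_measurable[OF a]
  have eq: "(\<integral>\<^sup>+w. ennreal ((norm (comb (truncate a j) w))\<^sup>2) \<partial>m)
    = (\<integral>\<^sup>+x. ennreal (quad_form (G x) (\<lambda>k. truncate a j k x)) \<partial>M)" for j
  proof -
    note B = bounded_comb[OF t truncate_bounded, of j]
    have "(\<integral>\<^sup>+w. ennreal ((norm (comb (truncate a j) w))\<^sup>2) \<partial>m)
        = ennreal (\<integral>w. (norm (comb (truncate a j) w))\<^sup>2 \<partial>m)"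
      by (intro nn_integral_eq_integral L2_integrable B) auto
    also have "\<dots> = (\<integral>\<^sup>+x. ennreal (quad_form (G x) (\<lambda>k. truncate a j k x)) \<partial>M)"
      unfolding B(3) by (intro nn_integral_eq_integral[symmetric] B quad_form_nonneg t)
    finally show ?thesis .
  qed
  have "(\<lambda>j. \<integral>\<^sup>+w. ennreal ((norm (comb (truncate a j) w))\<^sup>2) \<partial>m)
      \<longlonglongrightarrow> (\<integral>\<^sup>+w. ennreal ((norm (comb a w))\<^sup>2) \<partial>m)"
  proof (rule nn_integral_LIMSEQ)
    show "incseq (\<lambda>j w. ennreal ((norm (comb (truncate a j) w))\<^sup>2))"
      by (auto simp: incseq_def le_fun_def comb_truncate intro: order_trans of_nat_mono)
    show "(\<lambda>j. ennreal ((norm (comb (truncate a j) w))\<^sup>2)) \<longlonglongrightarrow> ennreal ((norm (comb a w))\<^sup>2)" for w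
      by (rule tendsto_eventually, rule eventually_mono[OF eventually_truncate[of a "\<pi> w"]])
         (simp add: comb_def)
  qed (use comb_measurable[OF a] comb_measurable[OF t] quad_form_measurable[OF a]
      quad_form_measurable[OF t] in measurable)
  moreover have "(\<lambda>j. \<integral>\<^sup>+x. ennreal (quad_form (G x) (\<lambda>k. truncate a j k x)) \<partial>M)
      \<longlonglongrightarrow> (\<integral>\<^sup>+x. ennreal (quad_form (G x) (\<lambda>k. a k x)) \<partial>M)"
  proof (rule nn_integral_LIMSEQ)
    show "incseq (\<lambda>j x. ennreal (quad_form (G x) (\<lambda>k. truncate a j k x)))"
      by (auto simp: incseq_def le_fun_def quad_form_truncate intro: order_trans of_nat_mono)
    show "(\<lambda>j. ennreal (quad_form (G x) (\<lambda>k. truncate a j k x)))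
        \<longlonglongrightarrow> ennreal (quad_form (G x) (\<lambda>k. a k x))" for x
      by (rule tendsto_eventually, rule eventually_mono[OF eventually_truncate[of a x]]) simp
  qed (use comb_measurable[OF a] comb_measurable[OF t] quad_form_measurable[OF a]
      quad_form_measurable[OF t] in measurable)
  ultimately show ?thesis unfolding eq by (rule LIMSEQ_unique)
qed

lemma integral_comb:
  assumes a: "\<forall>k. a k \<in> borel_measurable M"
  shows "(L2_norm m (comb a))\<^sup>2 = (\<integral>x. quad_form (G x) (\<lambda>k. a k x) \<partial>M)"
proof -
  note [measurable] = a[rule_format] quad_form_measurable[OF a] comb_measurable[OF a]
  have "(L2_norm m (comb a))\<^sup>2 = enn2real (\<integral>\<^sup>+w. ennreal ((norm (comb a w))\<^sup>2) \<partial>m)"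
    unfolding L2_norm_squared by (intro integral_eq_nn_integral) auto
  also have "\<dots> = (\<integral>x. quad_form (G x) (\<lambda>k. a k x) \<partial>M)"
    unfolding nn_integral_comb[OF a]
    by (intro integral_eq_nn_integral[symmetric] quad_form_nonneg a) auto
  finally show ?thesis .
qed

lemma comb_L2_iff:
  assumes a: "\<forall>k. a k \<in> borel_measurable M"
  shows "comb a \<in> L2 m \<longleftrightarrow> integrable M (\<lambda>x. quad_form (G x) (\<lambda>k. a k x))"
proof -
  note [measurable] = a[rule_format] quad_form_measurable[OF a] comb_measurable[OF a]
  have nn: "AE x in M. norm (quad_form (G x) (\<lambda>k. a k x)) = quad_form (G x) (\<lambda>k. a k x)"
    using quad_form_nonneg[OF a] by eventually_elim simp
  have "comb a \<in> L2 m \<longleftrightarrow> (\<integral>\<^sup>+w. ennreal ((norm (comb a w))\<^sup>2) \<partial>m) < \<infinity>"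
    by (simp add: L2_def integrable_iff_bounded comb_measurable[OF a])
  also have "(\<integral>\<^sup>+w. ennreal ((norm (comb a w))\<^sup>2) \<partial>m)
      = (\<integral>\<^sup>+x. ennreal (norm (quad_form (G x) (\<lambda>k. a k x))) \<partial>M)"
    unfolding nn_integral_comb[OF a] using nn by (intro nn_integral_cong_AE) auto
  also have "\<dots> < \<infinity> \<longleftrightarrow> integrable M (\<lambda>x. quad_form (G x) (\<lambda>k. a k x))"
    by (simp add: integrable_iff_bounded)
  finally show ?thesis .
qed

end

lemma inner_matrix_quad_form: "v \<bullet> (g *v v) = quad_form (\<lambda>i j. g $ i $ j) (\<lambda>i. v $ i)"
  for v :: "real ^ 'd"
  by (simp add: quad_form_def inner_vec_def matrix_vector_mult_def sum_distrib_left mult_ac)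


section \<open>Products with vector valued white noises\<close>

locale gram_noise = gram_fields m M \<pi> K "\<lambda>x i j. G x $ i $ j"
  for m :: "'w measure" and M :: "'x measure" and \<pi> :: "'w \<Rightarrow> 'x"
    and K :: "'d::finite \<Rightarrow> 'w \<Rightarrow> 'h::{second_countable_topology,real_inner}"
    and G :: "'x \<Rightarrow> real ^ 'd ^ 'd" +
  fixes P :: "'o measure" and T :: "('w \<Rightarrow> 'h) \<Rightarrow> 'o \<Rightarrow> real"
    and \<Lambda> :: "'d \<Rightarrow> 'x set \<Rightarrow> 'o \<Rightarrow> real"
  assumes isometry: "L2_isometry P m T"
    and noise: "A \<in> sets M \<Longrightarrow> \<Lambda> i A = T (\<lambda>w. indicator (\<pi> -` A \<inter> space m) w *\<^sub>R K i w)"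
begin

lemma vec_measurable:
  fixes v :: "'x \<Rightarrow> real ^ 'd"
  assumes "v \<in> borel_measurable M" shows "\<forall>i. (\<lambda>x. v x $ i) \<in> borel_measurable M"
  using measurable_compose[OF assms borel_measurable_nth] by blast

abbreviation (input) vcomb where "vcomb v \<equiv> comb (\<lambda>i x. v x $ i)"

lemma weighted_norm_eq:
  assumes "v \<in> borel_measurable M" shows "weighted_norm M G v = L2_norm m (vcomb v)"
  using integral_comb[of "\<lambda>i x. v x $ i", OF vec_measurable[OF assms]]
  by (simp add: weighted_norm_def inner_matrix_quad_form real_sqrt_unique)

lemma weighted_L2_iff:
  assumes "v \<in> borel_measurable M" shows "v \<in> weighted_L2 M G \<longleftrightarrow> vcomb v \<in> L2 m"
  using assms comb_L2_iff[of "\<lambda>i x. v x $ i", OF vec_measurable[OF assms]]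
  by (simp add: weighted_L2_def inner_matrix_quad_form)

abbreviation (input) component_measure where
  "component_measure i \<equiv> density M (\<lambda>x. ennreal (G x $ i $ i))"

text \<open>
  The measure associated with the component \<open>\<Lambda>\<^sub>i\<close> is the image of \<open>\<parallel>K\<^sub>i\<parallel>\<^sup>2 \<cdot> m\<close> under \<open>\<pi>\<close>.
\<close>

lemma component_nn_integral:
  assumes [measurable]: "f \<in> borel_measurable M"
  shows "(\<integral>\<^sup>+w. ennreal ((norm (f (\<pi> w) *\<^sub>R K i w))\<^sup>2) \<partial>m)
    = (\<integral>\<^sup>+x. ennreal ((f x)\<^sup>2) \<partial>component_measure i)"
proof -
  define a where "a k x = (if k = i then f x else 0)" for k x
  have a: "\<forall>k. a k \<in> borel_measurable M" unfolding a_def[abs_def] by measurable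
  have "comb a w = f (\<pi> w) *\<^sub>R K i w" for w
  proof -
    have "comb a w = (\<Sum>k\<in>UNIV. if k = i then f (\<pi> w) *\<^sub>R K i w else 0)"
      unfolding comb_def a_def by (intro sum.cong) auto
    thus ?thesis by simp
  qed
  moreover have "quad_form (\<lambda>k l. G x $ k $ l) (\<lambda>k. a k x) = (f x)\<^sup>2 * G x $ i $ i" for x
  proof -
    have "quad_form (\<lambda>k l. G x $ k $ l) (\<lambda>k. a k x)
        = (\<Sum>k\<in>UNIV. if k = i then \<Sum>l\<in>UNIV. if l = i then (f x)\<^sup>2 * G x $ i $ i else 0 else 0)"
      unfolding quad_form_def a_def
    proof (intro sum.cong refl)
      fix k
      have "(\<Sum>l\<in>UNIV. (if k = i then f x else 0) * (if l = i then f x else 0) * G x $ k $ l)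
          = (\<Sum>l\<in>UNIV. if l = i then (if k = i then (f x)\<^sup>2 * G x $ i $ i else 0) else 0)"
        by (intro sum.cong) (auto simp: power2_eq_square)
      thus "(\<Sum>l\<in>UNIV. (if k = i then f x else 0) * (if l = i then f x else 0) * G x $ k $ l)
          = (if k = i then \<Sum>l\<in>UNIV. if l = i then (f x)\<^sup>2 * G x $ i $ i else 0 else 0)" by simp
    qed
    thus ?thesis by simp
  qed
  ultimately have "(\<integral>\<^sup>+w. ennreal ((norm (f (\<pi> w) *\<^sub>R K i w))\<^sup>2) \<partial>m)
      = (\<integral>\<^sup>+x. ennreal ((f x)\<^sup>2 * G x $ i $ i) \<partial>M)"
    using nn_integral_comb[of a, OF a] by simp
  also have "\<dots> = (\<integral>\<^sup>+x. ennreal (G x $ i $ i) * ennreal ((f x)\<^sup>2) \<partial>M)"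
    by (intro nn_integral_cong) (simp add: ennreal_mult'' mult.commute)
  also have "\<dots> = (\<integral>\<^sup>+x. ennreal ((f x)\<^sup>2) \<partial>component_measure i)"
    by (subst nn_integral_density) auto
  finally show ?thesis .
qed

lemma component_finite: "finite_measure (component_measure i)"
proof (rule finite_measureI)
  have "emeasure (component_measure i) (space (component_measure i))
      = (\<integral>\<^sup>+x. ennreal (1\<^sup>2) \<partial>component_measure i)" by simp
  also have "\<dots> = (\<integral>\<^sup>+w. ennreal ((norm (1 *\<^sub>R K i w))\<^sup>2) \<partial>m)"
    by (rule component_nn_integral[symmetric]) simp
  also have "\<dots> < \<infinity>" using L2_integrable[OF field_L2[of i]] by (simp add: integrable_iff_bounded)
  finally show "emeasure (component_measure i) (space (component_measure i)) \<noteq> \<infinity>" by simp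
qed

lemma component_L2:
  fixes f :: "'x \<Rightarrow> real"
  assumes f: "f \<in> L2 (component_measure i)"
  shows "(\<lambda>w. f (\<pi> w) *\<^sub>R K i w) \<in> L2 m"
    and "L2_norm m (\<lambda>w. f (\<pi> w) *\<^sub>R K i w) = L2_norm (component_measure i) f"
proof -
  have [measurable]: "f \<in> borel_measurable M" using L2_measurable[OF f] by simp
  note eq = component_nn_integral[of f i]
  show "(\<lambda>w. f (\<pi> w) *\<^sub>R K i w) \<in> L2 m"
    using eq L2_integrable[OF f] by (intro L2I) (auto simp: integrable_iff_bounded)
  have "(\<integral>w. (norm (f (\<pi> w) *\<^sub>R K i w))\<^sup>2 \<partial>m)
      = enn2real (\<integral>\<^sup>+w. ennreal ((norm (f (\<pi> w) *\<^sub>R K i w))\<^sup>2) \<partial>m)"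
    by (rule integral_eq_nn_integral) auto
  also have "\<dots> = (\<integral>x. (f x)\<^sup>2 \<partial>component_measure i)"
    unfolding eq[OF \<open>f \<in> borel_measurable M\<close>] by (rule integral_eq_nn_integral[symmetric]) auto
  finally show "L2_norm m (\<lambda>w. f (\<pi> w) *\<^sub>R K i w) = L2_norm (component_measure i) f"
    by (simp add: L2_norm_def)
qed

text \<open>
  The explicit map \<open>f \<mapsto> T (f(\<pi>) K\<^sub>i)\<close> extends \<open>\<Lambda>\<^sub>i\<close> isometrically, so it is the integral.
\<close>

lemma component_product:
  fixes f :: "'x \<Rightarrow> real"
  assumes f: "f \<in> L2 (component_measure i)"
  shows "wn_integral P (component_measure i) (\<Lambda> i) f \<in> L2 P"
    and "AE \<omega> in P. wn_integral P (component_measure i) (\<Lambda> i) f \<omega> = T (\<lambda>w. f (\<pi> w) *\<^sub>R K i w) \<omega>"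
proof -
  have J: "isometric_extension P (component_measure i) (\<Lambda> i) (\<lambda>f. T (\<lambda>w. f (\<pi> w) *\<^sub>R K i w))"
    unfolding isometric_extension_def
  proof (intro conjI ballI allI)
    fix f :: "'x \<Rightarrow> real" assume f: "f \<in> L2 (component_measure i)"
    note f' = component_L2[OF f]
    show "T (\<lambda>w. f (\<pi> w) *\<^sub>R K i w) \<in> L2 P"
      "L2_norm P (T (\<lambda>w. f (\<pi> w) *\<^sub>R K i w)) = L2_norm (component_measure i) f"
      using L2_isometry_L2[OF isometry f'(1)] L2_isometry_norm[OF isometry f'(1)] f'(2) by auto
    fix g :: "'x \<Rightarrow> real" and a b assume g: "g \<in> L2 (component_measure i)"
    show "AE \<omega> in P. T (\<lambda>w. (a * f (\<pi> w) + b * g (\<pi> w)) *\<^sub>R K i w) \<omega>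
        = a * T (\<lambda>w. f (\<pi> w) *\<^sub>R K i w) \<omega> + b * T (\<lambda>w. g (\<pi> w) *\<^sub>R K i w) \<omega>"
      using L2_isometry_lincomb[OF isometry f'(1) component_L2(1)[OF g], of a b]
      by (simp add: scaleR_add_left)
  next
    fix A assume "A \<in> sets (component_measure i)"
    hence A [measurable]: "A \<in> sets M" by simp
    show "AE \<omega> in P. T (\<lambda>w. indicator A (\<pi> w) *\<^sub>R K i w) \<omega> = \<Lambda> i A \<omega>"
      unfolding noise[OF A]
    proof (rule L2_isometry_cong[OF isometry])
      show "(\<lambda>w. indicator A (\<pi> w) *\<^sub>R K i w) \<in> L2 m"
        using A by (intro component_L2(1) indicator_L2 component_finite) simp
      show "(\<lambda>w. indicator (\<pi> -` A \<inter> space m) w *\<^sub>R K i w) \<in> L2 m"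
        by (intro L2_indicator_scaleR field_L2) measurable
    qed (auto intro!: AE_I2 split: split_indicator)
  qed
  note I = wn_integral_isometric_extension[OF J]
  show "wn_integral P (component_measure i) (\<Lambda> i) f \<in> L2 P" by (rule isometric_extensionD(1)[OF I f])
  show "AE \<omega> in P. wn_integral P (component_measure i) (\<Lambda> i) f \<omega> = T (\<lambda>w. f (\<pi> w) *\<^sub>R K i w) \<omega>"
    by (rule isometric_extension_unique[OF component_finite I J f])
qed

lemma bounded_product:
  fixes \<phi> :: "'x \<Rightarrow> real ^ 'd"
  assumes \<phi>: "\<phi> \<in> borel_measurable M" "bounded (\<phi> ` space M)" and A: "A \<in> sets M"
  shows "vcomb \<phi> \<in> L2 m"
    and "AE \<omega> in P. wn_dot_bounded P M G \<Lambda> \<phi> A \<omega> = T (\<lambda>w. indicator A (\<pi> w) *\<^sub>R vcomb \<phi> w) \<omega>"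
    and "wn_dot_bounded P M G \<Lambda> \<phi> A \<in> L2 P"
proof -
  obtain C where C: "\<And>x. x \<in> space M \<Longrightarrow> norm (\<phi> x) \<le> C" using \<phi>(2) by (auto simp: bounded_iff)
  have Ci: "\<bar>\<phi> x $ i\<bar> \<le> C" if "x \<in> space M" for x i
    using component_le_norm_cart[of "\<phi> x" i] C[OF that] by simp
  note [measurable] = vec_measurable[OF \<phi>(1), rule_format] A
  show "vcomb \<phi> \<in> L2 m" by (rule bounded_comb(1)[OF vec_measurable[OF \<phi>(1)] Ci])
  have coord: "(\<lambda>x. indicator A x * \<phi> x $ i) \<in> L2 (component_measure i)" for i
  proof (rule L2I)
    interpret finite_measure "component_measure i" by (rule component_finite)
    have "AE x in component_measure i. norm ((norm (indicator A x * \<phi> x $ i))\<^sup>2) \<le> C\<^sup>2"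
      using Ci power_mono[OF Ci abs_ge_zero, of _ i 2]
      by (intro AE_I2) (auto simp: power2_abs split: split_indicator)
    thus "integrable (component_measure i) (\<lambda>x. (norm (indicator A x * \<phi> x $ i))\<^sup>2)"
      by (rule integrable_const_bound) measurable
  qed measurable
  note coord' = component_L2(1)[OF coord]
  have "AE \<omega> in P. \<forall>i\<in>UNIV. wn_integral P (component_measure i) (\<Lambda> i) (\<lambda>x. indicator A x * \<phi> x $ i) \<omega>
      = T (\<lambda>w. (indicator A (\<pi> w) * \<phi> (\<pi> w) $ i) *\<^sub>R K i w) \<omega>"
    by (intro AE_finite_allI component_product(2) coord) simp
  moreover have "AE \<omega> in P. T (\<lambda>w. \<Sum>i\<in>UNIV. (indicator A (\<pi> w) * \<phi> (\<pi> w) $ i) *\<^sub>R K i w) \<omega>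
      = (\<Sum>i\<in>UNIV. T (\<lambda>w. (indicator A (\<pi> w) * \<phi> (\<pi> w) $ i) *\<^sub>R K i w) \<omega>)"
    by (intro L2_isometry_sum[OF isometry] coord') simp
  ultimately show "AE \<omega> in P. wn_dot_bounded P M G \<Lambda> \<phi> A \<omega>
      = T (\<lambda>w. indicator A (\<pi> w) *\<^sub>R vcomb \<phi> w) \<omega>"
    by eventually_elim (simp add: wn_dot_bounded_def comb_def scaleR_sum_right)
  show "wn_dot_bounded P M G \<Lambda> \<phi> A \<in> L2 P"
    unfolding wn_dot_bounded_def[abs_def]
    by (intro L2_sum component_product(1) coord)
qed

text \<open>
  The bounded product and its prospective limit are both values of \<open>T\<close>, so their distance is that
  of the fields, and cutting fields down to \<open>A\<close> only decreases it.
\<close>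

lemma wn_dot_bounded_diff:
  fixes v \<phi> :: "'x \<Rightarrow> real ^ 'd"
  assumes v: "v \<in> borel_measurable M" "vcomb v \<in> L2 m" and A: "A \<in> sets M"
    and \<phi>: "\<phi> \<in> borel_measurable M" "bounded (\<phi> ` space M)"
  shows "L2_norm P (\<lambda>\<omega>. wn_dot_bounded P M G \<Lambda> \<phi> A \<omega> - T (\<lambda>w. indicator A (\<pi> w) *\<^sub>R vcomb v w) \<omega>)
    \<le> weighted_norm M G (\<lambda>x. \<phi> x - v x)"
proof -
  note B = bounded_product[OF \<phi> A]
  have restrict_L2: "(\<lambda>w. indicator A (\<pi> w) *\<^sub>R vcomb u w) \<in> L2 m"
    if "vcomb u \<in> L2 m" for u :: "'x \<Rightarrow> real ^ 'd"
  proof (rule L2_bound[where C = 1, OF that])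
    note [measurable] = A L2_measurable[OF that]
    show "(\<lambda>w. indicator A (\<pi> w) *\<^sub>R vcomb u w) \<in> borel_measurable m" by measurable
  qed (auto split: split_indicator)
  note v' = restrict_L2[OF v(2)] and \<phi>' = restrict_L2[OF B(1)]
  have diff: "vcomb \<phi> w - vcomb v w = vcomb (\<lambda>x. \<phi> x - v x) w" for w
    by (simp add: comb_def sum_subtractf[symmetric] scaleR_diff_left)
  have "L2_norm P (\<lambda>\<omega>. wn_dot_bounded P M G \<Lambda> \<phi> A \<omega> - T (\<lambda>w. indicator A (\<pi> w) *\<^sub>R vcomb v w) \<omega>)
      = L2_norm P (\<lambda>\<omega>. T (\<lambda>w. indicator A (\<pi> w) *\<^sub>R vcomb \<phi> w) \<omega>
          - T (\<lambda>w. indicator A (\<pi> w) *\<^sub>R vcomb v w) \<omega>)"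
  proof (rule L2_norm_cong_AE)
    show "AE \<omega> in P. wn_dot_bounded P M G \<Lambda> \<phi> A \<omega> - T (\<lambda>w. indicator A (\<pi> w) *\<^sub>R vcomb v w) \<omega>
      = T (\<lambda>w. indicator A (\<pi> w) *\<^sub>R vcomb \<phi> w) \<omega> - T (\<lambda>w. indicator A (\<pi> w) *\<^sub>R vcomb v w) \<omega>"
      using B(2) by eventually_elim simp
  qed (intro L2_measurable L2_diff B(3) L2_isometry_L2[OF isometry] v' \<phi>')+
  also have "\<dots> = L2_norm m (\<lambda>w. indicator A (\<pi> w) *\<^sub>R vcomb \<phi> w - indicator A (\<pi> w) *\<^sub>R vcomb v w)"
    by (rule L2_isometry_diff[OF isometry \<phi>' v'])
  also have "\<dots> \<le> L2_norm m (\<lambda>w. vcomb \<phi> w - vcomb v w)"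
    unfolding L2_norm_def
  proof (intro real_sqrt_le_mono integral_mono L2_integrable L2_diff v' \<phi>' B(1) v(2))
    show "(norm (indicator A (\<pi> w) *\<^sub>R vcomb \<phi> w - indicator A (\<pi> w) *\<^sub>R vcomb v w))\<^sup>2
        \<le> (norm (vcomb \<phi> w - vcomb v w))\<^sup>2" for w
      by (simp split: split_indicator)
  qed
  also have "\<dots> = weighted_norm M G (\<lambda>x. \<phi> x - v x)"
    unfolding diff using v(1) \<phi>(1) by (intro weighted_norm_eq[symmetric]) measurable
  finally show ?thesis .
qed

text \<open>
  The product with an unbounded \<open>v\<close> does not depend on the approximating sequence: every
  admissible sequence of bounded functions has the limit determined by the field
  \<open>\<Sum>\<^sub>i v\<^sub>i(\<pi>) K\<^sub>i\<close>, and truncation provides one admissible sequence.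
\<close>

lemma wn_dot_eq:
  fixes v :: "'x \<Rightarrow> real ^ 'd"
  assumes v: "v \<in> borel_measurable M" "vcomb v \<in> L2 m" and A: "A \<in> sets M"
  shows "AE \<omega> in P. wn_dot P M G \<Lambda> v A \<omega> = T (\<lambda>w. indicator A (\<pi> w) *\<^sub>R vcomb v w) \<omega>"
proof -
  define Z where "Z = T (\<lambda>w. indicator A (\<pi> w) *\<^sub>R vcomb v w)"
  define approx where "approx \<phi> \<longleftrightarrow> (\<forall>n::nat. \<phi> n \<in> borel_measurable M \<and> bounded (\<phi> n ` space M))
      \<and> (\<lambda>n. weighted_norm M G (\<lambda>x. \<phi> n x - v x)) \<longlonglongrightarrow> 0" for \<phi>
  note [measurable] = v(1) vec_measurable[OF v(1), rule_format] L2_measurable[OF v(2)] A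
  have Z_L2: "Z \<in> L2 P" unfolding Z_def
  proof (rule L2_isometry_L2[OF isometry], rule L2_bound[where C = 1, OF v(2)])
    show "(\<lambda>w. indicator A (\<pi> w) *\<^sub>R vcomb v w) \<in> borel_measurable m" by measurable
  qed (auto split: split_indicator)
  have lim: "L2_tendsto P (\<lambda>n. wn_dot_bounded P M G \<Lambda> (\<phi> n) A) Z" if "approx \<phi>" for \<phi>
    unfolding L2_tendsto_def
  proof (rule Lim_null_comparison[OF always_eventually[OF allI]])
    show "(\<lambda>n. weighted_norm M G (\<lambda>x. \<phi> n x - v x)) \<longlonglongrightarrow> 0" using that by (simp add: approx_def)
    show "norm (L2_norm P (\<lambda>\<omega>. wn_dot_bounded P M G \<Lambda> (\<phi> n) A \<omega> - Z \<omega>))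
        \<le> weighted_norm M G (\<lambda>x. \<phi> n x - v x)" for n
      using wn_dot_bounded_diff[OF v A, of "\<phi> n"] that by (simp add: approx_def Z_def)
  qed
  define \<psi> where "\<psi> n x = (if norm (v x) \<le> real n then v x else 0)" for n x
  have [measurable]: "\<psi> n \<in> borel_measurable M" for n unfolding \<psi>_def[abs_def] by measurable
  have "approx \<psi>"
    unfolding approx_def
  proof (intro conjI allI)
    show "bounded (\<psi> n ` space M)" for n by (auto simp: bounded_iff \<psi>_def intro!: exI[of _ "real n"])
    have eq: "(norm (vcomb (\<lambda>x. \<psi> n x - v x) w))\<^sup>2
        = (if norm (v (\<pi> w)) \<le> real n then 0 else (norm (vcomb v w))\<^sup>2)" for n w
      by (simp add: comb_def \<psi>_def sum_negf)
    have "(\<lambda>n. \<integral>w. (norm (vcomb (\<lambda>x. \<psi> n x - v x) w))\<^sup>2 \<partial>m) \<longlonglongrightarrow> (\<integral>w. 0 \<partial>m)"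
      unfolding eq
    proof (rule integral_dominated_convergence[where w = "\<lambda>w. (norm (vcomb v w))\<^sup>2"])
      show "AE w in m. (\<lambda>n. if norm (v (\<pi> w)) \<le> real n then 0 else (norm (vcomb v w))\<^sup>2) \<longlonglongrightarrow> 0"
      proof (intro AE_I2 tendsto_eventually)
        fix w
        obtain n0 :: nat where "norm (v (\<pi> w)) \<le> real n0" using real_arch_simple by blast
        thus "\<forall>\<^sub>F n in sequentially. (if norm (v (\<pi> w)) \<le> real n then 0 else (norm (vcomb v w))\<^sup>2) = 0"
          by (intro eventually_sequentiallyI[of n0]) (auto intro: order_trans of_nat_mono)
      qed
    qed (use L2_integrable[OF v(2)] in auto)
    hence "(\<lambda>n. sqrt (\<integral>w. (norm (vcomb (\<lambda>x. \<psi> n x - v x) w))\<^sup>2 \<partial>m)) \<longlonglongrightarrow> sqrt 0"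
      by (intro tendsto_real_sqrt) simp
    moreover have "weighted_norm M G (\<lambda>x. \<psi> n x - v x)
        = sqrt (\<integral>w. (norm (vcomb (\<lambda>x. \<psi> n x - v x) w))\<^sup>2 \<partial>m)" for n
      by (subst weighted_norm_eq) (simp_all add: L2_norm_def)
    ultimately show "(\<lambda>n. weighted_norm M G (\<lambda>x. \<psi> n x - v x)) \<longlonglongrightarrow> 0" by simp
  qed measurable
  hence "\<exists>Y. Y \<in> L2 P \<and> (\<exists>\<phi>. (\<forall>n::nat. \<phi> n \<in> borel_measurable M \<and> bounded (\<phi> n ` space M)) \<and>
      (\<lambda>n. weighted_norm M G (\<lambda>x. \<phi> n x - v x)) \<longlonglongrightarrow> 0 \<and>
      L2_tendsto P (\<lambda>n. wn_dot_bounded P M G \<Lambda> (\<phi> n) A) Y)"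
    using lim[of \<psi>] Z_L2 unfolding approx_def by blast
  from someI_ex[OF this] obtain \<phi> where Y: "wn_dot P M G \<Lambda> v A \<in> L2 P" and \<phi>: "approx \<phi>"
    and to_Y: "L2_tendsto P (\<lambda>n. wn_dot_bounded P M G \<Lambda> (\<phi> n) A) (wn_dot P M G \<Lambda> v A)"
    unfolding wn_dot_def[symmetric] approx_def by blast
  have "wn_dot_bounded P M G \<Lambda> (\<phi> n) A \<in> L2 P" for n
    using \<phi> A by (intro bounded_product(3)) (auto simp: approx_def)
  from L2_tendsto_unique[OF this Y Z_L2 to_Y lim[OF \<phi>]] show ?thesis by (simp add: Z_def)
qed

end


section \<open>Measurable solution of degenerate linear systems\<close>

lemma borel_measurable_vecI:
  fixes f :: "'x \<Rightarrow> real ^ 'd"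
  assumes "\<And>i. (\<lambda>x. f x $ i) \<in> borel_measurable M"
  shows "f \<in> borel_measurable M"
proof (subst borel_measurable_euclidean_space, intro ballI)
  fix b :: "real ^ 'd" assume "b \<in> Basis"
  hence "\<exists>i. b = axis i 1" unfolding Basis_vec_def by (simp only: Basis_real_def) blast
  then obtain i where b: "b = axis i 1" ..
  show "(\<lambda>x. f x \<bullet> b) \<in> borel_measurable M"
    unfolding b inner_axis inner_real_def mult_1_right by (rule assms)
qed

lemma borel_measurable_matrix_vector_mult:
  fixes g :: "'x \<Rightarrow> real ^ 'd ^ 'd" and y :: "'x \<Rightarrow> real ^ 'd"
  assumes "\<And>i j. (\<lambda>x. g x $ i $ j) \<in> borel_measurable M" "y \<in> borel_measurable M"
  shows "(\<lambda>x. g x *v y x) \<in> borel_measurable M"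
proof (rule borel_measurable_vecI)
  note [measurable] = assms measurable_compose[OF assms(2) borel_measurable_nth]
  show "(\<lambda>x. (g x *v y x) $ i) \<in> borel_measurable M" for i
    unfolding matrix_vector_mult_def by simp
qed

text \<open>
  A bound of the operator norm, used as inverse step size below; the summand \<open>1\<close> keeps it positive.
\<close>

definition matrix_bound :: "real ^ 'd ^ 'd \<Rightarrow> real" where
  "matrix_bound g = 1 + (\<Sum>i\<in>UNIV. \<Sum>j\<in>UNIV. \<bar>g $ i $ j\<bar>)"

lemma matrix_bound_pos: "0 < matrix_bound g"
  unfolding matrix_bound_def by (intro add_pos_nonneg sum_nonneg) auto

lemma inner_matrix_le: "y \<bullet> (g *v y) \<le> matrix_bound g * (norm y)\<^sup>2"
proof -
  have "y \<bullet> (g *v y) = (\<Sum>i\<in>UNIV. \<Sum>j\<in>UNIV. y $ i * y $ j * g $ i $ j)"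
    unfolding inner_matrix_quad_form quad_form_def ..
  also have "\<dots> \<le> (\<Sum>i\<in>UNIV. \<Sum>j\<in>UNIV. \<bar>g $ i $ j\<bar> * (norm y)\<^sup>2)"
  proof (intro sum_mono)
    fix i j
    have "\<bar>y $ i\<bar> * \<bar>y $ j\<bar> \<le> norm y * norm y"
      by (intro mult_mono component_le_norm_cart) auto
    hence "\<bar>y $ i\<bar> * \<bar>y $ j\<bar> * \<bar>g $ i $ j\<bar> \<le> norm y * norm y * \<bar>g $ i $ j\<bar>"
      by (intro mult_right_mono) auto
    moreover have "y $ i * y $ j * g $ i $ j \<le> \<bar>y $ i\<bar> * \<bar>y $ j\<bar> * \<bar>g $ i $ j\<bar>"
      unfolding abs_mult[symmetric] by (rule abs_ge_self)
    ultimately show "y $ i * y $ j * g $ i $ j \<le> \<bar>g $ i $ j\<bar> * (norm y)\<^sup>2"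
      by (simp add: power2_eq_square mult_ac)
  qed
  also have "\<dots> \<le> matrix_bound g * (norm y)\<^sup>2"
    by (simp add: matrix_bound_def sum_distrib_right distrib_right)
  finally show ?thesis .
qed

text \<open>
  Gradient descent for \<open>a \<mapsto> a \<bullet> g a / 2 - a \<bullet> c\<close>. Its limit depends measurably on the data,
  which a choice of a solution for each matrix separately would not.
\<close>

primrec descent :: "real ^ 'd ^ 'd \<Rightarrow> real ^ 'd \<Rightarrow> nat \<Rightarrow> real ^ 'd" where
  "descent g c 0 = 0"
| "descent g c (Suc k) = descent g c k + (1 / matrix_bound g) *\<^sub>R (c - g *v descent g c k)"

definition solve :: "real ^ 'd ^ 'd \<Rightarrow> real ^ 'd \<Rightarrow> real ^ 'd" where
  "solve g c = lim (descent g c)"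

lemma solve_measurable:
  fixes g :: "'x \<Rightarrow> real ^ 'd ^ 'd" and c :: "'x \<Rightarrow> real ^ 'd"
  assumes g: "\<And>i j. (\<lambda>x. g x $ i $ j) \<in> borel_measurable M" and c: "c \<in> borel_measurable M"
  shows "(\<lambda>x. solve (g x) (c x)) \<in> borel_measurable M"
proof -
  have bound: "(\<lambda>x. matrix_bound (g x)) \<in> borel_measurable M"
    unfolding matrix_bound_def
    by (intro borel_measurable_add borel_measurable_const borel_measurable_sum borel_measurable_abs g)
  have "(\<lambda>x. descent (g x) (c x) k) \<in> borel_measurable M" for k
  proof (induction k)
    case (Suc k)
    show ?case
      unfolding descent.simps
      by (intro borel_measurable_add borel_measurable_scaleR borel_measurable_diff
          borel_measurable_divide borel_measurable_const bound c Suc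
          borel_measurable_matrix_vector_mult g)
  qed simp
  thus ?thesis unfolding solve_def by (rule borel_measurable_lim_metric)
qed

context
  fixes g :: "real ^ 'd ^ 'd"
  assumes sym: "\<And>i j. g $ i $ j = g $ j $ i" and psd: "\<And>y. 0 \<le> y \<bullet> (g *v y)"
begin

lemma inner_symmetric: "y \<bullet> (g *v z) = (g *v y) \<bullet> z"
proof -
  have "transpose g = g"
    unfolding vec_eq_iff
  proof (intro allI)
    show "transpose g $ i $ j = g $ i $ j" for i j using sym[of j i] by (simp only: transpose_def vec_lambda_beta)
  qed
  thus ?thesis by (simp only: dot_lmul_matrix[symmetric] transpose_matrix_vector[symmetric])
qed

text \<open>
  Cauchy--Schwarz for the semidefinite form, applied to \<open>z\<close> and \<open>g z\<close>.
\<close>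

lemma norm_matrix_squared_le: "(norm (g *v z))\<^sup>2 \<le> matrix_bound g * (z \<bullet> (g *v z))"
proof (cases "g *v z = 0")
  case True
  thus ?thesis using psd[of z] matrix_bound_pos[of g] by simp
next
  case False
  let ?y = "g *v z"
  have "0 \<le> (z \<bullet> ?y) * t\<^sup>2 + 2 * (?y \<bullet> ?y) * t + ?y \<bullet> (g *v ?y)" for t
  proof -
    have "0 \<le> (t *\<^sub>R z + ?y) \<bullet> (g *v (t *\<^sub>R z + ?y))" by (rule psd)
    also have "\<dots> = t * (t * (z \<bullet> ?y)) + t * (z \<bullet> (g *v ?y)) + (t * (?y \<bullet> ?y) + ?y \<bullet> (g *v ?y))"
      by (simp only: matrix_vector_right_distrib matrix_vector_mult_scaleR inner_add_left
          inner_add_right inner_scaleR_left inner_scaleR_right distrib_left add.assoc)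
    also have "z \<bullet> (g *v ?y) = ?y \<bullet> ?y" by (rule inner_symmetric)
    also have "t * (t * (z \<bullet> ?y)) + t * (?y \<bullet> ?y) + (t * (?y \<bullet> ?y) + ?y \<bullet> (g *v ?y))
        = (z \<bullet> ?y) * t\<^sup>2 + 2 * (?y \<bullet> ?y) * t + ?y \<bullet> (g *v ?y)"
      by (simp only: power2_eq_square) algebra
    finally show ?thesis .
  qed
  from quadratic_nonneg_discriminant(2)[OF this]
  have "(?y \<bullet> ?y)\<^sup>2 \<le> (z \<bullet> ?y) * (?y \<bullet> (g *v ?y))" .
  also have "\<dots> \<le> (z \<bullet> ?y) * (matrix_bound g * (norm ?y)\<^sup>2)"
    by (intro mult_left_mono inner_matrix_le psd)
  finally have "(norm ?y)\<^sup>2 * (norm ?y)\<^sup>2 \<le> (matrix_bound g * (z \<bullet> ?y)) * (norm ?y)\<^sup>2"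
    by (simp add: power2_norm_eq_inner[symmetric] power2_eq_square mult_ac)
  thus ?thesis by (rule mult_right_le_imp_le) (use False in simp)
qed

text \<open>
  The residuals stay orthogonal to the kernel, where \<open>g\<close> is bounded below, so they decrease
  geometrically.
\<close>

lemma solve_solves:
  assumes c: "\<And>z. g *v z = 0 \<Longrightarrow> z \<bullet> c = 0"
  shows "g *v solve g c = c"
proof -
  \<comment> \<open>The orthogonal complement of the kernel; it contains the range and all residuals.\<close>
  define W where "W = {y. \<forall>z. g *v z = 0 \<longrightarrow> z \<bullet> y = 0}"
  define r where "r k = c - g *v descent g c k" for k
  define b where "b = matrix_bound g"
  have b: "0 < b" by (simp add: b_def matrix_bound_pos)
  have "subspace W" by (auto simp: W_def subspace_def inner_add_right)
  have gW: "g *v y \<in> W" for y by (simp add: W_def inner_symmetric)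
  have inj: "\<forall>y\<in>W. g *v y = 0 \<longrightarrow> y = 0" by (auto simp: W_def)
  obtain e where e: "0 < e" "\<And>y. y \<in> W \<Longrightarrow> e * norm y \<le> norm (g *v y)"
    using injective_imp_isometric[OF closed_subspace[OF \<open>subspace W\<close>] \<open>subspace W\<close>
        matrix_vector_mul_bounded_linear inj] by blast
  have rW: "r k \<in> W" for k
    unfolding r_def using c gW by (intro subspace_diff \<open>subspace W\<close>) (auto simp: W_def)
  have r_Suc: "r (Suc k) = r k - (1 / b) *\<^sub>R (g *v r k)" for k
    by (simp add: r_def b_def matrix_vector_right_distrib matrix_vector_mult_scaleR
        matrix_vector_mult_diff_distrib algebra_simps)
  define \<rho> where "\<rho> = max 0 (1 - (e / b)\<^sup>2)"
  have \<rho>: "0 \<le> \<rho>" "\<rho> < 1" using e(1) b by (auto simp: \<rho>_def)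
  have step: "(norm (r (Suc k)))\<^sup>2 \<le> \<rho> * (norm (r k))\<^sup>2" for k
  proof -
    let ?y = "g *v r k"
    have "(norm (r (Suc k)))\<^sup>2 = (norm (r k))\<^sup>2 - 2 / b * (r k \<bullet> ?y) + (norm ?y)\<^sup>2 / b\<^sup>2"
      unfolding r_Suc power2_norm_eq_inner
      by (simp add: inner_diff_left inner_diff_right inner_commute power2_eq_square)
    also have "\<dots> \<le> (norm (r k))\<^sup>2 - (norm ?y)\<^sup>2 / b\<^sup>2"
    proof -
      have "(norm ?y)\<^sup>2 / b\<^sup>2 \<le> (b * (r k \<bullet> ?y)) / b\<^sup>2"
        using norm_matrix_squared_le[of "r k"] by (intro divide_right_mono) (auto simp: b_def)
      also have "\<dots> = (r k \<bullet> ?y) / b" using b by (simp add: power2_eq_square)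
      finally show ?thesis by simp
    qed
    also have "\<dots> \<le> (norm (r k))\<^sup>2 - (e / b)\<^sup>2 * (norm (r k))\<^sup>2"
    proof -
      have "(e * norm (r k))\<^sup>2 \<le> (norm ?y)\<^sup>2" using e rW by (intro power_mono) auto
      hence "(e * norm (r k))\<^sup>2 / b\<^sup>2 \<le> (norm ?y)\<^sup>2 / b\<^sup>2" by (intro divide_right_mono) auto
      thus ?thesis by (simp add: power_mult_distrib power_divide)
    qed
    also have "\<dots> = (1 - (e / b)\<^sup>2) * (norm (r k))\<^sup>2" by (simp add: algebra_simps)
    also have "\<dots> \<le> \<rho> * (norm (r k))\<^sup>2" by (intro mult_right_mono) (auto simp: \<rho>_def)
    finally show ?thesis .
  qed
  have "(norm (r k))\<^sup>2 \<le> \<rho> ^ k * (norm c)\<^sup>2" for k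
  proof (induction k)
    case (Suc k)
    have "(norm (r (Suc k)))\<^sup>2 \<le> \<rho> * (\<rho> ^ k * (norm c)\<^sup>2)"
      using step[of k] mult_left_mono[OF Suc \<rho>(1)] by linarith
    thus ?case by simp
  qed (simp add: r_def)
  hence r_le: "norm (r k) \<le> sqrt \<rho> ^ k * norm c" for k
    using real_sqrt_le_mono[of "(norm (r k))\<^sup>2" "\<rho> ^ k * (norm c)\<^sup>2"]
    by (simp add: real_sqrt_mult real_sqrt_power)
  have geo: "summable (\<lambda>k. sqrt \<rho> ^ k * norm c)"
    using \<rho> by (intro summable_mult2 summable_geometric) simp
  have "summable r" using r_le by (intro summable_comparison_test'[OF geo, of 0]) auto
  have "descent g c k = (1 / b) *\<^sub>R (\<Sum>j<k. r j)" for k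
    by (induction k) (simp_all add: r_def b_def scaleR_add_right)
  hence "descent g c \<longlonglongrightarrow> (1 / b) *\<^sub>R suminf r"
    using tendsto_scaleR[OF tendsto_const summable_LIMSEQ[OF \<open>summable r\<close>], of "1 / b"] by presburger
  hence lim: "descent g c \<longlonglongrightarrow> solve g c" unfolding solve_def by (simp add: limI)
  have "(\<lambda>k. g *v descent g c k) \<longlonglongrightarrow> g *v solve g c"
    by (rule bounded_linear.tendsto[OF matrix_vector_mul_bounded_linear lim])
  moreover have "r \<longlonglongrightarrow> 0" using \<open>summable r\<close> by (rule summable_LIMSEQ_zero)
  hence "(\<lambda>k. c - r k) \<longlonglongrightarrow> c - 0" by (intro tendsto_diff tendsto_const)
  hence "(\<lambda>k. g *v descent g c k) \<longlonglongrightarrow> c" by (simp add: r_def)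
  ultimately show ?thesis by (rule LIMSEQ_unique)
qed

end

text \<open>
  A quadratic polynomial bounded below has a critical point, although its quadratic part may
  be degenerate: on the kernel of \<open>g\<close> the polynomial is affine and bounded below, so
  its linear part vanishes there.
\<close>

lemma bounded_below_quadratic:
  fixes g :: "real ^ 'd ^ 'd" and c :: "real ^ 'd"
  assumes sym: "\<And>i j. g $ i $ j = g $ j $ i"
    and nonneg: "\<And>a. 0 \<le> s - 2 * (a \<bullet> c) + a \<bullet> (g *v a)"
  shows "g *v solve g c = c"
    and "s - solve g c \<bullet> (g *v solve g c) \<le> s - 2 * (a \<bullet> c) + a \<bullet> (g *v a)"
proof -
  have poly: "0 \<le> (y \<bullet> (g *v y)) * t\<^sup>2 + 2 * (- (y \<bullet> c)) * t + s" for y t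
    using nonneg[of "t *\<^sub>R y"] by (simp add: matrix_vector_mult_scaleR power2_eq_square mult_ac)
  have psd: "0 \<le> y \<bullet> (g *v y)" for y by (rule quadratic_nonneg_discriminant(1)[OF poly])
  show solves: "g *v solve g c = c"
  proof (rule solve_solves[OF sym psd])
    fix z assume "g *v z = 0"
    thus "z \<bullet> c = 0" using quadratic_nonneg_discriminant(2)[OF poly, of z] by simp
  qed
  let ?v = "solve g c"
  have "0 \<le> (a - ?v) \<bullet> (g *v (a - ?v))" by (rule psd)
  also have "\<dots> = a \<bullet> (g *v a) - 2 * (a \<bullet> c) + ?v \<bullet> (g *v ?v)"
    using inner_symmetric[OF sym psd, of ?v a] solves
    by (simp add: matrix_vector_mult_diff_distrib inner_diff_left inner_diff_right inner_commute)
  finally show "s - ?v \<bullet> (g *v ?v) \<le> s - 2 * (a \<bullet> c) + a \<bullet> (g *v a)" by simp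
qed


section \<open>Conditional expectations as functions of the conditioning variable\<close>

text \<open>Doob--Dynkin: simple functions factor through \<open>X\<close>, and so do their limits.\<close>

lemma vimage_algebra_factorization:
  fixes f :: "'w \<Rightarrow> real" and X :: "'w \<Rightarrow> 'x::topological_space"
  assumes f: "f \<in> borel_measurable (vimage_algebra S X borel)"
  shows "\<exists>g\<in>borel_measurable borel. \<forall>w\<in>S. f w = g (X w)"
proof -
  let ?F = "vimage_algebra S X borel"
  obtain s where s: "\<forall>i. simple_function ?F (s i)" "\<forall>w\<in>space ?F. (\<lambda>i. s i w) \<longlonglongrightarrow> f w"
    using borel_measurable_implies_sequence_metric[OF f, of 0] by blast
  have "\<forall>i y. \<exists>B. B \<in> sets borel \<and> s i -` {y} \<inter> S = X -` B \<inter> S"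
  proof (intro allI)
    fix i y
    have "s i -` {y} \<inter> space ?F \<in> sets ?F" using s(1) by (blast intro: simple_functionD)
    thus "\<exists>B. B \<in> sets borel \<and> s i -` {y} \<inter> S = X -` B \<inter> S"
      by (auto simp: sets_vimage_algebra2)
  qed
  then obtain B where B: "\<And>i y. B i y \<in> sets borel" "\<And>i y. s i -` {y} \<inter> S = X -` B i y \<inter> S"
    by metis
  define g where "g i x = (\<Sum>y\<in>s i ` S. y * indicator (B i y) x)" for i x
  have g_meas: "g i \<in> borel_measurable borel" for i
    unfolding g_def[abs_def]
    by (intro borel_measurable_sum borel_measurable_times borel_measurable_const borel_measurable_indicator B)
  have g: "g i (X w) = s i w" if "w \<in> S" for i w
  proof -
    have "indicator (s i -` {y} \<inter> S) w = (indicator (B i y) (X w) :: real)" for y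
      unfolding B(2) using that by (simp split: split_indicator)
    hence "g i (X w) = (\<Sum>y\<in>s i ` space ?F. indicator (s i -` {y} \<inter> space ?F) w *\<^sub>R y)"
      by (simp add: g_def mult.commute)
    also have "\<dots> = s i w"
      using s(1) that by (intro simple_function_indicator_representation_banach[symmetric]) auto
    finally show ?thesis .
  qed
  have "f w = lim (\<lambda>i. g i (X w))" if "w \<in> S" for w
  proof -
    have "(\<lambda>i. s i w) \<longlonglongrightarrow> f w" using s(2) that by simp
    from limI[OF this] show ?thesis by (simp add: g that)
  qed
  thus ?thesis by (intro bexI[OF _ borel_measurable_lim_metric[of g, OF g_meas]]) simp
qed

context
  fixes m :: "'w measure" and X :: "'w \<Rightarrow> real ^ 'd"
  assumes m: "prob_space m" and X [measurable]: "X \<in> borel_measurable m"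
begin

abbreviation (input) sigma_X where "sigma_X \<equiv> vimage_algebra (space m) X borel"

lemma sigma_X_subalgebra: "finite_measure_subalgebra m sigma_X"
proof -
  interpret prob_space m by (rule m)
  have "subalgebra m sigma_X"
    unfolding subalgebra_def by (auto simp: sets_vimage_algebra2)
  thus ?thesis by unfold_locales
qed

lemma X_measurable_sigma_X: "X \<in> borel_measurable sigma_X"
  by (rule measurable_vimage_algebra1) simp

lemma cond_exp_at_works:
  "cond_exp_at m X f \<in> borel_measurable borel"
  "AE w in m. cond_exp_at m X f (X w) = real_cond_exp m sigma_X f w"
proof -
  obtain g where g: "g \<in> borel_measurable borel" "\<forall>w\<in>space m. real_cond_exp m sigma_X f w = g (X w)"
    using bexE[OF vimage_algebra_factorization[of "real_cond_exp m sigma_X f",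
          OF borel_measurable_cond_exp]] by metis
  have "\<exists>g. g \<in> borel_measurable borel \<and> (AE w in m. g (X w) = real_cond_exp m sigma_X f w)"
    by (intro exI[of _ g] conjI AE_I2 g(1)) (use g(2) in simp)
  from someI_ex[OF this]
  show "cond_exp_at m X f \<in> borel_measurable borel"
    "AE w in m. cond_exp_at m X f (X w) = real_cond_exp m sigma_X f w"
    unfolding cond_exp_at_def by blast+
qed

lemma cond_exp_at_integrable:
  assumes f: "integrable m f"
  shows "integrable (distr m borel X) (cond_exp_at m X f)"
proof -
  interpret finite_measure_subalgebra m sigma_X by (rule sigma_X_subalgebra)
  note [measurable] = cond_exp_at_works(1)[of f] borel_measurable_integrable[OF f]
  have "integrable m (\<lambda>w. cond_exp_at m X f (X w)) \<longleftrightarrow> integrable m (real_cond_exp m sigma_X f)"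
    using cond_exp_at_works(2)[of f] by (intro integrable_cong_AE) auto
  thus ?thesis using real_cond_exp_int(1)[OF f] by (simp add: integrable_distr_eq)
qed

text \<open>
  The defining property of the conditional expectation, transported to the image measure.
\<close>

lemma cond_exp_at_integral:
  assumes f: "integrable m f"
    and \<phi>: "\<phi> \<in> borel_measurable borel" "\<And>x. \<bar>\<phi> x\<bar> \<le> C"
  shows "(\<integral>w. \<phi> (X w) * f w \<partial>m) = (\<integral>x. \<phi> x * cond_exp_at m X f x \<partial>distr m borel X)"
proof -
  interpret finite_measure_subalgebra m sigma_X by (rule sigma_X_subalgebra)
  note [measurable] = cond_exp_at_works(1)[of f] \<phi>(1) borel_measurable_integrable[OF f]
  let ?r = "real_cond_exp m sigma_X f"
  have int: "integrable m (\<lambda>w. \<phi> (X w) * f w)"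
    by (rule bounded_times_integrable[OF _ \<phi>(2) f]) measurable
  have "(\<integral>w. \<phi> (X w) * f w \<partial>m) = (\<integral>w. \<phi> (X w) * ?r w \<partial>m)"
    by (rule real_cond_exp_intg(2)[symmetric, OF int])
       (use measurable_compose[OF X_measurable_sigma_X \<phi>(1)] in auto)
  also have "\<dots> = (\<integral>w. \<phi> (X w) * cond_exp_at m X f (X w) \<partial>m)"
    using cond_exp_at_works(2)[of f] by (intro integral_cong_AE) auto
  also have "\<dots> = (\<integral>x. \<phi> x * cond_exp_at m X f x \<partial>distr m borel X)"
    by (rule integral_distr[symmetric]) auto
  finally show ?thesis .
qed

lemma cond_exp_at_cong:
  assumes f: "f \<in> borel_measurable m" "g \<in> borel_measurable m" and eq: "AE w in m. f w = g w"
  shows "AE x in distr m borel X. cond_exp_at m X f x = cond_exp_at m X g x"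
proof -
  interpret finite_measure_subalgebra m sigma_X by (rule sigma_X_subalgebra)
  note [measurable] = cond_exp_at_works(1)
  have "AE w in m. real_cond_exp m sigma_X f w = real_cond_exp m sigma_X g w"
    by (rule real_cond_exp_cong[OF eq f])
  hence "AE w in m. cond_exp_at m X f (X w) = cond_exp_at m X g (X w)"
    using cond_exp_at_works(2)[of f] cond_exp_at_works(2)[of g] by eventually_elim simp
  thus ?thesis by (subst AE_distr_iff) auto
qed

end


section \<open>The gradient of a smooth function of several variables\<close>

text \<open>
  A smooth function on \<open>real ^ 'd\<close> enters the functional calculus of an error structure through an
  enumeration \<open>ix\<close> of the coordinates, with inverse \<open>pos\<close>.
\<close>

lemma C1_lipschitz_in_coords:
  fixes u :: "real ^ 'd \<Rightarrow> real" and pos :: "'d \<Rightarrow> nat"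
  assumes u: "C1_lipschitz u" and grad: "\<And>x. GDERIV u x :> g x" "continuous_on UNIV g"
    and ix: "bij_betw ix {..<k} UNIV" "\<And>i. ix (pos i) = i" "\<And>l. l < k \<Longrightarrow> pos (ix l) = l"
  shows "C1_lipschitz_coords k (\<lambda>y. u (\<chi> i. y (pos i))) (\<lambda>l y. g (\<chi> i. y (pos i)) $ ix l)"
  unfolding C1_lipschitz_coords_def
proof (intro conjI allI impI)
  obtain L where L: "L-lipschitz_on UNIV u" using conjunct1[OF u[unfolded C1_lipschitz_def]] ..
  have "\<bar>u (\<chi> i. x (pos i)) - u (\<chi> i. y (pos i))\<bar> \<le> L * L2_set (\<lambda>i. x i - y i) {..<k}" for x y
  proof -
    have "\<bar>u (\<chi> i. x (pos i)) - u (\<chi> i. y (pos i))\<bar> \<le> L * dist (\<chi> i. x (pos i)) (\<chi> i. y (pos i))"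
      using lipschitz_onD[OF L] by (simp add: dist_real_def)
    also have "dist (\<chi> i. x (pos i)) (\<chi> i. y (pos i)) = L2_set (\<lambda>i. x (pos i) - y (pos i)) UNIV"
      by (simp add: dist_norm norm_vec_def L2_set_def)
    also have "\<dots> = L2_set (\<lambda>l. x l - y l) {..<k}"
      unfolding L2_set_def
      by (subst sum.reindex_bij_betw[OF ix(1), symmetric])
         (rule arg_cong[where f = sqrt], rule sum.cong[OF refl], simp add: ix(3))
    finally show ?thesis .
  qed
  thus "\<exists>L. \<forall>x y. \<bar>u (\<chi> i. x (pos i)) - u (\<chi> i. y (pos i))\<bar> \<le> L * L2_set (\<lambda>i. x i - y i) {..<k}"
    by blast
  fix l assume l: "l < k"
  show "continuous_on UNIV (\<lambda>y. g (\<chi> i. y (pos i)) $ ix l)"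
    by (intro continuous_on_component continuous_on_compose2[OF grad(2)] continuous_on_vec_lambda
        continuous_on_product_coordinates) auto
  fix x :: "nat \<Rightarrow> real"
  let ?p = "\<chi> i. x (pos i)"
  have line: "(\<chi> i. (x(l := t)) (pos i)) = ?p + (t - x l) *\<^sub>R axis (ix l) 1" for t
    using ix l by (auto simp: vec_eq_iff axis_def)
  have "((\<lambda>t. ?p + (t - x l) *\<^sub>R axis (ix l) 1) has_derivative (\<lambda>h. h *\<^sub>R axis (ix l) 1)) (at (x l))"
    by (auto intro!: derivative_eq_intros)
  moreover have "(u has_derivative (\<lambda>h. h \<bullet> g ?p)) (at (?p + (x l - x l) *\<^sub>R axis (ix l) 1))"
    using grad(1)[of ?p] by (simp add: gderiv_def inner_commute)
  ultimately have "((\<lambda>t. u (?p + (t - x l) *\<^sub>R axis (ix l) 1)) has_derivative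
      (\<lambda>h. (h *\<^sub>R axis (ix l) 1) \<bullet> g ?p)) (at (x l))"
    by (rule has_derivative_compose)
  thus "((\<lambda>t. u (\<chi> i. (x(l := t)) (pos i))) has_real_derivative g ?p $ ix l) (at (x l))"
    unfolding line has_field_derivative_def by (simp add: inner_axis' mult_commute_abs)
qed

lemma coordinate_C1_lipschitz_coords:
  "C1_lipschitz_coords 1 (\<lambda>y. y 0) (\<lambda>_ _. 1)"
  unfolding C1_lipschitz_coords_def
proof (intro conjI allI impI)
  show "\<exists>L. \<forall>(x :: nat \<Rightarrow> real) y. \<bar>x 0 - y 0\<bar> \<le> L * L2_set (\<lambda>i. x i - y i) {..<1}"
  proof (intro exI[of _ 1] allI)
    have "{..<1} = {0 :: nat}" by auto
    thus "\<bar>x 0 - y 0\<bar> \<le> 1 * L2_set (\<lambda>i. x i - y i) {..<1}" for x y :: "nat \<Rightarrow> real"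
      by (simp only: L2_set_def) simp
  qed
  fix i :: nat and x :: "nat \<Rightarrow> real" assume "i < 1"
  hence "(x(i := t)) 0 = t" for t by simp
  thus "((\<lambda>t. (x(i := t)) 0) has_real_derivative 1) (at (x i))" by (simp only: DERIV_ident)
qed simp

context error_structure
begin

context
  fixes D :: "('w \<Rightarrow> real) \<Rightarrow> 'w \<Rightarrow> 'h::{real_inner,banach,second_countable_topology}"
  assumes D: "D_gradient m \<D> \<Gamma> D"
begin

lemma D_L2: "u \<in> \<D> \<Longrightarrow> D u \<in> L2 m"
  and D_add: "u \<in> \<D> \<Longrightarrow> v \<in> \<D> \<Longrightarrow> AE w in m. D (\<lambda>z. u z + v z) w = D u w + D v w"
  and D_scale: "u \<in> \<D> \<Longrightarrow> AE w in m. D (\<lambda>z. c * u z) w = c *\<^sub>R D u w"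
  and D_norm: "u \<in> \<D> \<Longrightarrow> AE w in m. (norm (D u w))\<^sup>2 = \<Gamma> u u w"
  using D unfolding D_gradient_def by blast+

lemma D_diff:
  assumes "u \<in> \<D>" "v \<in> \<D>"
  shows "(\<lambda>z. u z - v z) \<in> \<D>" "AE w in m. D (\<lambda>z. u z - v z) w = D u w - D v w"
proof -
  show "(\<lambda>z. u z - v z) \<in> \<D>" using dom_add[OF assms(1) dom_scale[OF assms(2), of "-1"]] by simp
  show "AE w in m. D (\<lambda>z. u z - v z) w = D u w - D v w"
    using D_add[OF assms(1) dom_scale[OF assms(2), of "-1"]] D_scale[OF assms(2), of "-1"]
    by eventually_elim simp
qed

text \<open>
  Polarization: only \<open>\<parallel>D u\<parallel>\<^sup>2\<close> is prescribed by a gradient, but both sides are bilinear.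
\<close>

lemma inner_D:
  assumes u: "u \<in> \<D>" and v: "v \<in> \<D>"
  shows "AE w in m. D u w \<bullet> D v w = \<Gamma> u v w"
proof -
  let ?s = "\<lambda>z. u z + v z"
  note s = dom_add[OF u v]
  show ?thesis
    using D_norm[OF u] D_norm[OF v] D_norm[OF s] D_add[OF u v] Gamma_add[OF u v s] Gamma_sym[OF u s]
      Gamma_sym[OF v s] Gamma_add[OF u v u] Gamma_add[OF u v v] Gamma_sym[OF u v]
  proof eventually_elim
    case (elim w)
    have "(norm (D u w + D v w))\<^sup>2 = (norm (D u w))\<^sup>2 + 2 * (D u w \<bullet> D v w) + (norm (D v w))\<^sup>2"
      by (simp add: power2_norm_eq_inner inner_add_left inner_add_right inner_commute)
    thus ?case using elim by simp
  qed
qed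

text \<open>
  The functional calculus evaluates \<open>\<Gamma>[u(X)]\<close> and \<open>\<Gamma>[u(X), X\<^sub>j]\<close>, and with these values the square
  \<open>\<parallel>D[u(X)] - \<Sum>\<^sub>i \<partial>\<^sub>iu(X) D[X\<^sub>i]\<parallel>\<^sup>2\<close> expands to \<open>0\<close>.
\<close>

lemma gradient_chain_rule:
  fixes X :: "'w \<Rightarrow> real ^ 'd"
  assumes X: "\<forall>i. (\<lambda>w. X w $ i) \<in> \<D>" and u: "C1_lipschitz u"
    and grad: "\<And>x. GDERIV u x :> g x" "continuous_on UNIV g"
  shows "u \<circ> X \<in> \<D>"
    and "AE w in m. D (u \<circ> X) w = (\<Sum>i\<in>UNIV. g (X w) $ i *\<^sub>R D (\<lambda>z. X z $ i) w)"
proof -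
  define k where "k = card (UNIV :: 'd set)"
  obtain ix :: "nat \<Rightarrow> 'd" where ix: "bij_betw ix {..<k} UNIV"
    using ex_bij_betw_nat_finite[of "UNIV :: 'd set"] by (auto simp: k_def atLeast0LessThan)
  define pos where "pos = inv_into {..<k} ix"
  have pos: "ix (pos i) = i" "l < k \<Longrightarrow> pos (ix l) = l" for i l
    using ix unfolding pos_def
    by (auto simp: bij_betw_def f_inv_into_f inv_into_f_f)
  have C: "C1_lipschitz_coords k (\<lambda>y. u (\<chi> i. y (pos i))) (\<lambda>l y. g (\<chi> i. y (pos i)) $ ix l)"
    by (rule C1_lipschitz_in_coords[OF u grad ix pos])
  define U where "U l w = X w $ ix l" for l w
  have U: "\<forall>l<k. U l \<in> \<D>" using X by (simp add: U_def[abs_def])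
  have uX: "(\<lambda>w. u (\<chi> i. U (pos i) w)) = u \<circ> X"
    by (simp add: fun_eq_iff U_def pos)
  have gX: "g (\<chi> i. U (pos i) w) = g (X w)" for w by (simp add: U_def pos)
  show uX_dom: "u \<circ> X \<in> \<D>" using dom_comp[OF C U] by (simp add: uX)
  let ?d = "\<lambda>i w. D (\<lambda>z. X z $ i) w" and ?S = "\<lambda>i j w. \<Gamma> (\<lambda>z. X z $ i) (\<lambda>z. X z $ j) w"
  have reindex: "(\<Sum>l<k. h (ix l)) = (\<Sum>i\<in>UNIV. h i)" for h :: "'d \<Rightarrow> real"
    by (rule sum.reindex_bij_betw[OF ix])
  have uu: "AE w in m. \<Gamma> (u \<circ> X) (u \<circ> X) w
      = (\<Sum>i\<in>UNIV. \<Sum>j\<in>UNIV. g (X w) $ i * g (X w) $ j * ?S i j w)"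
    using Gamma_comp[OF C U C U] unfolding uX gX
    by eventually_elim (simp only: U_def[abs_def] reindex[symmetric])
  have uj: "AE w in m. \<Gamma> (u \<circ> X) (\<lambda>z. X z $ j) w = (\<Sum>i\<in>UNIV. g (X w) $ i * ?S i j w)" for j
  proof -
    have V: "\<forall>l<1. (\<lambda>z. X z $ j) \<in> \<D>" using X by simp
    show ?thesis
      using Gamma_comp[OF C U coordinate_C1_lipschitz_coords V] unfolding uX gX
      by eventually_elim (simp add: U_def[abs_def] reindex[symmetric] del: One_nat_def)
  qed
  have "AE w in m. \<forall>i\<in>UNIV. D (u \<circ> X) w \<bullet> ?d i w = \<Gamma> (u \<circ> X) (\<lambda>z. X z $ i) w"
    by (intro AE_finite_allI inner_D[OF uX_dom]) (use X in auto)
  moreover have "AE w in m. \<forall>i\<in>UNIV. \<Gamma> (u \<circ> X) (\<lambda>z. X z $ i) w = (\<Sum>j\<in>UNIV. g (X w) $ j * ?S j i w)"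
    by (intro AE_finite_allI uj) auto
  moreover have "AE w in m. \<forall>i\<in>UNIV. \<forall>j\<in>UNIV. ?d i w \<bullet> ?d j w = ?S i j w"
    by (intro AE_finite_allI inner_D) (use X in auto)
  ultimately show "AE w in m. D (u \<circ> X) w = (\<Sum>i\<in>UNIV. g (X w) $ i *\<^sub>R ?d i w)"
    using uu D_norm[OF uX_dom]
  proof eventually_elim
    case (elim w)
    let ?p = "\<Sum>i\<in>UNIV. g (X w) $ i *\<^sub>R ?d i w"
    let ?q = "\<Sum>i\<in>UNIV. \<Sum>j\<in>UNIV. g (X w) $ i * g (X w) $ j * ?S i j w"
    have "D (u \<circ> X) w \<bullet> ?p = (\<Sum>i\<in>UNIV. \<Sum>j\<in>UNIV. g (X w) $ i * (g (X w) $ j * ?S j i w))"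
      using elim(1,2) by (simp add: inner_sum_right sum_distrib_left)
    also have "\<dots> = ?q" by (subst sum.swap) (simp add: mult_ac)
    finally have "D (u \<circ> X) w \<bullet> ?p = ?q" .
    moreover have "?p \<bullet> ?p = ?q"
    proof -
      have "?p \<bullet> ?p = (\<Sum>i\<in>UNIV. \<Sum>j\<in>UNIV. g (X w) $ i * g (X w) $ j * (?d i w \<bullet> ?d j w))"
        unfolding inner_sum_left
        by (intro sum.cong refl) (simp add: inner_sum_right sum_distrib_left mult_ac)
      thus ?thesis using elim(3) by simp
    qed
    ultimately have "(norm (D (u \<circ> X) w - ?p))\<^sup>2 = 0"
      using elim(4,5) by (simp add: power2_norm_eq_inner inner_diff_left inner_diff_right inner_commute)
    thus ?case by simp
  qed
qed

end

end


section \<open>The gradient in the image structure\<close>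

text \<open>
  For the Gram matrix of \<open>F, I\<^sub>1, \<dots>, I\<^sub>d\<close> the left-hand side is \<open>\<Gamma>\<^sub>X[F] - 2 \<Sum>\<^sub>i a\<^sub>i \<Gamma>\<^sub>X[F, I\<^sub>i] +
  a\<^sup>t \<Gamma>\<^sub>X[I] a\<close>, the conditional mean square of the residual \<open>D[F(X)] - \<Sum>\<^sub>i a\<^sub>i D[X\<^sub>i]\<close>.
\<close>

lemma quad_form_option:
  fixes G :: "'d::finite option \<Rightarrow> 'd option \<Rightarrow> real" and a :: "real ^ 'd"
  assumes sym: "\<And>i. G (Some i) None = G None (Some i)"
  shows "quad_form G (case_option 1 (\<lambda>i. - a $ i))
    = G None None - 2 * (a \<bullet> (\<chi> i. G None (Some i))) + a \<bullet> ((\<chi> i j. G (Some i) (Some j)) *v a)"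
proof -
  have "(\<Sum>k\<in>UNIV. h k) = h None + (\<Sum>i\<in>UNIV. h (Some i))" for h :: "'d option \<Rightarrow> real"
    by (simp add: UNIV_option_conv sum.reindex)
  thus ?thesis
    unfolding inner_matrix_quad_form
    by (simp add: quad_form_def sym inner_vec_def sum.distrib sum_negf sum_subtractf)
qed

text \<open>
  The index \<open>None\<close> stands for \<open>F\<close>, so that statements about Gram matrices apply to the residuals
  \<open>D[F(X)] - \<Sum>\<^sub>i a\<^sub>i D[X\<^sub>i]\<close> as well.
\<close>

definition extended_field :: "(('w \<Rightarrow> real) \<Rightarrow> 'w \<Rightarrow> 'h) \<Rightarrow> ('w \<Rightarrow> real ^ 'd)
    \<Rightarrow> (real ^ 'd \<Rightarrow> real) \<Rightarrow> 'd option \<Rightarrow> 'w \<Rightarrow> 'h" where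
  "extended_field D X F = case_option (D (F \<circ> X)) (\<lambda>i. D (\<lambda>w. X w $ i))"

definition extended_Gamma :: "'w measure \<Rightarrow> (('w \<Rightarrow> real) \<Rightarrow> ('w \<Rightarrow> real) \<Rightarrow> 'w \<Rightarrow> real)
    \<Rightarrow> (('w \<Rightarrow> real) \<Rightarrow> 'w \<Rightarrow> 'h::real_inner) \<Rightarrow> ('w \<Rightarrow> real ^ 'd) \<Rightarrow> (real ^ 'd \<Rightarrow> real)
    \<Rightarrow> real ^ 'd \<Rightarrow> 'd option \<Rightarrow> 'd option \<Rightarrow> real" where
  "extended_Gamma m \<Gamma> D X F x k l = (case k of
     None \<Rightarrow> (case l of None \<Rightarrow> image_Gamma1 m \<Gamma> X F x
        | Some j \<Rightarrow> cond_exp_at m X (\<lambda>w. D (F \<circ> X) w \<bullet> D (\<lambda>w. X w $ j) w) x)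
   | Some i \<Rightarrow> (case l of None \<Rightarrow> cond_exp_at m X (\<lambda>w. D (F \<circ> X) w \<bullet> D (\<lambda>w. X w $ i) w) x
        | Some j \<Rightarrow> image_Gamma_matrix m \<Gamma> X x $ i $ j))"

context error_structure
begin

lemma energy_bound:
  assumes D: "D_gradient m \<D> \<Gamma> D" and u: "u \<in> \<D>"
  shows "(L2_norm m (D u))\<^sup>2 \<le> 2 * (dom_norm m \<Gamma> u)\<^sup>2"
proof -
  have "(L2_norm m (D u))\<^sup>2 = (\<integral>w. \<Gamma> u u w \<partial>m)"
    unfolding L2_norm_squared
    using D_norm[OF D u] L2_measurable[OF D_L2[OF D u]] borel_measurable_integrable[OF Gamma_L1[OF u u]]
    by (intro integral_cong_AE) auto
  moreover have "0 \<le> (\<integral>w. \<Gamma> u u w \<partial>m)" by (rule integral_nonneg_AE[OF Gamma_pos[OF u]])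
  ultimately show ?thesis by (simp add: dom_norm_def energy_def)
qed

context
  fixes D :: "('w \<Rightarrow> real) \<Rightarrow> 'w \<Rightarrow> 'h::{real_inner,banach,second_countable_topology}"
    and X :: "'w \<Rightarrow> real ^ 'd"
  assumes D: "D_gradient m \<D> \<Gamma> D" and X: "\<forall>i. (\<lambda>w. X w $ i) \<in> \<D>"
begin

abbreviation (input) DX where "DX i \<equiv> D (\<lambda>w. X w $ i)"

lemma coord_dom: "(\<lambda>w. X w $ i) \<in> \<D>"
  using X by blast

lemma X_measurable [measurable]: "X \<in> borel_measurable m"
proof (rule borel_measurable_vecI)
  show "(\<lambda>w. X w $ i) \<in> borel_measurable m" for i
    using coord_dom dom_L2 by (intro L2_measurable) blast
qed

lemma Gamma_integral_cong:
  assumes u: "u \<in> \<D>" and v: "v \<in> \<D>" and \<phi>: "\<phi> \<in> borel_measurable m"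
  shows "(\<integral>w. \<phi> w * (D u w \<bullet> D v w) \<partial>m) = (\<integral>w. \<phi> w * \<Gamma> u v w \<partial>m)"
proof (rule integral_cong_AE)
  note [measurable] = \<phi> borel_measurable_integrable[OF Gamma_L1[OF u v]]
    L2_measurable[OF D_L2[OF D u]] L2_measurable[OF D_L2[OF D v]]
  show "(\<lambda>w. \<phi> w * (D u w \<bullet> D v w)) \<in> borel_measurable m" by measurable
  show "(\<lambda>w. \<phi> w * \<Gamma> u v w) \<in> borel_measurable m" by measurable
  show "AE w in m. \<phi> w * (D u w \<bullet> D v w) = \<phi> w * \<Gamma> u v w"
    using inner_D[OF D u v] by eventually_elim simp
qed

lemma initial_gram_fields: "gram_fields m m (\<lambda>w. w) DX (\<lambda>w i j. Gamma_matrix \<Gamma> X w $ i $ j)"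
proof
  show "distr m m (\<lambda>w. w) = m" by (rule distr_id)
  show "DX k \<in> L2 m" for k by (rule D_L2[OF D coord_dom])
  show "integrable m (\<lambda>w. Gamma_matrix \<Gamma> X w $ k $ l)" for k l
    using Gamma_L1[OF coord_dom coord_dom] by (simp add: Gamma_matrix_def)
  show "(\<integral>w. \<phi> w * (DX k w \<bullet> DX l w) \<partial>m) = (\<integral>w. \<phi> w * Gamma_matrix \<Gamma> X w $ k $ l \<partial>m)"
    if "\<phi> \<in> borel_measurable m" for \<phi> :: "'w \<Rightarrow> real" and k l
    using Gamma_integral_cong[OF coord_dom coord_dom that] by (simp add: Gamma_matrix_def)
qed measurable

lemma image_Gamma1_integrable:
  assumes u: "u \<circ> X \<in> \<D>"
  shows "integrable (distr m borel X) (image_Gamma1 m \<Gamma> X u)"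
  using cond_exp_at_integrable[OF prob_space_axioms X_measurable Gamma_L1[OF u u]]
  by (simp add: image_Gamma1_def[abs_def])

lemma image_Gamma1_integral:
  assumes u: "u \<circ> X \<in> \<D>" and \<phi>: "\<phi> \<in> borel_measurable borel" "\<And>x. \<bar>\<phi> x\<bar> \<le> C"
  shows "(\<integral>x. \<phi> x * image_Gamma1 m \<Gamma> X u x \<partial>distr m borel X) = (\<integral>w. \<phi> (X w) * \<Gamma> (u \<circ> X) (u \<circ> X) w \<partial>m)"
  using cond_exp_at_integral[OF prob_space_axioms X_measurable Gamma_L1[OF u u] \<phi>]
  by (simp add: image_Gamma1_def[abs_def])

lemma polarization_D:
  assumes u: "u \<in> \<D>" and v: "v \<in> \<D>"
  shows "AE w in m. D u w \<bullet> D v w =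
    (\<Gamma> (\<lambda>w. u w + v w) (\<lambda>w. u w + v w) w - \<Gamma> (\<lambda>w. u w - v w) (\<lambda>w. u w - v w) w) / 4"
  using D_add[OF D u v] D_diff(2)[OF D u v] D_norm[OF D dom_add[OF u v]] D_norm[OF D D_diff(1)[OF D u v]]
proof eventually_elim
  case (elim w)
  have "(norm (D u w + D v w))\<^sup>2 - (norm (D u w - D v w))\<^sup>2 = 4 * (D u w \<bullet> D v w)"
    by (simp add: power2_norm_eq_inner inner_add_left inner_add_right inner_diff_left
        inner_diff_right inner_commute)
  thus ?case using elim by simp
qed

lemma coord_sum_dom: "(\<lambda>y. y $ i + y $ j) \<circ> X \<in> \<D>"
  and coord_diff_dom: "(\<lambda>y. y $ i - y $ j) \<circ> X \<in> \<D>"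
  using dom_add[OF coord_dom coord_dom] D_diff(1)[OF D coord_dom coord_dom] by (simp_all add: comp_def)

lemma image_Gamma_matrix_polarization:
  "image_Gamma_matrix m \<Gamma> X x $ i $ j
    = (image_Gamma1 m \<Gamma> X (\<lambda>y. y $ i + y $ j) x - image_Gamma1 m \<Gamma> X (\<lambda>y. y $ i - y $ j) x) / 4"
  by (simp add: image_Gamma_matrix_def Gamma_matrix_def image_Gamma_def)

lemma image_Gamma_integrable: "integrable (distr m borel X) (\<lambda>x. image_Gamma_matrix m \<Gamma> X x $ i $ j)"
  unfolding image_Gamma_matrix_polarization
  using image_Gamma1_integrable[OF coord_sum_dom] image_Gamma1_integrable[OF coord_diff_dom] by simp

lemma image_Gamma_integral:
  assumes \<phi>: "\<phi> \<in> borel_measurable borel" "\<And>x. \<bar>\<phi> x\<bar> \<le> C"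
  shows "(\<integral>w. \<phi> (X w) * (DX i w \<bullet> DX j w) \<partial>m)
      = (\<integral>x. \<phi> x * image_Gamma_matrix m \<Gamma> X x $ i $ j \<partial>distr m borel X)"
proof -
  let ?p = "\<lambda>y :: real ^ 'd. y $ i + y $ j" and ?q = "\<lambda>y :: real ^ 'd. y $ i - y $ j"
  note p = coord_sum_dom[of i j] and q = coord_diff_dom[of i j]
  note P = image_Gamma1_integrable[OF p] image_Gamma1_integral[OF p \<phi>]
  note Q = image_Gamma1_integrable[OF q] image_Gamma1_integral[OF q \<phi>]
  have [measurable]: "\<phi> \<in> borel_measurable borel" by (rule \<phi>)
  have "(\<integral>w. \<phi> (X w) * (DX i w \<bullet> DX j w) \<partial>m)
      = (\<integral>w. (\<phi> (X w) * \<Gamma> (?p \<circ> X) (?p \<circ> X) w - \<phi> (X w) * \<Gamma> (?q \<circ> X) (?q \<circ> X) w) / 4 \<partial>m)"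
  proof (rule integral_cong_AE)
    note [measurable] = borel_measurable_integrable[OF Gamma_L1[OF p p]]
      borel_measurable_integrable[OF Gamma_L1[OF q q]]
      L2_measurable[OF D_L2[OF D coord_dom]]
    show "(\<lambda>w. \<phi> (X w) * (DX i w \<bullet> DX j w)) \<in> borel_measurable m" by measurable
    show "(\<lambda>w. (\<phi> (X w) * \<Gamma> (?p \<circ> X) (?p \<circ> X) w - \<phi> (X w) * \<Gamma> (?q \<circ> X) (?q \<circ> X) w) / 4)
        \<in> borel_measurable m" by measurable
    show "AE w in m. \<phi> (X w) * (DX i w \<bullet> DX j w)
        = (\<phi> (X w) * \<Gamma> (?p \<circ> X) (?p \<circ> X) w - \<phi> (X w) * \<Gamma> (?q \<circ> X) (?q \<circ> X) w) / 4"
      using polarization_D[OF coord_dom[of i] coord_dom[of j]]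
    proof eventually_elim
      case (elim w)
      show ?case unfolding elim by (simp add: comp_def right_diff_distrib)
    qed
  qed
  also have "\<dots> = ((\<integral>w. \<phi> (X w) * \<Gamma> (?p \<circ> X) (?p \<circ> X) w \<partial>m) - (\<integral>w. \<phi> (X w) * \<Gamma> (?q \<circ> X) (?q \<circ> X) w \<partial>m)) / 4"
    using bounded_times_integrable[of "\<lambda>w. \<phi> (X w)" m, OF _ \<phi>(2) Gamma_L1[OF p p]]
      bounded_times_integrable[of "\<lambda>w. \<phi> (X w)" m, OF _ \<phi>(2) Gamma_L1[OF q q]] by simp
  also have "\<dots> = (\<integral>x. (\<phi> x * image_Gamma1 m \<Gamma> X ?p x - \<phi> x * image_Gamma1 m \<Gamma> X ?q x) / 4 \<partial>distr m borel X)"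
    unfolding P(2)[symmetric] Q(2)[symmetric]
    using bounded_times_integrable[of \<phi> "distr m borel X", OF _ \<phi>(2) P(1)]
      bounded_times_integrable[of \<phi> "distr m borel X", OF _ \<phi>(2) Q(1)] by simp
  also have "\<dots> = (\<integral>x. \<phi> x * image_Gamma_matrix m \<Gamma> X x $ i $ j \<partial>distr m borel X)"
    by (intro Bochner_Integration.integral_cong) (simp_all add: image_Gamma_matrix_polarization right_diff_distrib)
  finally show "(\<integral>w. \<phi> (X w) * (DX i w \<bullet> DX j w) \<partial>m)
      = (\<integral>x. \<phi> x * image_Gamma_matrix m \<Gamma> X x $ i $ j \<partial>distr m borel X)" .
qed

lemma distr_image_measure: "distr m (distr m borel X) X = distr m borel X"
  by (rule distr_cong) auto

lemma bounded_extension: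
  fixes \<phi> :: "real ^ 'd \<Rightarrow> real"
  assumes "\<phi> \<in> borel_measurable (distr m borel X)" "\<And>x. x \<in> space (distr m borel X) \<Longrightarrow> \<bar>\<phi> x\<bar> \<le> C"
  shows "\<phi> \<in> borel_measurable borel" "\<And>x. \<bar>\<phi> x\<bar> \<le> C"
  using assms by auto

lemma image_gram_fields:
  "gram_fields m (distr m borel X) X DX (\<lambda>x i j. image_Gamma_matrix m \<Gamma> X x $ i $ j)"
proof
  show "integrable (distr m borel X) (\<lambda>x. image_Gamma_matrix m \<Gamma> X x $ k $ l)" for k l
    by (rule image_Gamma_integrable)
  show "(\<integral>w. \<phi> (X w) * (DX k w \<bullet> DX l w) \<partial>m)
      = (\<integral>x. \<phi> x * image_Gamma_matrix m \<Gamma> X x $ k $ l \<partial>distr m borel X)"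
    if "\<phi> \<in> borel_measurable (distr m borel X)" "\<And>x. x \<in> space (distr m borel X) \<Longrightarrow> \<bar>\<phi> x\<bar> \<le> C"
    for \<phi> C k l
    by (rule image_Gamma_integral[OF bounded_extension[OF that]])
qed (simp_all add: distr_image_measure D_L2[OF D coord_dom])

lemma extended_gram_fields:
  assumes F: "F \<circ> X \<in> \<D>"
  shows "gram_fields m (distr m borel X) X (extended_field D X F) (extended_Gamma m \<Gamma> D X F)"
proof -
  note DF = D_L2[OF D F]
  have mixed: "integrable m (\<lambda>w. D (F \<circ> X) w \<bullet> DX j w)" for j
    by (intro integrable_inner_L2 DF D_L2[OF D coord_dom])
  note C = cond_exp_at_integrable[OF prob_space_axioms X_measurable mixed]
    cond_exp_at_integral[OF prob_space_axioms X_measurable mixed]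
  show ?thesis
  proof
    show "extended_field D X F k \<in> L2 m" for k
      using DF D_L2[OF D coord_dom] by (cases k) (simp_all add: extended_field_def)
    show "integrable (distr m borel X) (\<lambda>x. extended_Gamma m \<Gamma> D X F x k l)" for k l
      using C(1) image_Gamma1_integrable[OF F] image_Gamma_integrable
      by (cases k; cases l) (simp_all add: extended_Gamma_def)
    show "(\<integral>w. \<phi> (X w) * (extended_field D X F k w \<bullet> extended_field D X F l w) \<partial>m)
        = (\<integral>x. \<phi> x * extended_Gamma m \<Gamma> D X F x k l \<partial>distr m borel X)"
      if "\<phi> \<in> borel_measurable (distr m borel X)" "\<And>x. x \<in> space (distr m borel X) \<Longrightarrow> \<bar>\<phi> x\<bar> \<le> B"
      for \<phi> B k l
    proof -
      note \<phi> = bounded_extension[OF that]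
      have "(\<lambda>w. \<phi> (X w)) \<in> borel_measurable m" using \<phi>(1) by measurable
      note FF = Gamma_integral_cong[OF F F this] and Gamma1 = image_Gamma1_integral[OF F \<phi>]
      have comm: "DX i w \<bullet> D (F \<circ> X) w = D (F \<circ> X) w \<bullet> DX i w" for i w by (rule inner_commute)
      show ?thesis
        using FF Gamma1 C(2)[OF \<phi>] image_Gamma_integral[OF \<phi>]
        by (cases k; cases l) (simp_all add: extended_Gamma_def extended_field_def comm)
    qed
  qed (simp_all add: distr_image_measure)
qed

text \<open>
  Exchanging \<open>i\<close> and \<open>j\<close> changes the sign of the argument in the second term of the polarization
  that defines \<open>\<Gamma>\<^sub>X[I\<^sub>i, I\<^sub>j]\<close>.
\<close>

lemma image_Gamma_matrix_symmetric:
  "AE x in distr m borel X. \<forall>i j. image_Gamma_matrix m \<Gamma> X x $ i $ j = image_Gamma_matrix m \<Gamma> X x $ j $ i"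
proof -
  have "AE x in distr m borel X. image_Gamma_matrix m \<Gamma> X x $ i $ j = image_Gamma_matrix m \<Gamma> X x $ j $ i" for i j
  proof -
    let ?q = "\<lambda>i j (y :: real ^ 'd). y $ i - y $ j"
    note q = coord_diff_dom
    have neg: "?q j i \<circ> X = (\<lambda>w. (-1) * (?q i j \<circ> X) w)" by (auto simp: fun_eq_iff)
    have "AE w in m. \<Gamma> (?q i j \<circ> X) (?q i j \<circ> X) w = \<Gamma> (?q j i \<circ> X) (?q j i \<circ> X) w"
      using D_norm[OF D q[of i j]] D_norm[OF D q[of j i]] D_scale[OF D q[of i j], of "-1"]
      unfolding neg[symmetric] by eventually_elim simp
    hence "AE x in distr m borel X. image_Gamma1 m \<Gamma> X (?q i j) x = image_Gamma1 m \<Gamma> X (?q j i) x"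
      unfolding image_Gamma1_def
      by (intro cond_exp_at_cong prob_space_axioms X_measurable
          borel_measurable_integrable Gamma_L1 q)
    thus ?thesis
      by eventually_elim (simp add: image_Gamma_matrix_polarization add.commute)
  qed
  hence "AE x in distr m borel X. \<forall>i\<in>UNIV. \<forall>j\<in>UNIV.
      image_Gamma_matrix m \<Gamma> X x $ i $ j = image_Gamma_matrix m \<Gamma> X x $ j $ i"
    by (intro AE_finite_allI) auto
  thus ?thesis by simp
qed

text \<open>
  For fixed \<open>x\<close> the mean square residual \<open>q x a\<close> is a nonnegative quadratic polynomial in \<open>a\<close>, so it
  attains its minimum at the measurable point \<open>v x = solve (g x) (c x)\<close>. A smooth function \<open>u\<close> close
  to \<open>F\<close> gives a competitor \<open>a = \<nabla>u\<close> with small integrated residual, so the minimum is \<open>0\<close> almost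
  everywhere. Vanishing of the residual is both the formula for \<open>\<Gamma>\<^sub>X[F]\<close> and the representation of
  \<open>D[F(X)]\<close>.
\<close>

lemma image_gradient_exists:
  assumes F: "F \<in> image_dom m \<D> \<Gamma> X"
  shows "\<exists>v\<in>borel_measurable borel.
    (AE w in m. D (F \<circ> X) w = (\<Sum>i\<in>UNIV. v (X w) $ i *\<^sub>R D (\<lambda>w. X w $ i) w)) \<and>
    (AE x in distr m borel X. image_Gamma1 m \<Gamma> X F x = v x \<bullet> (image_Gamma_matrix m \<Gamma> X x *v v x))"
proof -
  have FX: "F \<circ> X \<in> \<D>" using F by (simp add: image_dom_def)
  let ?M = "distr m borel X"
  interpret E: gram_fields m ?M X "extended_field D X F" "extended_Gamma m \<Gamma> D X F"
    by (rule extended_gram_fields[OF FX])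
  define g where "g = image_Gamma_matrix m \<Gamma> X"
  define s where "s = image_Gamma1 m \<Gamma> X F"
  define c where "c x = (\<chi> i. extended_Gamma m \<Gamma> D X F x None (Some i))" for x
  define q where "q x a = quad_form (extended_Gamma m \<Gamma> D X F x) (case_option 1 (\<lambda>i. - a $ i))"
    for x and a :: "real ^ 'd"
  have q: "q x a = s x - 2 * (a \<bullet> c x) + a \<bullet> (g x *v a)" for x a
  proof -
    have "(\<chi> i j. extended_Gamma m \<Gamma> D X F x (Some i) (Some j)) = g x"
      by (simp add: vec_eq_iff g_def extended_Gamma_def)
    moreover have "extended_Gamma m \<Gamma> D X F x None None = s x"
      by (simp add: s_def extended_Gamma_def)
    ultimately show ?thesis
      unfolding q_def c_def
      by (subst quad_form_option) (simp_all add: extended_Gamma_def)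
  qed
  define coeff where "coeff a k x = case_option 1 (\<lambda>i. - a x $ i) k"
    for a :: "real ^ 'd \<Rightarrow> real ^ 'd" and k x
  have coeff_measurable: "\<forall>k. coeff a k \<in> borel_measurable ?M" if "a \<in> borel_measurable borel" for a
  proof
    fix k
    have "(\<lambda>x. a x $ i) \<in> borel_measurable borel" for i
      by (rule measurable_compose[OF that borel_measurable_nth])
    thus "coeff a k \<in> borel_measurable ?M" by (cases k) (simp_all add: coeff_def[abs_def])
  qed
  have comb: "E.comb (coeff a) w = D (F \<circ> X) w - (\<Sum>i\<in>UNIV. a (X w) $ i *\<^sub>R D (\<lambda>w. X w $ i) w)" for a w
    unfolding E.comb_def coeff_def
    by (simp add: extended_field_def UNIV_option_conv sum.reindex sum_negf)
  have nn: "(\<integral>\<^sup>+w. ennreal ((norm (E.comb (coeff a) w))\<^sup>2) \<partial>m) = (\<integral>\<^sup>+x. ennreal (q x (a x)) \<partial>?M)"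
    if "a \<in> borel_measurable borel" for a
    using E.nn_integral_comb[OF coeff_measurable[OF that]] by (simp add: coeff_def q_def)
  \<comment> \<open>For almost every \<open>x\<close> all vectors \<open>a\<close> are admitted at once: countably many suffice by continuity.\<close>
  obtain S :: "(real ^ 'd) set" where S: "countable S" "\<And>U. open U \<Longrightarrow> U \<noteq> {} \<Longrightarrow> \<exists>d\<in>S. d \<in> U"
    using countable_dense_exists by blast
  have "AE x in ?M. \<forall>a\<in>S. 0 \<le> q x a"
    unfolding AE_ball_countable[OF S(1)]
  proof
    fix a :: "real ^ 'd"
    show "AE x in ?M. 0 \<le> q x a"
      using E.quad_form_nonneg[OF coeff_measurable[of "\<lambda>_. a"]] by (simp add: coeff_def q_def)
  qed
  hence q_nonneg: "AE x in ?M. \<forall>a. 0 \<le> q x a"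
  proof eventually_elim
    case (elim x)
    show ?case
    proof (rule allI, rule ccontr)
      fix a assume "\<not> 0 \<le> q x a"
      hence "q x a < 0" by simp
      hence "{a. q x a < 0} \<noteq> {}" by blast
      moreover have "continuous_on UNIV (\<lambda>a. g x *v a)"
        by (rule linear_continuous_on[OF matrix_vector_mul_bounded_linear])
      hence "open {a. q x a < 0}"
        unfolding q by (intro open_Collect_less continuous_intros)
      ultimately obtain d where d: "d \<in> S" "q x d < 0" using S(2)[of "{a. q x a < 0}"] by blast
      thus False using bspec[OF elim d(1)] by simp
    qed
  qed
  define v where "v x = solve (g x) (c x)" for x
  have [measurable]: "v \<in> borel_measurable borel"
    unfolding v_def[abs_def]
  proof (intro solve_measurable borel_measurable_vecI)
    show "(\<lambda>x. g x $ i $ j) \<in> borel_measurable borel" for i j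
      using E.gram_measurable[of "Some i" "Some j"] by (simp add: g_def extended_Gamma_def)
    show "(\<lambda>x. c x $ i) \<in> borel_measurable borel" for i
      using E.gram_measurable[of None "Some i"] by (simp add: c_def)
  qed
  have v: "AE x in ?M. g x *v v x = c x \<and> (\<forall>a. q x (v x) \<le> q x a)"
    using q_nonneg image_Gamma_matrix_symmetric
  proof eventually_elim
    case (elim x)
    have solves: "g x *v v x = c x" and min: "\<And>a. s x - v x \<bullet> (g x *v v x) \<le> q x a"
      using bounded_below_quadratic[of "g x" "s x" "c x"] elim unfolding v_def q by (auto simp: g_def)
    moreover have "q x (v x) = s x - v x \<bullet> (g x *v v x)" unfolding q solves by simp
    ultimately show ?case by simp
  qed
  \<comment> \<open>\<open>v\<close> beats the gradients of the approximating smooth functions, whose residual tends to \<open>0\<close>.\<close>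
  have "(\<integral>\<^sup>+x. ennreal (q x (v x)) \<partial>?M) \<le> 0 + ennreal r" if r: "0 < r" for r
  proof -
    have "0 < sqrt (r / 2)" using r by simp
    then obtain u where u: "C1_lipschitz u" "dom_norm m \<Gamma> ((\<lambda>x. F x - u x) \<circ> X) < sqrt (r / 2)"
      using F unfolding image_dom_def by blast
    obtain a where a: "\<And>x. GDERIV u x :> a x" "continuous_on UNIV a"
      using conjunct2[OF u(1)[unfolded C1_lipschitz_def]] by blast
    note chain = gradient_chain_rule[OF D X u(1) a]
    let ?d = "\<lambda>w. (F \<circ> X) w - (u \<circ> X) w"
    note d = D_diff[OF D FX chain(1)]
    have a_meas: "a \<in> borel_measurable borel" using a(2) by (rule borel_measurable_continuous_onI)
    have "(\<integral>\<^sup>+x. ennreal (q x (v x)) \<partial>?M) \<le> (\<integral>\<^sup>+x. ennreal (q x (a x)) \<partial>?M)"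
    proof (rule nn_integral_mono_AE, use v in eventually_elim)
      case (elim x)
      thus ?case by (intro ennreal_leI) blast
    qed
    also have "\<dots> = (\<integral>\<^sup>+w. ennreal ((norm (E.comb (coeff a) w))\<^sup>2) \<partial>m)" by (rule nn[OF a_meas, symmetric])
    also have "\<dots> = (\<integral>\<^sup>+w. ennreal ((norm (D ?d w))\<^sup>2) \<partial>m)"
      by (rule nn_integral_cong_AE, use d(2) chain(2) in eventually_elim) (simp add: comb)
    also have "\<dots> = ennreal ((L2_norm m (D ?d))\<^sup>2)"
      unfolding L2_norm_squared by (intro nn_integral_eq_integral L2_integrable D_L2[OF D d(1)]) auto
    also have "\<dots> \<le> ennreal r"
    proof (rule ennreal_leI)
      have "(L2_norm m (D ?d))\<^sup>2 \<le> 2 * (dom_norm m \<Gamma> ?d)\<^sup>2" by (rule energy_bound[OF D d(1)])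
      also have "\<dots> \<le> 2 * (sqrt (r / 2))\<^sup>2"
      proof (intro mult_left_mono power_mono)
        show "dom_norm m \<Gamma> ?d \<le> sqrt (r / 2)" using u(2) by (simp add: comp_def)
        show "0 \<le> dom_norm m \<Gamma> ?d"
          unfolding dom_norm_def energy_def using integral_nonneg_AE[OF Gamma_pos[OF d(1)]]
          by (intro real_sqrt_ge_zero) simp
      qed simp
      also have "\<dots> = r" using r by simp
      finally show "(L2_norm m (D ?d))\<^sup>2 \<le> r" .
    qed
    finally show ?thesis by simp
  qed
  hence "(\<integral>\<^sup>+x. ennreal (q x (v x)) \<partial>?M) \<le> 0" by (rule ennreal_le_epsilon)
  hence zero: "(\<integral>\<^sup>+x. ennreal (q x (v x)) \<partial>?M) = 0" by simp
  have "E.comb (coeff v) \<in> borel_measurable m" by (intro E.comb_measurable coeff_measurable) measurable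
  hence "AE w in m. ennreal ((norm (E.comb (coeff v) w))\<^sup>2) = 0"
    using nn[of v] zero by (subst nn_integral_0_iff_AE[symmetric]) simp_all
  hence grad: "AE w in m. D (F \<circ> X) w = (\<Sum>i\<in>UNIV. v (X w) $ i *\<^sub>R D (\<lambda>w. X w $ i) w)"
    by eventually_elim (simp add: comb)
  have "(\<lambda>x. q x (v x)) \<in> borel_measurable ?M"
    using E.quad_form_measurable[OF coeff_measurable[of v]] by (simp add: coeff_def q_def)
  hence "AE x in ?M. ennreal (q x (v x)) = 0"
    using zero by (subst nn_integral_0_iff_AE[symmetric]) simp_all
  hence "AE x in ?M. s x = v x \<bullet> (g x *v v x)"
    using q_nonneg v
  proof eventually_elim
    case (elim x)
    have "q x (v x) = 0" using elim(1) elim(2)[rule_format, of "v x"] by (simp add: ennreal_eq_0_iff)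
    thus ?case using elim(3) by (simp add: q)
  qed
  thus ?thesis using grad \<open>v \<in> borel_measurable borel\<close> unfolding s_def g_def by blast
qed

end

end


section \<open>Representation of the measure valued gradient\<close>

theorem proposition4:
  fixes m :: "'w measure" and \<D> :: "('w \<Rightarrow> real) set"
    and \<Gamma> :: "('w \<Rightarrow> real) \<Rightarrow> ('w \<Rightarrow> real) \<Rightarrow> 'w \<Rightarrow> real"
    and D :: "('w \<Rightarrow> real) \<Rightarrow> 'w \<Rightarrow> 'h::{real_inner,banach,second_countable_topology}"
    and P :: "'o measure" and N :: "nat set" and e :: "nat \<Rightarrow> 'h"
    and \<nu> :: "nat \<Rightarrow> 'w set \<Rightarrow> 'o \<Rightarrow> real"
    and X :: "'w \<Rightarrow> real ^ 'd"
  assumes "error_structure m \<D> \<Gamma>"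
    and "D_gradient m \<D> \<Gamma> D"
    and "H_white_noise P m N e \<nu>"
    and "\<forall>i. (\<lambda>w. X w $ i) \<in> \<D>"
  shows "\<forall>F\<in> image_dom m \<D> \<Gamma> X. \<exists>nablaF\<in> weighted_L2 (image_measure m X) (image_Gamma_matrix m \<Gamma> X).
      wn_eq P (image_measure m X) (image_dG P m N e \<nu> D X F)
        (wn_dot P (image_measure m X) (image_Gamma_matrix m \<Gamma> X) (\<lambda>i. image_dG P m N e \<nu> D X (\<lambda>x. x $ i)) nablaF) \<and>
      (AE x in image_measure m X. image_Gamma1 m \<Gamma> X F x = nablaF x \<bullet> (image_Gamma_matrix m \<Gamma> X x *v nablaF x)) \<and>
      wn_eq P m (dG P m N e \<nu> D (F \<circ> X))
        (wn_dot P m (Gamma_matrix \<Gamma> X) (\<lambda>i. dG P m N e \<nu> D (\<lambda>w. X w $ i)) (nablaF \<circ> X))"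
proof
  fix F assume F: "F \<in> image_dom m \<D> \<Gamma> X"
  interpret error_structure m \<D> \<Gamma> by fact
  note D = assms(2) and X = assms(4)
  note [measurable] = X_measurable[OF D X]
  let ?T = "H_integral P m N e \<nu>"
  have T: "L2_isometry P m ?T"
    by (rule H_integral_isometry[OF finite_measure_axioms assms(3)])
  have FX: "F \<circ> X \<in> \<D>" using F by (simp add: image_dom_def)
  note DF = D_L2[OF D FX]
  obtain v where v [measurable]: "v \<in> borel_measurable borel"
    and grad: "AE w in m. D (F \<circ> X) w = (\<Sum>i\<in>UNIV. v (X w) $ i *\<^sub>R D (\<lambda>w. X w $ i) w)"
    and Gamma: "AE x in image_measure m X. image_Gamma1 m \<Gamma> X F x = v x \<bullet> (image_Gamma_matrix m \<Gamma> X x *v v x)"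
    using image_gradient_exists[OF D X F] by blast
  have vX [measurable]: "v \<circ> X \<in> borel_measurable m" by measurable

  interpret I: gram_noise m "image_measure m X" X "\<lambda>i. D (\<lambda>w. X w $ i)" "image_Gamma_matrix m \<Gamma> X"
      P ?T "\<lambda>i. image_dG P m N e \<nu> D X (\<lambda>x. x $ i)"
  proof (intro gram_noise.intro gram_noise_axioms.intro image_gram_fields[OF D X] T)
    show "image_dG P m N e \<nu> D X (\<lambda>x. x $ i) A
        = ?T (\<lambda>w. indicator (X -` A \<inter> space m) w *\<^sub>R D (\<lambda>w. X w $ i) w)" for A i
      by (simp add: image_dG_def wn_image_def dG_def H_pairing_eq_H_integral comp_def)
  qed
  interpret W: gram_noise m m "\<lambda>w. w" "\<lambda>i. D (\<lambda>w. X w $ i)" "Gamma_matrix \<Gamma> X"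
      P ?T "\<lambda>i. dG P m N e \<nu> D (\<lambda>w. X w $ i)"
  proof (intro gram_noise.intro gram_noise_axioms.intro initial_gram_fields[OF D X] T)
    show "dG P m N e \<nu> D (\<lambda>w. X w $ i) A
        = ?T (\<lambda>w. indicator ((\<lambda>w. w) -` A \<inter> space m) w *\<^sub>R D (\<lambda>w. X w $ i) w)"
      if "A \<in> sets m" for A i
      using sets.sets_into_space[OF that]
      by (simp add: dG_def H_pairing_eq_H_integral vimage_def Int_absorb2)
  qed

  have comb: "W.comb (\<lambda>i w. (v \<circ> X) w $ i) = I.comb (\<lambda>i x. v x $ i)"
    by (simp add: fun_eq_iff W.comb_def I.comb_def)
  have comb_eq: "AE w in m. D (F \<circ> X) w = I.comb (\<lambda>i x. v x $ i) w"
    using grad by (simp add: I.comb_def)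
  have v': "v \<in> borel_measurable (image_measure m X)" by simp
  have comb_L2: "I.comb (\<lambda>i x. v x $ i) \<in> L2 m"
    by (rule L2_cong_AE[OF DF I.comb_measurable[OF I.vec_measurable[OF v']] comb_eq])

  show "\<exists>nablaF\<in> weighted_L2 (image_measure m X) (image_Gamma_matrix m \<Gamma> X).
      wn_eq P (image_measure m X) (image_dG P m N e \<nu> D X F)
        (wn_dot P (image_measure m X) (image_Gamma_matrix m \<Gamma> X) (\<lambda>i. image_dG P m N e \<nu> D X (\<lambda>x. x $ i)) nablaF) \<and>
      (AE x in image_measure m X. image_Gamma1 m \<Gamma> X F x = nablaF x \<bullet> (image_Gamma_matrix m \<Gamma> X x *v nablaF x)) \<and>
      wn_eq P m (dG P m N e \<nu> D (F \<circ> X))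
        (wn_dot P m (Gamma_matrix \<Gamma> X) (\<lambda>i. dG P m N e \<nu> D (\<lambda>w. X w $ i)) (nablaF \<circ> X))"
  proof (intro bexI[of _ v] conjI Gamma)
    show "v \<in> weighted_L2 (image_measure m X) (image_Gamma_matrix m \<Gamma> X)"
      using I.weighted_L2_iff[OF v'] comb_L2 by simp
    have restricted: "AE \<omega> in P. ?T (\<lambda>w. indicator A w *\<^sub>R D (F \<circ> X) w) \<omega>
        = ?T (\<lambda>w. indicator B (p w) *\<^sub>R I.comb (\<lambda>i x. v x $ i) w) \<omega>"
      if A: "A \<in> sets m" and AB: "\<And>w. w \<in> space m \<Longrightarrow> w \<in> A \<longleftrightarrow> p w \<in> B" for A p and B :: "'z set"
    proof (rule L2_isometry_cong[OF T])
      show L: "(\<lambda>w. indicator A w *\<^sub>R D (F \<circ> X) w) \<in> L2 m" by (rule L2_indicator_scaleR[OF DF A])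
      have eq: "(indicator B (p w) :: real) = indicator A w" if "w \<in> space m" for w
        using AB[OF that] by (simp split: split_indicator)
      show "(\<lambda>w. indicator B (p w) *\<^sub>R I.comb (\<lambda>i x. v x $ i) w) \<in> L2 m"
      proof (rule L2_cong_AE[OF L2_indicator_scaleR[OF comb_L2 A]])
        have "(\<lambda>w. indicator A w *\<^sub>R I.comb (\<lambda>i x. v x $ i) w) \<in> borel_measurable m"
          by (rule L2_measurable[OF L2_indicator_scaleR[OF comb_L2 A]])
        thus "(\<lambda>w. indicator B (p w) *\<^sub>R I.comb (\<lambda>i x. v x $ i) w) \<in> borel_measurable m"
          by (rule measurable_cong[THEN iffD1, rotated]) (simp add: eq)
      qed (intro AE_I2, simp add: eq)
      show "AE w in m. indicator A w *\<^sub>R D (F \<circ> X) w = indicator B (p w) *\<^sub>R I.comb (\<lambda>i x. v x $ i) w"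
        using comb_eq AE_space by eventually_elim (simp add: eq)
    qed
    show "wn_eq P (image_measure m X) (image_dG P m N e \<nu> D X F)
        (wn_dot P (image_measure m X) (image_Gamma_matrix m \<Gamma> X) (\<lambda>i. image_dG P m N e \<nu> D X (\<lambda>x. x $ i)) v)"
      unfolding wn_eq_def
    proof
      fix A assume A: "A \<in> sets (image_measure m X)"
      have B: "X -` A \<inter> space m \<in> sets m" using A by simp
      have "AE \<omega> in P. ?T (\<lambda>w. indicator (X -` A \<inter> space m) w *\<^sub>R D (F \<circ> X) w) \<omega>
          = ?T (\<lambda>w. indicator A (X w) *\<^sub>R I.comb (\<lambda>i x. v x $ i) w) \<omega>"
        by (rule restricted[OF B]) simp
      with I.wn_dot_eq[OF v' comb_L2 A]
      show "AE \<omega> in P. image_dG P m N e \<nu> D X F A \<omega> = wn_dot P (image_measure m X)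
          (image_Gamma_matrix m \<Gamma> X) (\<lambda>i. image_dG P m N e \<nu> D X (\<lambda>x. x $ i)) v A \<omega>"
        unfolding image_dG_def wn_image_def dG_def H_pairing_eq_H_integral
        by eventually_elim simp
    qed
    show "wn_eq P m (dG P m N e \<nu> D (F \<circ> X))
        (wn_dot P m (Gamma_matrix \<Gamma> X) (\<lambda>i. dG P m N e \<nu> D (\<lambda>w. X w $ i)) (v \<circ> X))"
      unfolding wn_eq_def
    proof
      fix A assume A: "A \<in> sets m"
      have "AE \<omega> in P. ?T (\<lambda>w. indicator A w *\<^sub>R D (F \<circ> X) w) \<omega>
          = ?T (\<lambda>w. indicator A w *\<^sub>R I.comb (\<lambda>i x. v x $ i) w) \<omega>"
        by (rule restricted[OF A]) simp
      with W.wn_dot_eq[OF vX comb_L2[folded comb] A]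
      show "AE \<omega> in P. dG P m N e \<nu> D (F \<circ> X) A \<omega> = wn_dot P m (Gamma_matrix \<Gamma> X)
          (\<lambda>i. dG P m N e \<nu> D (\<lambda>w. X w $ i)) (v \<circ> X) A \<omega>"
        unfolding comb dG_def H_pairing_eq_H_integral by eventually_elim (simp add: comp_def)
    qed
  qed
qed

end
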